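(* Let $S$ be a finite subset of $]0,+\infty[$ of size $|S|\leqslant 4$ satisfying the $4$-values condition. Then $\mathbf{U}_S$ is indivisible.
   Context: $S$ satisfies the $4$-values condition when for every $s_0,s_1,s_0',s_1'\in S$, if there is $t\in S$ with $|s_0-s_1|\leqslant t\leqslant s_0+s_1$ and $|s_0'-s_1'|\leqslant t\leqslant s_0'+s_1'$, then there is $u\in S$ with $|s_0-s_0'|\leqslant u\leqslant s_0+s_0'$ and $|s_1-s_1'|\leqslant u\leqslant s_1+s_1'$. In that case $\mathbf{U}_S$ denotes the unique (up to isometry) countable ultrahomogeneous metric space whose finite subspaces are, up to isometry, exactly the finite metric spaces with all distances between distinct points in $S$ (ultrahomogeneous: every isometry between finite subspaces extends to an isometry of the whole space onto itself). A metric space $X$ is indivisible when for every integer $k\geqslant1$ and every $\chi:X\to\{0,\dots,k-1\}$ there is a subspace $\widetilde X\subset X$ isometric to $X$ on which $\chi$ is constant. *)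

theory Defs
  imports "HOL-Analysis.Analysis"
begin

text \<open>Metric spaces are given by a carrier and a distance function as in \<^locale>\<open>Metric_space\<close>;
  a subspace is a subset of the carrier with the same distance function.\<close>

definition four_values_condition :: "real set \<Rightarrow> bool" where
  "four_values_condition S \<longleftrightarrow>
     (\<forall>s0\<in>S. \<forall>s1\<in>S. \<forall>s0'\<in>S. \<forall>s1'\<in>S.
        (\<exists>t\<in>S. \<bar>s0 - s1\<bar> \<le> t \<and> t \<le> s0 + s1 \<and> \<bar>s0' - s1'\<bar> \<le> t \<and> t \<le> s0' + s1') \<longrightarrow>
        (\<exists>u\<in>S. \<bar>s0 - s0'\<bar> \<le> u \<and> u \<le> s0 + s0' \<and> \<bar>s1 - s1'\<bar> \<le> u \<and> u \<le> s1 + s1'))"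

definition isometry_onto ::
  "'a set \<Rightarrow> ('a \<Rightarrow> 'a \<Rightarrow> real) \<Rightarrow> 'b set \<Rightarrow> ('b \<Rightarrow> 'b \<Rightarrow> real) \<Rightarrow> ('a \<Rightarrow> 'b) \<Rightarrow> bool" where
  "isometry_onto M d N e f \<longleftrightarrow>
     bij_betw f M N \<and> (\<forall>x\<in>M. \<forall>y\<in>M. e (f x) (f y) = d x y)"

definition isometric ::
  "'a set \<Rightarrow> ('a \<Rightarrow> 'a \<Rightarrow> real) \<Rightarrow> 'b set \<Rightarrow> ('b \<Rightarrow> 'b \<Rightarrow> real) \<Rightarrow> bool" where
  "isometric M d N e \<longleftrightarrow> (\<exists>f. isometry_onto M d N e f)"

definition distances_in :: "real set \<Rightarrow> 'a set \<Rightarrow> ('a \<Rightarrow> 'a \<Rightarrow> real) \<Rightarrow> bool" where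
  "distances_in S M d \<longleftrightarrow> (\<forall>x\<in>M. \<forall>y\<in>M. x \<noteq> y \<longrightarrow> d x y \<in> S)"

definition ultrahomogeneous :: "'a set \<Rightarrow> ('a \<Rightarrow> 'a \<Rightarrow> real) \<Rightarrow> bool" where
  "ultrahomogeneous M d \<longleftrightarrow>
     (\<forall>F G f. F \<subseteq> M \<and> G \<subseteq> M \<and> finite F \<and> finite G \<and> isometry_onto F d G d f \<longrightarrow>
        (\<exists>g. isometry_onto M d M d g \<and> (\<forall>x\<in>F. g x = f x)))"

text \<open>\<open>is_Urysohn S M d\<close>: the space \<open>(M, d)\<close> is (a copy of) \<open>\<^bold>U\<^sub>S\<close>.  A finite space
  isometric to one with distances in \<open>S\<close> has its own distances in \<open>S\<close>, which gives the first
  clause on finite subspaces.  In the converse clause the finite spaces range over those with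
  carrier a set of naturals, since every finite metric space is isometric to one of these.\<close>

definition is_Urysohn :: "real set \<Rightarrow> 'a set \<Rightarrow> ('a \<Rightarrow> 'a \<Rightarrow> real) \<Rightarrow> bool" where
  "is_Urysohn S M d \<longleftrightarrow>
     Metric_space M d \<and> countable M \<and> ultrahomogeneous M d \<and>
     (\<forall>F. F \<subseteq> M \<and> finite F \<longrightarrow> distances_in S F d) \<and>
     (\<forall>(N :: nat set) e. Metric_space N e \<and> finite N \<and> distances_in S N e \<longrightarrow>
        (\<exists>F\<subseteq>M. isometric N e F d))"

definition indivisible :: "'a set \<Rightarrow> ('a \<Rightarrow> 'a \<Rightarrow> real) \<Rightarrow> bool" where
  "indivisible M d \<longleftrightarrow>
     (\<forall>k::nat. k \<ge> 1 \<longrightarrow> (\<forall>col \<in> M \<rightarrow> {..<k}.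
        \<exists>M'\<subseteq>M. isometric M' d M d \<and> (\<exists>c. \<forall>x\<in>M'. col x = c)))"

end

theory Submission
  imports Defs
begin

text \<open>Let \<open>a \<oplus> b\<close> be the largest element of \<open>S \<union> {0}\<close> not exceeding \<open>a + b\<close>, and \<open>M = Max S\<close>. The
  4-values condition says that \<open>\<oplus>\<close> is associative, so that shortest paths with respect to \<open>\<oplus>\<close> provide
  amalgams. It suffices to treat two colours, and to find, for every set \<open>R\<close> of points, a subset
  realising all its own one-point extensions that lies inside \<open>R\<close> or inside the complement of \<open>R\<close>.

  Call a distance \<open>s\<close> large if \<open>s \<oplus> s = M\<close>. The points of a prescribed type over a finite set all of
  whose distances are large form again a copy of the space. Hence, in a counterexample, both colours
  occur in every such orbit. One then tries to build a red copy point by point, shrinking the ambient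
  copy at each step, so that every type with some distance that is not large remains rich in red
  points. As \<open>|S| \<le> 4\<close>, the element \<open>i = 4 Min S\<close> (a multiple for \<open>\<oplus>\<close>) is idempotent, which leaves four
  cases.

  If \<open>i = M\<close>, then all sums are large: a type that is not rich in blue becomes rich in red
  after shrinking, at the price of auxiliary points, which are forgotten by shrinking once more. If
  the distances that are not large form clusters in which any two of them sum to the same \<open>i\<close>, then
  the set of types that are hereditarily red somewhere in a cluster is a colour of the cluster, and a
  cluster whose colour persists must have all types in it. If \<open>S = {a, b, c, M}\<close> with \<open>a\<close> and \<open>b\<close>
  idempotent and otherwise \<open>s \<oplus> t = M\<close> for \<open>t > b\<close>, then the distances above \<open>b\<close> do not constrain one
  another, and either red points are cofinite in enough clusters, or blue ones are infinite in
  enough. Finally, if an idempotent \<open>e < M\<close> is absorbed by all larger distances, then the space is a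
  lexicographic composition of spaces over smaller sets of distances.\<close>

section \<open>Rounded addition\<close>

text \<open>The colours play asymmetric roles. If a type is not \<open>rich\<close> in blue, then
  only some refinement of it over a larger finite set has all its realisations red. The obstacle is
  that the extra points cannot be kept in the copy, as nothing controls their own colours. So the
  ambient copy is shrunk until the distances to the kept points determine those to the auxiliary
  ones (\<open>forget_points\<close>). This needs every distance allowed between the prescribed
  types over the kept points to remain allowed over the auxiliary ones; the hypotheses of the first
  two cases and the choice of closest representatives serve to guarantee it. Types with large
  distances only need no bookkeeping, since both colours occur in their orbits in every copy. The
  bound four enters through chains: if 4 \<open>Min S\<close> did not absorb \<open>Min S\<close>,
  then the first five multiples of \<open>Min S\<close> would be five elements of \<open>S\<close>.
  In the case of two idempotents richness is replaced by counting points within classes and classes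
  within blocks, and nothing is shrunk.\<close>

definition rnd :: "real set \<Rightarrow> real \<Rightarrow> real" where
  "rnd S x = Max (insert 0 {s \<in> S. s \<le> x})"

text \<open>The arguments are rounded as well, so that \<open>oplus S\<close> is associative on all reals.\<close>

definition oplus :: "real set \<Rightarrow> real \<Rightarrow> real \<Rightarrow> real" where
  "oplus S a b = rnd S (rnd S a + rnd S b)"

definition tri :: "real \<Rightarrow> real \<Rightarrow> real \<Rightarrow> bool" where
  "tri a b c \<longleftrightarrow> a \<le> b + c \<and> b \<le> a + c \<and> c \<le> a + b"

text \<open>The one-point extension property for Katetov maps with values in \<open>S\<close>. With
  \<open>S\<close> positive and \<open>d\<close> zero on the diagonal, the realising point lies
  outside \<open>E\<close>; the case \<open>E = {}\<close> makes \<open>Y\<close> non-empty.\<close>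

definition saturated :: "real set \<Rightarrow> ('a \<Rightarrow> 'a \<Rightarrow> real) \<Rightarrow> 'a set \<Rightarrow> bool" where
  "saturated S d Y \<longleftrightarrow> (\<forall>E f. finite E \<and> E \<subseteq> Y \<and> (\<forall>x\<in>E. f x \<in> S) \<and>
     (\<forall>x\<in>E. \<forall>y\<in>E. tri (f x) (f y) (d x y)) \<longrightarrow> (\<exists>z\<in>Y. \<forall>x\<in>E. d z x = f x))"

lemma tri_commute: "tri a b c \<longleftrightarrow> tri b a c" "tri a b c \<longleftrightarrow> tri a c b"
  by (auto simp: tri_def algebra_simps)

locale distance_set =
  fixes S :: "real set"
  assumes finite_S: "finite S" and S_nonempty: "S \<noteq> {}" and S_pos: "S \<subseteq> {0<..}"
    and assoc_S: "\<And>a b c. \<lbrakk>a \<in> S; b \<in> S; c \<in> S\<rbrakk> \<Longrightarrow>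
      oplus S (oplus S a b) c = oplus S a (oplus S b c)"
begin

abbreviation plus_S (infixl "\<oplus>" 65) where "a \<oplus> b \<equiv> oplus S a b"

definition "S0 = insert 0 S"

lemma S_S0: "a \<in> S \<Longrightarrow> a \<in> S0" by (simp add: S0_def)

lemma zero_S0 [simp]: "0 \<in> S0" by (simp add: S0_def)

definition "M = Max S"

lemma S0_nonneg: "a \<in> S0 \<Longrightarrow> 0 \<le> a"
  using S_pos by (auto simp: S0_def)

lemma rnd_in: "rnd S x \<in> S0"
proof -
  have "rnd S x \<in> insert 0 {s \<in> S. s \<le> x}"
    unfolding rnd_def using finite_S by (intro Max_in) auto
  then show ?thesis by (auto simp: S0_def)
qed

lemma rnd_nonneg: "0 \<le> rnd S x"
  using rnd_in S0_nonneg by blast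

text \<open>For negative \<open>x\<close> the inserted 0 exceeds \<open>x\<close>, hence the
  hypothesis.\<close>

lemma rnd_le: "0 \<le> x \<Longrightarrow> rnd S x \<le> x"
  unfolding rnd_def using finite_S by (subst Max_le_iff) auto

lemma le_rnd: "s \<in> S0 \<Longrightarrow> s \<le> x \<Longrightarrow> s \<le> rnd S x"
  unfolding rnd_def using finite_S by (intro Max_ge) (auto simp: S0_def)

lemma rnd_id [simp]: "a \<in> S0 \<Longrightarrow> rnd S a = a"
  using le_rnd[of a a] rnd_le[of a] S0_nonneg[of a] by force

lemma rnd_rnd [simp]: "rnd S (rnd S x) = rnd S x"
  using rnd_in rnd_id by blast

lemma rnd_mono: "x \<le> y \<Longrightarrow> rnd S x \<le> rnd S y"
proof -
  assume "x \<le> y"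
  then show ?thesis
    unfolding rnd_def using finite_S by (intro Max_mono) auto
qed

lemma oplus_in [simp]: "a \<oplus> b \<in> S0"
  unfolding oplus_def by (rule rnd_in)

lemma oplus_nonneg [simp]: "0 \<le> a \<oplus> b"
  using oplus_in S0_nonneg by blast

lemma oplus_comm: "a \<oplus> b = b \<oplus> a"
  unfolding oplus_def by (simp add: add.commute)

lemma oplus_rnd [simp]: "rnd S a \<oplus> b = a \<oplus> b" "a \<oplus> rnd S b = a \<oplus> b"
  unfolding oplus_def by simp_all

lemma oplus_0 [simp]: "a \<in> S0 \<Longrightarrow> a \<oplus> 0 = a" "a \<in> S0 \<Longrightarrow> 0 \<oplus> a = a"
  unfolding oplus_def by simp_all

lemma assoc_S0: 
  assumes "a \<in> S0" "b \<in> S0" "c \<in> S0"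
  shows "(a \<oplus> b) \<oplus> c = a \<oplus> (b \<oplus> c)"
proof -
  consider "a = 0" | "b = 0" | "c = 0" | "a \<in> S" "b \<in> S" "c \<in> S" using assms by (auto simp: S0_def)
  then show ?thesis by cases (use assms assoc_S in auto)
qed

lemma oplus_assoc: "(a \<oplus> b) \<oplus> c = a \<oplus> (b \<oplus> c)"
  using assoc_S0[OF rnd_in rnd_in rnd_in, of a b c] by simp

sublocale op: abel_semigroup "oplus S"
  by unfold_locales (rule oplus_assoc, rule oplus_comm)

lemmas oplus_ac = op.assoc op.commute op.left_commute

lemma oplus_mono: "a \<le> a' \<Longrightarrow> b \<le> b' \<Longrightarrow> a \<oplus> b \<le> a' \<oplus> b'"
  unfolding oplus_def by (intro rnd_mono add_mono)

lemma le_oplus: "\<lbrakk>s \<in> S0; s \<le> a + b; a \<in> S0; b \<in> S0\<rbrakk> \<Longrightarrow> s \<le> a \<oplus> b"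
  unfolding oplus_def using le_rnd by simp

lemma oplus_le: "\<lbrakk>a \<in> S0; b \<in> S0\<rbrakk> \<Longrightarrow> a \<oplus> b \<le> a + b"
  unfolding oplus_def using rnd_le[of "a + b"] S0_nonneg[of a] S0_nonneg[of b] by simp

text \<open>Rounding down never drops below an element of \<open>S0\<close> that is at most the sum.
  Hence real triangle inequalities between elements of \<open>S0\<close> are triangle inequalities
  for \<oplus>, the form in which associativity can be used.\<close>

lemma le_oplus_iff: "\<lbrakk>s \<in> S0; a \<in> S0; b \<in> S0\<rbrakk> \<Longrightarrow> s \<le> a \<oplus> b \<longleftrightarrow> s \<le> a + b"
  using le_oplus[of s a b] oplus_le[of a b] by linarith

lemma le_oplus1: "a \<in> S0 \<Longrightarrow> a \<le> a \<oplus> b"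
  using le_oplus[of a a "rnd S b"] rnd_in[of b] rnd_nonneg[of b] by (metis le_add_same_cancel1 oplus_rnd(2))

lemma le_oplus2: "a \<in> S0 \<Longrightarrow> a \<le> b \<oplus> a"
  using le_oplus1 oplus_comm by metis

lemma oplus_pos: "a \<in> S \<Longrightarrow> 0 < a \<oplus> b" "a \<in> S \<Longrightarrow> 0 < b \<oplus> a"
  using le_oplus1[OF S_S0, of a b] le_oplus2[OF S_S0, of a b] S_pos by force+

lemma oplus_in_S: "a \<in> S \<Longrightarrow> a \<oplus> b \<in> S" "a \<in> S \<Longrightarrow> b \<oplus> a \<in> S"
  using oplus_pos[of a b] oplus_in[of a b] oplus_in[of b a] by (auto simp: S0_def)

lemma tri_iff: "\<lbrakk>a \<in> S0; b \<in> S0; c \<in> S0\<rbrakk> \<Longrightarrow> tri a b c \<longleftrightarrow> a \<le> b \<oplus> c \<and> b \<le> a \<oplus> c \<and> c \<le> a \<oplus> b"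
  unfolding tri_def by (simp add: le_oplus_iff)

lemma M_in: "M \<in> S" unfolding M_def using finite_S S_nonempty by simp

lemma le_M: "a \<in> S0 \<Longrightarrow> a \<le> M"
  using finite_S M_in S_pos unfolding M_def S0_def by auto

lemma oplus_M [simp]: "a \<oplus> M = M" "M \<oplus> a = M"
  using le_oplus2[OF S_S0[OF M_in], of a] le_oplus1[OF S_S0[OF M_in], of a] le_M[OF oplus_in]
  by (auto intro: antisym)

lemma oplus_le_M: "a \<oplus> b \<le> M"
  using le_M oplus_in by blast

definition "large s \<longleftrightarrow> s \<oplus> s = M"

lemma large_mono: "large s \<Longrightarrow> s \<le> t \<Longrightarrow> large t"
  unfolding large_def using oplus_mono[of s t s t] oplus_le_M[of t t] by simp

lemma large_M: "large M" by (simp add: large_def)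

end

section \<open>Saturated sets\<close>

text \<open>The carrier is all of \<open>nat\<close>, so copies are plain sets, and the well-order
  supplies least representatives of classes later on.\<close>

locale urysohn_nat = distance_set +
  fixes d :: "nat \<Rightarrow> nat \<Rightarrow> real"
  assumes d_eq_0 [simp]: "d x y = 0 \<longleftrightarrow> x = y"
    and d_sym: "d x y = d y x"
    and d_in_S: "x \<noteq> y \<Longrightarrow> d x y \<in> S"
    and d_triangle: "d x z \<le> d x y + d y z"
    and sat_UNIV: "saturated S d UNIV"
begin

abbreviation "sat \<equiv> saturated S d"

lemma d_self [simp]: "d x x = 0" by simp

lemma d_in [simp]: "d x y \<in> S0"
  using d_in_S[of x y] d_eq_0[of x y] by (cases "x = y") (auto simp: S0_def)

lemma d_nonneg [simp]: "0 \<le> d x y" using d_in S0_nonneg by blast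

lemma d_tri: "d x z \<le> d x y \<oplus> d y z"
  using d_triangle by (simp add: le_oplus_iff)

lemma d_le_M: "d x y \<le> M" by (rule le_M) simp

lemma tri_d: "tri (d z x) (d z y) (d x y)"
  unfolding tri_def using d_triangle[of z x y] d_triangle[of z y x] d_triangle[of x y z] d_sym by (auto simp: algebra_simps)

text \<open>A type over \<open>E\<close> is represented by any point outside \<open>E\<close> that
  realises it; since the whole space is saturated, every type has such a point.\<close>

definition eqv :: "nat set \<Rightarrow> nat \<Rightarrow> nat \<Rightarrow> bool" where
  "eqv E y w \<longleftrightarrow> (\<forall>x\<in>E. d y x = d w x)"

lemma eqv_refl [simp]: "eqv E w w" by (simp add: eqv_def)

lemma eqv_sym: "eqv E y w \<Longrightarrow> eqv E w y" by (simp add: eqv_def)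

lemma eqv_trans: "eqv E y w \<Longrightarrow> eqv E w v \<Longrightarrow> eqv E y v" by (simp add: eqv_def)

lemma eqv_subset: "eqv E y w \<Longrightarrow> F \<subseteq> E \<Longrightarrow> eqv F y w" by (auto simp: eqv_def)

lemma eqv_insert [simp]: "eqv (insert x E) y w \<longleftrightarrow> d y x = d w x \<and> eqv E y w"
  by (simp add: eqv_def)

lemma eqv_Un [simp]: "eqv (E \<union> F) y w \<longleftrightarrow> eqv E y w \<and> eqv F y w"
  by (auto simp: eqv_def)

lemma eqv_notin: "eqv E y w \<Longrightarrow> w \<notin> E \<Longrightarrow> y \<notin> E"
  using d_eq_0 unfolding eqv_def by metis

lemma realize:
  assumes "finite E" "\<And>x. x \<in> E \<Longrightarrow> f x \<in> S"
    and "\<And>x y. \<lbrakk>x \<in> E; y \<in> E; x \<noteq> y\<rbrakk> \<Longrightarrow> tri (f x) (f y) (d x y)"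
  obtains z where "z \<notin> E" "\<And>x. x \<in> E \<Longrightarrow> d z x = f x"
proof -
  have "tri (f x) (f y) (d x y)" if "x \<in> E" "y \<in> E" for x y
    using assms(3)[OF that] assms(2)[OF that(1)] S_pos unfolding tri_def
    by (cases "x = y") (auto dest: less_imp_le)
  then obtain z where z: "\<forall>x\<in>E. d z x = f x"
    using sat_UNIV[unfolded saturated_def, rule_format, of E f] assms(1,2) by auto
  moreover have "z \<notin> E" using z assms(2) S_pos d_eq_0 by fastforce
  ultimately show thesis using that by auto
qed

lemma sat_pt:
  assumes "sat Y" "finite E" "E \<subseteq> Y" "w \<notin> E"
  obtains y where "y \<in> Y" "eqv E y w" "y \<notin> E"
proof -
  have "\<forall>x\<in>E. d w x \<in> S" using assms(4) d_in_S by metis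
  then obtain y where "y \<in> Y" "\<forall>x\<in>E. d y x = d w x"
    using assms(1-3) tri_d[of w] unfolding saturated_def by (metis (no_types, lifting))
  then show thesis using that eqv_notin assms(4) unfolding eqv_def by blast
qed

lemma sat_ptI:
  assumes "\<And>E w. \<lbrakk>finite E; E \<subseteq> Y; w \<notin> E\<rbrakk> \<Longrightarrow> \<exists>y\<in>Y. eqv E y w"
  shows "sat Y"
  unfolding saturated_def
proof (intro allI impI)
  fix E f assume a: "finite E \<and> E \<subseteq> Y \<and> (\<forall>x\<in>E. f x \<in> S) \<and> (\<forall>x\<in>E. \<forall>y\<in>E. tri (f x) (f y) (d x y))"
  obtain z where "z \<notin> E" "\<And>x. x \<in> E \<Longrightarrow> d z x = f x" using realize[of E f] a by auto
  then show "\<exists>z\<in>Y. \<forall>x\<in>E. d z x = f x" using assms[of E z] a unfolding eqv_def by auto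
qed

text \<open>A point that copies the distances of \<open>w\<close> and is put at distance
  \<open>t\<close> from \<open>w\<close> can violate only the inequality bounding \<open>t\<close>
  by twice a distance of \<open>w\<close>.\<close>

lemma twin:
  assumes "finite E" "t \<in> S"  "\<And>x. x \<noteq> w \<Longrightarrow> t \<le> d w x \<oplus> d w x"
  obtains v where "v \<notin> E" "v \<noteq> w" "eqv (E - {w}) v w" "d v w = t"
proof -
  define f where "f x = (if x = w then t else d w x)" for x
  have tr: "tri (f x) (f y) (d x y)" if "x \<noteq> y" for x y
  proof -
    have le: "t \<le> d w z + d w z" if "z \<noteq> w" for z
      using assms(3)[OF that] le_oplus_iff[OF S_S0[OF assms(2)] d_in d_in] by blast
    show ?thesis
      using tri_d[of w x y] assms(2) le[of x] le[of y] S_pos that d_sym[of x w]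
      by (auto simp: f_def tri_def)
  qed
  obtain v where v: "v \<notin> insert w E" "\<And>x. x \<in> insert w E \<Longrightarrow> d v x = f x"
  proof (rule realize[of "insert w E" f])
    show "f x \<in> S" for x using assms(2) d_in_S[of w x] by (auto simp: f_def)
  qed (use tr assms(1) in auto)
  show thesis using that[of v] v by (auto simp: eqv_def f_def)
qed

text \<open>For \<open>t = Min S\<close> the condition of \<open>twin\<close> always holds, so a
  type can be realised off any finite set.\<close>

lemma fresh:
  assumes "finite E" "finite D" "w \<notin> D"
  obtains v where "v \<notin> E" "eqv D v w"
proof -
  define a where "a = Min S"
  have a: "a \<in> S" "\<And>s. s \<in> S \<Longrightarrow> a \<le> s" unfolding a_def using finite_S S_nonempty by auto
  have "a \<le> d w x \<oplus> d w x" if "x \<noteq> w" for x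
    using a(2)[OF d_in_S[of w x]] le_oplus1[OF d_in, of w x "d w x"] that by force
  from twin[OF _ a(1) this, of "E \<union> D"] obtain v where "v \<notin> E \<union> D" "eqv (E \<union> D - {w}) v w"
    using assms(1,2) by blast
  then show thesis using that[of v] assms(3) by (auto simp: eqv_def)
qed

text \<open>The free amalgam of \<open>w\<close> with \<open>E\<close> over \<open>D\<close>.\<close>

lemma free_point:
  assumes "finite E" "D \<subseteq> E" "w \<notin> D"
  obtains p where "p \<notin> E" "eqv D p w"
    "\<And>y. y \<in> E - D \<Longrightarrow> d p y = M \<or> (\<exists>x\<in>D. d p y = d w x \<oplus> d x y)"
proof -
  \<comment> \<open>Lengths of paths through one point of \<open>D\<close>, capped at
    \<open>M\<close>. The minimum is the shortest-path distance; associativity yields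
    \<open>lip\<close> and \<open>up\<close> below.\<close>
  define P where "P y = insert M ((\<lambda>x. d w x \<oplus> d x y) ` D)" for y
  define f where "f y = (if y \<in> D then d w y else Min (P y))" for y
  have fD: "finite D" using assms(1,2) finite_subset by blast
  have P_in: "P y \<subseteq> S" for y
    using M_in assms(3) d_in_S oplus_in_S(1) unfolding P_def by (metis (no_types, lifting) image_subset_iff insert_subset)
  have fP: "finite (P y)" "P y \<noteq> {}" for y using fD by (auto simp: P_def)
  have f_in: "f y \<in> S" for y
  proof (cases "y \<in> D")
    case True
    then show ?thesis using d_in_S[of w y] assms(3) by (auto simp: f_def)
  next
    case False
    then show ?thesis using P_in[of y] fP(2)[of y] Min_in[OF fP, of y] by (auto simp: f_def)
  qed
  have f_in0: "f y \<in> S0" for y using f_in S_S0 by blast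
  have fP_in: "f y \<in> P y" for y
  proof (cases "y \<in> D")
    case True
    then have "f y = d w y \<oplus> d y y" by (simp add: f_def)
    then show ?thesis using True unfolding P_def by blast
  qed (use fP Min_in in \<open>auto simp: f_def\<close>)
  have f_le: "f y \<le> d w x \<oplus> d x y" if "x \<in> D" for x y
    using d_tri[of w y x] fP that by (auto simp: f_def P_def)
  have f_leM: "f y \<le> M" for y using f_in0 le_M by blast
  have lip: "f y \<le> f y' \<oplus> d y' y" for y y'
  proof -
    consider "f y' = M" | x where "x \<in> D" "f y' = d w x \<oplus> d x y'" using fP_in[of y'] by (auto simp: P_def)
    then show ?thesis
    proof cases
      case 1 then show ?thesis using f_leM by simp
    next
      case 2
      have "f y \<le> d w x \<oplus> d x y" using f_le 2 by blast
      also have "\<dots> \<le> d w x \<oplus> (d x y' \<oplus> d y' y)" by (intro oplus_mono d_tri) simp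
      finally show ?thesis using 2 by (simp add: oplus_assoc)
    qed
  qed
  have up: "d y y' \<le> f y \<oplus> f y'" for y y'
  proof -
    consider "f y = M" | "f y' = M" | x x' where "x \<in> D" "f y = d w x \<oplus> d x y" "x' \<in> D" "f y' = d w x' \<oplus> d x' y'"
      using fP_in[of y'] fP_in[of y] by (auto simp: P_def)
    then show ?thesis
    proof cases
      case 3
      have "d y y' \<le> d y x \<oplus> d x y'" by (rule d_tri)
      also have "\<dots> \<le> d y x \<oplus> (d x x' \<oplus> d x' y')" by (intro oplus_mono d_tri) simp
      also have "\<dots> \<le> d y x \<oplus> ((d x w \<oplus> d w x') \<oplus> d x' y')" by (intro oplus_mono d_tri) simp_all
      finally show ?thesis using 3 by (simp add: d_sym[of x w] d_sym[of y x] oplus_ac)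
    qed (simp_all add: d_le_M)
  qed
  obtain p where p: "p \<notin> E" "\<And>y. y \<in> E \<Longrightarrow> d p y = f y"
  proof (rule realize[OF assms(1), of f])
    show "tri (f x) (f y) (d x y)" for x y
      using lip[of x y] lip[of y x] up[of x y] by (simp add: tri_iff f_in0 d_sym[of y x])
  qed (use f_in in auto)
  show thesis
  proof (rule that)
    show "eqv D p w" using p assms(2) by (auto simp: eqv_def f_def)
    show "d p y = M \<or> (\<exists>x\<in>D. d p y = d w x \<oplus> d x y)" if "y \<in> E - D" for y
      using fP_in[of y] p(2)[of y] that by (auto simp: P_def)
  qed (rule p)
qed

section \<open>Partial isometries between finite sets\<close>

definition isom_on :: "nat set \<Rightarrow> (nat \<Rightarrow> nat) \<Rightarrow> bool" where
  "isom_on A f \<longleftrightarrow> (\<forall>u\<in>A. \<forall>v\<in>A. d (f u) (f v) = d u v)"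

text \<open>One point at a time: its distances are carried over to the image and realised there by
  saturation of the whole space.\<close>

lemma isom_extend:
  assumes "finite C" "finite A" "isom_on A f"
  obtains g where "isom_on (A \<union> C) g" "\<And>u. u \<in> A \<Longrightarrow> g u = f u"
proof -
  have "\<exists>g. isom_on (A \<union> C) g \<and> (\<forall>u\<in>A. g u = f u)"
    using assms(1)
  proof (induction C)
    case empty
    then show ?case using assms(3) by auto
  next
    case (insert c C)
    then obtain g where g: "isom_on (A \<union> C) g" "\<forall>u\<in>A. g u = f u" by blast
    show ?case
    proof (cases "c \<in> A \<union> C")
      case True
      then show ?thesis using g by (metis Un_insert_right insert_absorb)
    next
      case False
      let ?A = "A \<union> C"
      have inj: "inj_on g ?A"
        using g(1) unfolding isom_on_def inj_on_def by (metis d_eq_0)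
      define h where "h y = d c (inv_into ?A g y)" for y
      have h: "h (g u) = d c u" if "u \<in> ?A" for u using inj that by (simp add: h_def)
      obtain z where z: "z \<notin> g ` ?A" "\<And>y. y \<in> g ` ?A \<Longrightarrow> d z y = h y"
      proof (rule realize[of "g ` ?A" h])
        show "finite (g ` ?A)" using insert assms(2) by simp
        show "h x \<in> S" if "x \<in> g ` ?A" for x using that h False d_in_S by (metis imageE)
        show "tri (h x) (h y) (d x y)" if xy: "x \<in> g ` ?A" "y \<in> g ` ?A" for x y
        proof -
          obtain u v where "u \<in> ?A" "v \<in> ?A" "x = g u" "y = g v" using xy by blast
          then have "h x = d c u" "h y = d c v" "d x y = d u v"
            using h g(1) unfolding isom_on_def by blast+
          then show ?thesis by (simp only: tri_d)
        qed
      qed blast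
      have "d z (g u) = d c u" if "u \<in> ?A" for u
        using z(2)[OF imageI[OF that]] h[OF that] by simp
      then have "isom_on (insert c ?A) (g(c := z))"
        using g(1) False unfolding isom_on_def by (auto simp: d_sym[of _ z] d_sym[of _ c])
      moreover have "\<forall>u\<in>A. (g(c := z)) u = f u" using g(2) False by auto
      ultimately show ?thesis by (metis Un_insert_right)
    qed
  qed
  then show thesis using that by blast
qed

text \<open>Stands in for an automorphism fixing \<open>B\<close> and taking \<open>p\<close> to
  \<open>x\<close>; only the finitely many points of \<open>C\<close> have to follow.\<close>

lemma move:
  assumes "finite B" "finite C" "eqv B x p" "p \<notin> B"
  obtains f where "isom_on (insert p B \<union> C) f" "\<And>b. b \<in> B \<Longrightarrow> f b = b" "f p = x"
proof -
  define f where "f = id(p := x)"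
  have "isom_on (insert p B) f"
    unfolding isom_on_def
  proof (intro ballI)
    fix u v assume "u \<in> insert p B" "v \<in> insert p B"
    moreover have "d x b = d p b" "d b x = d b p" if "b \<in> B" for b
      using assms(3) that d_sym[of b] by (auto simp: eqv_def)
    moreover have "d x x = d p p" by simp
    ultimately show "d (f u) (f v) = d u v" using assms(4) by (auto simp: f_def)
  qed
  from isom_extend[OF assms(2) _ this] obtain g where
    "isom_on (insert p B \<union> C) g" "\<And>u. u \<in> insert p B \<Longrightarrow> g u = f u" using assms(1) by blast
  then show thesis using that[of g] assms(4) by (simp add: f_def) (metis id_apply)
qed

lemma isom_onD: "isom_on A f \<Longrightarrow> u \<in> A \<Longrightarrow> v \<in> A \<Longrightarrow> d (f u) (f v) = d u v"
  by (simp add: isom_on_def)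

text \<open>A fusion argument: each type over each finite set of chosen points is met at some stage
  and realised then, while the ambient copy may shrink.\<close>

lemma build:
  assumes init: "I F0 Y0"
    and inv: "\<And>F Y. I F Y \<Longrightarrow> finite F \<and> F \<subseteq> Y \<and> sat Y"
    and step: "\<And>F Y w. \<lbrakk>I F Y; w \<in> Y; w \<notin> F\<rbrakk> \<Longrightarrow> \<exists>y Y'. Y' \<subseteq> Y \<and> eqv F y w \<and> I (insert y F) Y'"
  obtains Z where "F0 \<subseteq> Z" "Z \<subseteq> Y0" "sat Z"
    "\<And>G. \<lbrakk>finite G; G \<subseteq> Z\<rbrakk> \<Longrightarrow> \<exists>F Y. I F Y \<and> G \<subseteq> F \<and> F \<subseteq> Z"
proof -
  \<comment> \<open>\<open>n\<close> codes a triple (\<open>E\<close>, \<open>w\<close>,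
    \<open>k\<close>). The last component is ignored here; it makes each pair recur at a stage
    \<open>n\<close> not before \<open>k\<close>, when \<open>E\<close> already consists of chosen
    points.\<close>
  define E where "E n = set_decode (fst (prod_decode (fst (prod_decode n))))" for n
  define w where "w n = snd (prod_decode (fst (prod_decode n)))" for n
  define Q where "Q n s s' \<longleftrightarrow> fst s \<subseteq> fst s' \<and> snd s' \<subseteq> snd s \<and>
     (E n \<subseteq> fst s \<and> w n \<notin> E n \<longrightarrow> (\<exists>y\<in>fst s'. eqv (E n) y (w n)))" for n and s s' :: "nat set \<times> nat set"
  have "\<exists>s'. I (fst s') (snd s') \<and> Q n s s'" if I: "I (fst s) (snd s)" for s n
  proof (cases "E n \<subseteq> fst s \<and> w n \<notin> E n \<and> w n \<notin> fst s")
    case False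
    then have "E n \<subseteq> fst s \<and> w n \<notin> E n \<longrightarrow> (\<exists>y\<in>fst s. eqv (E n) y (w n))"
      using eqv_refl by blast
    then show ?thesis using I by (intro exI[of _ s]) (simp add: Q_def)
  next
    case True
    \<comment> \<open>\<open>step\<close> wants a point of the current ambient copy, while
      \<open>w n\<close> is arbitrary. Its type over all chosen points is first realised
      there.\<close>
    obtain w1 where w1: "w1 \<in> snd s" "eqv (fst s) w1 (w n)" "w1 \<notin> fst s"
      using sat_pt[of "snd s" "fst s" "w n"] True inv[OF I] by blast
    from step[OF I w1(1,3)] obtain y Y' where
      y: "Y' \<subseteq> snd s" "eqv (fst s) y w1" "I (insert y (fst s)) Y'" by blast
    have "eqv (E n) y (w n)" using y(2) w1(2) True by (meson eqv_subset eqv_trans)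
    then show ?thesis using y by (intro exI[of _ "(insert y (fst s), Y')"]) (auto simp: Q_def)
  qed
  then obtain s where s: "\<And>n. I (fst (s n)) (snd (s n))" "\<And>n. Q n (s n) (s (Suc n))" "s 0 = (F0, Y0)"
    using dependent_nat_choice[of "\<lambda>n s. I (fst s) (snd s) \<and> (n = 0 \<longrightarrow> s = (F0, Y0))" Q] init
    by (metis fst_conv nat.distinct(1) snd_conv)
  have mono: "fst (s m) \<subseteq> fst (s n)" "snd (s n) \<subseteq> snd (s m)" if "m \<le> n" for m n
    using lift_Suc_mono_le[of "\<lambda>n. fst (s n)" m n] lift_Suc_antimono_le[of "\<lambda>n. snd (s n)" m n] that s(2)
    by (auto simp: Q_def)
  define Z where "Z = (\<Union>n. fst (s n))"
  have cover: "\<exists>n. G \<subseteq> fst (s n)" if "finite G" "G \<subseteq> Z" for G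
    using that
  proof (induction G)
    case (insert g G)
    then obtain m n where "g \<in> fst (s m)" "G \<subseteq> fst (s n)" by (auto simp: Z_def)
    then show ?case using mono(1)[of m "max m n"] mono(1)[of n "max m n"]
      by (intro exI[of _ "max m n"]) auto
  qed simp
  show thesis
  proof (rule that)
    show "F0 \<subseteq> Z" using UN_upper[of 0 UNIV "\<lambda>n. fst (s n)"] s(3) unfolding Z_def by simp
    show "Z \<subseteq> Y0" using mono(2)[of 0] s(3) inv[OF s(1)] by (fastforce simp: Z_def)
    show "\<exists>F Y. I F Y \<and> G \<subseteq> F \<and> F \<subseteq> Z" if "finite G" "G \<subseteq> Z" for G
      using cover[OF that] s(1) unfolding Z_def by blast
    show "sat Z"
    proof (rule sat_ptI)
      fix G v assume G: "finite G" "G \<subseteq> Z" "v \<notin> G"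
      from cover[OF G(1,2)] obtain k where k: "G \<subseteq> fst (s k)" by blast
      define n where "n = prod_encode (prod_encode (set_encode G, v), k)"
      have "E n = G" "w n = v" using G(1) by (auto simp: n_def E_def w_def)
      moreover have "k \<le> n" unfolding n_def by (rule le_prod_encode_2)
      ultimately have "\<exists>y\<in>fst (s (Suc n)). eqv G y v"
        using s(2)[of n] k mono(1)[of k n] G(3) unfolding Q_def by blast
      then show "\<exists>y\<in>Z. eqv G y v" unfolding Z_def by blast
    qed
  qed
qed

text \<open>Two points of the orbit and a point \<open>p\<close> of \<open>F\<close> form a triangle
  with two sides \<open>d h p\<close>, whose base is unconstrained because \<open>d h p\<close> is
  large. So distances within the orbit can be prescribed independently of those to
  \<open>F\<close>.\<close>

lemma sat_large_orbit:
  assumes "sat Y" "finite F" "F \<subseteq> Y" "h \<notin> F" "\<And>p. p \<in> F \<Longrightarrow> large (d h p)"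
  shows "sat {y \<in> Y. eqv F y h}"
proof (rule sat_ptI)
  fix E w assume E: "finite E" "E \<subseteq> {y \<in> Y. eqv F y h}" "w \<notin> E"
  define f where "f x = (if x \<in> F then d h x else d w x)" for x
  have disj: "x \<notin> F" if "x \<in> E" for x using that E(2) assms(4) eqv_notin by blast
  have M2: "M \<le> d h p + d h p" if "p \<in> F" for p
    using assms(5)[OF that] oplus_le[OF d_in d_in, of h p h p] by (simp add: large_def)
  have cross: "tri (d h p) (d w e) (d p e)" if "p \<in> F" "e \<in> E" for p e
  proof -
    have "d p e = d h p" using that E(2) d_sym[of e p] by (auto simp: eqv_def)
    then show ?thesis using M2[OF that(1)] d_le_M[of w e] d_nonneg[of w e] d_nonneg[of h p] by (auto simp: tri_def)
  qed
  obtain z where z: "z \<notin> F \<union> E" "\<And>x. x \<in> F \<union> E \<Longrightarrow> d z x = f x"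
  proof (rule realize[of "F \<union> E" f])
    show "finite (F \<union> E)" using assms(2) E(1) by blast
    show "f x \<in> S" if "x \<in> F \<union> E" for x using that d_in_S[of h x] d_in_S[of w x] assms(4) E(3) by (auto simp: f_def)
    show "tri (f x) (f y) (d x y)" if "x \<in> F \<union> E" "y \<in> F \<union> E" for x y
      using that disj cross[of x y] cross[of y x] tri_d[of h x y] tri_d[of w x y] tri_commute
      by (auto simp: f_def d_sym[of y x])
  qed blast
  obtain y where "y \<in> Y" "eqv (F \<union> E) y z"
    using sat_pt[OF assms(1), of "F \<union> E" z] assms(2,3) E(1,2) z(1) by blast
  then show "\<exists>y\<in>{y \<in> Y. eqv F y h}. eqv E y w"
    using z disj by (intro bexI[of _ y]) (auto simp: eqv_def f_def)
qed

text \<open>The source of contradictions: the orbit of \<open>h\<close> is a copy, so realising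
  \<open>P\<close> in all refinements of its type gives a copy consisting of points with
  \<open>P\<close>.\<close>

lemma large_build:
  assumes "sat Y" "finite F" "F \<subseteq> Y" "h \<notin> F" "\<And>p. p \<in> F \<Longrightarrow> large (d h p)"
    and step: "\<And>G v. \<lbrakk>finite G; G \<subseteq> {y \<in> Y. eqv F y h \<and> P y}; v \<notin> F \<union> G; eqv F v h\<rbrakk> \<Longrightarrow>
        \<exists>y\<in>Y. eqv (F \<union> G) y v \<and> P y"
  obtains Z where "sat Z" "Z \<subseteq> {y \<in> Y. P y}"
proof -
  define Y' where "Y' = {y \<in> Y. eqv F y h}"
  have satY': "sat Y'" unfolding Y'_def using sat_large_orbit assms(1-5) by blast
  obtain Z where Z: "{} \<subseteq> Z" "Z \<subseteq> Y'" "sat Z"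
    "\<And>G. \<lbrakk>finite G; G \<subseteq> Z\<rbrakk> \<Longrightarrow> \<exists>H X. (finite H \<and> H \<subseteq> Y' \<and> X = Y' \<and> (\<forall>y\<in>H. P y)) \<and> G \<subseteq> H \<and> H \<subseteq> Z"
  proof (rule build[where I = "\<lambda>H X. finite H \<and> H \<subseteq> Y' \<and> X = Y' \<and> (\<forall>y\<in>H. P y)" and ?F0.0 = "{}" and ?Y0.0 = Y'])
    fix G X w assume G: "finite G \<and> G \<subseteq> Y' \<and> X = Y' \<and> (\<forall>y\<in>G. P y)" "w \<in> X" "w \<notin> G"
    have "w \<notin> F" using G assms(4) eqv_notin by (auto simp: Y'_def)
    then obtain y where "y \<in> Y" "eqv (F \<union> G) y w" "P y"
      using step[of G w] G by (auto simp: Y'_def)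
    moreover from this have "eqv F y h" using G unfolding Y'_def by (auto intro: eqv_trans)
    ultimately show "\<exists>y X'. X' \<subseteq> X \<and> eqv G y w \<and>
        (finite (insert y G) \<and> insert y G \<subseteq> Y' \<and> X' = Y' \<and> (\<forall>y\<in>insert y G. P y))"
      using G by (intro exI[of _ y] exI[of _ Y']) (auto simp: Y'_def)
  qed (use satY' in auto)
  show thesis
  proof (rule that[OF Z(3)])
    show "Z \<subseteq> {y \<in> Y. P y}"
    proof
      fix z assume "z \<in> Z"
      then show "z \<in> {y \<in> Y. P y}" using Z(4)[of "{z}"] Z(2) by (auto simp: Y'_def)
    qed
  qed
qed

section \<open>Forgetting points\<close>

text \<open>The points of \<open>Y'\<close> are forced into it by types over finite subsets of \<open>Y\<close>. Unlike being a
  saturated subset, this preserves richness (see \<open>cone_rich\<close>).\<close>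

definition cone :: "nat set \<Rightarrow> nat set \<Rightarrow> bool" where
  "cone Y' Y \<longleftrightarrow> Y' \<subseteq> Y \<and> (\<forall>E v. finite E \<and> E \<subseteq> Y' \<and> v \<notin> E \<longrightarrow>
     (\<exists>E' v'. finite E' \<and> E \<subseteq> E' \<and> E' \<subseteq> Y \<and> v' \<notin> E' \<and> eqv E v' v \<and>
        (\<forall>y\<in>Y. eqv E' y v' \<longrightarrow> y \<in> Y')))"

lemma coneE:
  assumes "cone Y' Y" "finite E" "E \<subseteq> Y'" "v \<notin> E"
  obtains E' v' where "finite E'" "E \<subseteq> E'" "E' \<subseteq> Y" "v' \<notin> E'" "eqv E v' v"
    "\<And>y. \<lbrakk>y \<in> Y; eqv E' y v'\<rbrakk> \<Longrightarrow> y \<in> Y'"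
  using assms unfolding cone_def by meson

lemma cone_sat:
  assumes "cone Y' Y" "sat Y" shows "sat Y'"
proof (rule sat_ptI)
  fix E v assume E: "finite E" "E \<subseteq> Y'" "v \<notin> E"
  obtain E' v' where E': "finite E'" "E \<subseteq> E'" "E' \<subseteq> Y" "v' \<notin> E'" "eqv E v' v"
    "\<And>y. \<lbrakk>y \<in> Y; eqv E' y v'\<rbrakk> \<Longrightarrow> y \<in> Y'" by (rule coneE[OF assms(1) E]) blast
  obtain y where "y \<in> Y" "eqv E' y v'" using sat_pt[OF assms(2) E'(1,3,4)] by blast
  then show "\<exists>y\<in>Y'. eqv E y v" using E' by (meson eqv_subset eqv_trans)
qed

text \<open>Forgetting the points of \<open>B - F\<close>: in the smaller copy \<open>Y'\<close> the distances of a point to \<open>F\<close>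
  determine its distances to \<open>B\<close>, in such a way that the prescribed points \<open>Zs\<close> are respected.
  With \<open>\<delta> k z\<close> the least possible distance between points looking like \<open>k\<close> and \<open>z\<close> over \<open>F\<close>, a
  point \<open>k\<close> gets the shortest-path distance \<open>\<phi> k b\<close> to \<open>b\<close>, along paths through \<open>F\<close> or \<open>Zs\<close>.\<close>

lemma forget_points:
  assumes satY: "sat Y" and fin: "finite B" "F \<subseteq> B" "B \<subseteq> Y" and Zs: "finite Zs" "Zs \<inter> B = {}"
    and canon: "\<And>z z' r b. \<lbrakk>z \<in> Zs; z' \<in> Zs; r \<in> S0; \<And>p. p \<in> F \<Longrightarrow> tri (d z p) (d z' p) r; b \<in> B\<rbrakk> \<Longrightarrow>
        tri (d z b) (d z' b) r"
  obtains Y' where "cone Y' Y" "F \<subseteq> Y'" "\<And>y z. \<lbrakk>y \<in> Y'; z \<in> Zs; eqv F y z\<rbrakk> \<Longrightarrow> eqv B y z"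
proof -
  have finF: "finite F" using fin finite_subset by blast
  have finS0: "finite S0" using finite_S by (simp add: S0_def)
  \<comment> \<open>Two of the three triangle inequalities. The third,
    \<open>r \<le> d k p \<oplus> d z p\<close>, holds for the least such \<open>r\<close>, by
    \<open>bound_sum\<close>.\<close>
  define bound where "bound r k z \<longleftrightarrow> (\<forall>p\<in>F. d k p \<le> d z p \<oplus> r \<and> d z p \<le> d k p \<oplus> r)" for r k z
  define \<delta> where "\<delta> k z = Min {r \<in> S0. bound r k z}" for k z
  have M0: "M \<in> S0" using M_in S_S0 by blast
  have \<delta>_ex: "{r \<in> S0. bound r k z} \<noteq> {}" for k z
    using M0 d_le_M by (auto simp: bound_def)
  have \<delta>: "\<delta> k z \<in> S0" "bound (\<delta> k z) k z" for k z
    using Min_in[of "{r \<in> S0. bound r k z}"] \<delta>_ex[of k z] finS0 by (auto simp: \<delta>_def)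
  have \<delta>_le: "\<delta> k z \<le> r" if "r \<in> S0" "bound r k z" for k z r
    unfolding \<delta>_def using finS0 that by (intro Min_le) auto
  have bound_sum: "bound (d k p \<oplus> d z p) k z" if "p \<in> F" for k z p
    unfolding bound_def
  proof (intro ballI conjI)
    fix q
    have "d k q \<le> d k p \<oplus> (d p z \<oplus> d z q)"
      using d_tri[of k q p] oplus_mono[OF order_refl d_tri[of p q z], of "d k p"] by linarith
    then show "d k q \<le> d z q \<oplus> (d k p \<oplus> d z p)" by (simp add: oplus_ac d_sym[of p z])
    have "d z q \<le> d z p \<oplus> (d p k \<oplus> d k q)"
      using d_tri[of z q p] oplus_mono[OF order_refl d_tri[of p q k], of "d z p"] by linarith
    then show "d z q \<le> d k q \<oplus> (d k p \<oplus> d z p)" by (simp add: oplus_ac d_sym[of p k])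
  qed
  define P where "P k b = insert M ((\<lambda>p. d k p \<oplus> d p b) ` F \<union> (\<lambda>z. \<delta> k z \<oplus> d z b) ` Zs)" for k b
  define \<phi> where "\<phi> k b = Min (P k b)" for k b
  have finP: "finite (P k b)" "P k b \<noteq> {}" for k b using finF Zs(1) by (auto simp: P_def)
  have \<phi>_cases: "\<phi> k b = M \<or> (\<exists>p\<in>F. \<phi> k b = d k p \<oplus> d p b) \<or> (\<exists>z\<in>Zs. \<phi> k b = \<delta> k z \<oplus> d z b)" for k b
    using Min_in[OF finP, of k b] unfolding \<phi>_def by (auto simp: P_def)
  have \<phi>_leF: "\<phi> k b \<le> d k p \<oplus> d p b" if "p \<in> F" for k b p
    unfolding \<phi>_def using finP that by (intro Min_le) (auto simp: P_def)
  have \<phi>_leZ: "\<phi> k b \<le> \<delta> k z \<oplus> d z b" if "z \<in> Zs" for k b z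
    unfolding \<phi>_def using finP that by (intro Min_le) (auto simp: P_def)
  have \<phi>_leM: "\<phi> k b \<le> M" for k b
    unfolding \<phi>_def using finP by (intro Min_le) (auto simp: P_def)
  have \<phi>_in: "\<phi> k b \<in> S0" for k b using \<phi>_cases[of k b] M0 by auto
  have \<phi>_S: "\<phi> k b \<in> S" if "k \<notin> F" "b \<in> B" for k b
  proof -
    have "d k p \<oplus> d p b \<in> S" if "p \<in> F" for p
      using \<open>k \<notin> F\<close> that by (intro oplus_in_S(1) d_in_S) auto
    moreover have "\<delta> k z \<oplus> d z b \<in> S" if "z \<in> Zs" for z
      using Zs(2) that \<open>b \<in> B\<close> by (intro oplus_in_S(2) d_in_S) auto
    ultimately show ?thesis using \<phi>_cases[of k b] M_in by auto
  qed
  have \<phi>_cong: "\<phi> k b = \<phi> k' b" if "eqv F k k'" for k k' b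
  proof -
    have "bound r k z = bound r k' z" for r z using that by (simp add: bound_def eqv_def)
    then have "\<delta> k z = \<delta> k' z" for z by (simp add: \<delta>_def)
    moreover have "(\<lambda>p. d k p \<oplus> d p b) ` F = (\<lambda>p. d k' p \<oplus> d p b) ` F"
      using that by (intro image_cong) (auto simp: eqv_def)
    ultimately show ?thesis by (simp add: \<phi>_def P_def)
  qed
  have lip_b: "\<phi> k b \<le> \<phi> k b' \<oplus> d b' b" for k b b'
  proof -
    consider "\<phi> k b' = M" | p where "p \<in> F" "\<phi> k b' = d k p \<oplus> d p b'"
      | z where "z \<in> Zs" "\<phi> k b' = \<delta> k z \<oplus> d z b'" using \<phi>_cases by blast
    then show ?thesis
    proof cases
      case 1 then show ?thesis using \<phi>_leM by simp
    next
      case 2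
      have "\<phi> k b \<le> d k p \<oplus> (d p b' \<oplus> d b' b)"
        using \<phi>_leF[OF 2(1), of k b] oplus_mono[OF order_refl d_tri[of p b b'], of "d k p"] by linarith
      then show ?thesis using 2 by (simp add: oplus_assoc)
    next
      case 3
      have "\<phi> k b \<le> \<delta> k z \<oplus> (d z b' \<oplus> d b' b)"
        using \<phi>_leZ[OF 3(1), of k b] oplus_mono[OF order_refl d_tri[of z b b'], of "\<delta> k z"] by linarith
      then show ?thesis using 3 by (simp add: oplus_assoc)
    qed
  qed
  \<comment> \<open>\<open>s\<close> is any distance allowed between the types of \<open>k\<close>
    and \<open>k'\<close> over \<open>F\<close>. Together with \<open>up_k\<close> this says that
    \<open>s\<close> stays allowed once both points receive their \<phi>-distances to
    \<open>B\<close>.\<close>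
  have lip_k: "\<phi> k b \<le> \<phi> k' b \<oplus> s" if "s \<in> S0" "\<And>p. p \<in> F \<Longrightarrow> tri (d k p) (d k' p) s" for k k' b s
  proof -
    have le: "d k p \<le> d k' p \<oplus> s" "d k' p \<le> d k p \<oplus> s" if "p \<in> F" for p
      using \<open>p \<in> F \<Longrightarrow> tri (d k p) (d k' p) s\<close> that \<open>s \<in> S0\<close> by (simp_all add: tri_iff)
    consider "\<phi> k' b = M" | p where "p \<in> F" "\<phi> k' b = d k' p \<oplus> d p b"
      | z where "z \<in> Zs" "\<phi> k' b = \<delta> k' z \<oplus> d z b" using \<phi>_cases by blast
    then show ?thesis
    proof cases
      case 1 then show ?thesis using \<phi>_leM by simp
    next
      case 2
      have "\<phi> k b \<le> (d k' p \<oplus> s) \<oplus> d p b"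
        using \<phi>_leF[OF 2(1), of k b] oplus_mono[OF le(1)[OF 2(1)] order_refl, of "d p b"] by linarith
      then show ?thesis using 2 by (simp add: oplus_ac)
    next
      case 3
      have "bound (\<delta> k' z \<oplus> s) k z"
        unfolding bound_def
      proof (intro ballI conjI)
        fix p assume p: "p \<in> F"
        have *: "d k' p \<le> d z p \<oplus> \<delta> k' z" "d z p \<le> d k' p \<oplus> \<delta> k' z"
          using \<delta>(2)[of k' z] p by (auto simp: bound_def)
        show "d k p \<le> d z p \<oplus> (\<delta> k' z \<oplus> s)"
          using le(1)[OF p] oplus_mono[OF *(1) order_refl, of s] by (simp add: oplus_assoc)
        have "d z p \<le> (d k p \<oplus> s) \<oplus> \<delta> k' z"
          using *(2) oplus_mono[OF le(2)[OF p] order_refl, of "\<delta> k' z"] by linarith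
        then show "d z p \<le> d k p \<oplus> (\<delta> k' z \<oplus> s)" by (simp add: oplus_ac)
      qed
      then have "\<delta> k z \<le> \<delta> k' z \<oplus> s" by (intro \<delta>_le) auto
      then have "\<phi> k b \<le> (\<delta> k' z \<oplus> s) \<oplus> d z b"
        using \<phi>_leZ[OF 3(1), of k b] oplus_mono[OF _ order_refl, of "\<delta> k z" "\<delta> k' z \<oplus> s" "d z b"] by linarith
      then show ?thesis using 3 by (simp add: oplus_ac)
    qed
  qed
  \<comment> \<open>The shortest path from \<open>z\<close> to \<open>z'\<close> through
    \<open>F\<close>, capped at \<open>M\<close>, is a distance allowed by their types over
    \<open>F\<close>. By \<open>canon\<close> it is allowed over \<open>b\<close> as well, so the
    way through \<open>b\<close> is not shorter.\<close>
  have canon_up: "d z b \<oplus> d z' b \<ge> M \<or> (\<exists>p\<in>F. d z p \<oplus> d z' p \<le> d z b \<oplus> d z' b)"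
    if "z \<in> Zs" "z' \<in> Zs" "b \<in> B" for z z' b
  proof -
    define Q where "Q = insert M ((\<lambda>p. d z p \<oplus> d z' p) ` F)"
    have "finite Q" "Q \<noteq> {}" using finF by (auto simp: Q_def)
    note Q = this Min_in[OF this]
    have "Min Q \<in> S0" using Q(3) M0 by (auto simp: Q_def)
    moreover have "tri (d z p) (d z' p) (Min Q)" if "p \<in> F" for p
    proof -
      have "Min Q \<le> d z p \<oplus> d z' p" using Q(1) that by (intro Min_le) (auto simp: Q_def)
      moreover have "bound (Min Q) z z'"
        using Q(3) d_le_M bound_sum by (auto simp: Q_def bound_def)
      ultimately show ?thesis using \<open>Min Q \<in> S0\<close> that by (auto simp: tri_iff bound_def)
    qed
    ultimately have "tri (d z b) (d z' b) (Min Q)" using canon that by blast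
    then have le: "Min Q \<le> d z b \<oplus> d z' b" using \<open>Min Q \<in> S0\<close> by (simp add: tri_iff)
    consider "Min Q = M" | p where "p \<in> F" "Min Q = d z p \<oplus> d z' p" using Q(3) by (auto simp: Q_def)
    then show ?thesis
    proof cases
      case 1
      then show ?thesis using le by (simp only: simp_thms)
    next
      case 2
      then show ?thesis using le by metis
    qed
  qed
  have canon_\<delta>: "d z b \<le> \<delta> z z' \<oplus> d z' b" if "z \<in> Zs" "z' \<in> Zs" "b \<in> B" for z z' b
  proof -
    have "tri (d z p) (d z' p) (\<delta> z z')" if "p \<in> F" for p
    proof -
      have "\<delta> z z' \<le> d z p \<oplus> d z' p" by (rule \<delta>_le[OF oplus_in bound_sum[OF that]])
      then show ?thesis using \<delta>[of z z'] that by (simp add: tri_iff bound_def)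
    qed
    then have "tri (d z b) (d z' b) (\<delta> z z')" using canon \<delta>(1) that by blast
    then show ?thesis using \<delta>(1) by (simp add: tri_iff oplus_comm)
  qed
  have up_k: "s \<le> \<phi> k b \<oplus> \<phi> k' b"
    if s: "s \<in> S0" "\<And>p. p \<in> F \<Longrightarrow> tri (d k p) (d k' p) s" and b: "b \<in> B" for k k' b s
  proof -
    have le: "s \<le> d k p \<oplus> d k' p" if "p \<in> F" for p
      using s that by (simp add: tri_iff)
    have leM: "s \<le> M" using s(1) le_M by blast
    have dZ: "d k p \<le> \<delta> k z \<oplus> d z p" if "p \<in> F" for k z p
      using \<delta>(2)[of k z] that by (auto simp: bound_def oplus_comm)
    have FZ: "s \<le> (d k p \<oplus> d p b) \<oplus> (\<delta> k' z \<oplus> d z b)" if "p \<in> F" "\<And>q. q \<in> F \<Longrightarrow> s \<le> d k q \<oplus> d k' q" for k k' p z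
    proof -
      have "s \<le> d k p \<oplus> (\<delta> k' z \<oplus> (d p b \<oplus> d b z))"
        using that(2)[OF that(1)] oplus_mono[OF order_refl dZ[OF that(1), of k' z], of "d k p"] 
          oplus_mono[OF order_refl oplus_mono[OF order_refl d_tri[of p z b]], of "d k p" "\<delta> k' z"]
        by (simp add: d_sym[of z p])
      then show ?thesis by (simp add: oplus_ac d_sym[of b z])
    qed
    consider "\<phi> k b = M \<or> \<phi> k' b = M"
      | p q where "p \<in> F" "q \<in> F" "\<phi> k b = d k p \<oplus> d p b" "\<phi> k' b = d k' q \<oplus> d q b"
      | p z where "p \<in> F" "z \<in> Zs" "\<phi> k b = d k p \<oplus> d p b" "\<phi> k' b = \<delta> k' z \<oplus> d z b"
      | p z where "p \<in> F" "z \<in> Zs" "\<phi> k' b = d k' p \<oplus> d p b" "\<phi> k b = \<delta> k z \<oplus> d z b"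
      | z z' where "z \<in> Zs" "z' \<in> Zs" "\<phi> k b = \<delta> k z \<oplus> d z b" "\<phi> k' b = \<delta> k' z' \<oplus> d z' b"
      using \<phi>_cases by metis
    then show ?thesis
    proof cases
      case 1 then show ?thesis using leM by auto
    next
      case 2
      have "s \<le> d k p \<oplus> (d k' q \<oplus> (d q b \<oplus> d b p))"
        using le[OF 2(1)] oplus_mono[OF order_refl d_tri[of k' p q], of "d k p"]
          oplus_mono[OF order_refl oplus_mono[OF order_refl d_tri[of q p b]], of "d k p" "d k' q"] by linarith
      then show ?thesis using 2 by (simp add: oplus_ac d_sym[of b p])
    next
      case 3
      then show ?thesis using FZ[of p k k' z] le by simp
    next
      case 4
      then show ?thesis using FZ[of p k' k z] le by (simp add: oplus_comm)
    next
      case 5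
      have "s \<le> \<delta> k z \<oplus> (\<delta> k' z' \<oplus> (d z b \<oplus> d z' b))"
      proof (cases "d z b \<oplus> d z' b \<ge> M")
        case True
        then have "d z b \<oplus> d z' b = M" using le_M[OF oplus_in] by (simp add: antisym)
        then show ?thesis using leM by simp
      next
        case False
        then obtain p where p: "p \<in> F" "d z p \<oplus> d z' p \<le> d z b \<oplus> d z' b" using canon_up 5 b by blast
        have "s \<le> (\<delta> k z \<oplus> d z p) \<oplus> (\<delta> k' z' \<oplus> d z' p)"
          using le[OF p(1)] oplus_mono[OF dZ[OF p(1), of k z] dZ[OF p(1), of k' z']] by linarith
        also have "\<dots> = \<delta> k z \<oplus> (\<delta> k' z' \<oplus> (d z p \<oplus> d z' p))" by (simp add: oplus_ac)
        also have "\<dots> \<le> \<delta> k z \<oplus> (\<delta> k' z' \<oplus> (d z b \<oplus> d z' b))"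
          by (rule oplus_mono[OF order_refl oplus_mono[OF order_refl p(2)]])
        finally show ?thesis .
      qed
      then show ?thesis using 5 by (simp add: oplus_ac)
    qed
  qed
  have up_b: "d b b' \<le> \<phi> k b \<oplus> \<phi> k b'" if "b \<in> B" "b' \<in> B" for k b b'
  proof -
    have bP: "d b b' \<le> (u \<oplus> d p b) \<oplus> (u' \<oplus> d p' b')" if "d p p' \<le> u \<oplus> u'" for u u' p p' b b'
    proof -
      have "d b b' \<le> d b p \<oplus> (d p p' \<oplus> d p' b')"
        using d_tri[of b b' p] oplus_mono[OF order_refl d_tri[of p b' p'], of "d b p"] by linarith
      also have "\<dots> \<le> d b p \<oplus> ((u \<oplus> u') \<oplus> d p' b')" using that by (intro oplus_mono order_refl)
      finally show ?thesis by (simp add: oplus_ac d_sym[of b p])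
    qed
    have FZ: "d b b' \<le> (d k p \<oplus> d p b) \<oplus> (\<delta> k z \<oplus> d z b')" if "p \<in> F" for p z b b'
    proof (rule bP)
      show "d p z \<le> d k p \<oplus> \<delta> k z"
        using \<delta>(2)[of k z] that by (auto simp: bound_def d_sym[of p z])
    qed
    consider "\<phi> k b = M \<or> \<phi> k b' = M"
      | p q where "p \<in> F" "q \<in> F" "\<phi> k b = d k p \<oplus> d p b" "\<phi> k b' = d k q \<oplus> d q b'"
      | p z where "p \<in> F" "z \<in> Zs" "\<phi> k b = d k p \<oplus> d p b" "\<phi> k b' = \<delta> k z \<oplus> d z b'"
      | p z where "p \<in> F" "z \<in> Zs" "\<phi> k b' = d k p \<oplus> d p b'" "\<phi> k b = \<delta> k z \<oplus> d z b"
      | z z' where "z \<in> Zs" "z' \<in> Zs" "\<phi> k b = \<delta> k z \<oplus> d z b" "\<phi> k b' = \<delta> k z' \<oplus> d z' b'"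
      using \<phi>_cases by metis
    then show ?thesis
    proof cases
      case 1 then show ?thesis using d_le_M by auto
    next
      case 2
      have "d p q \<le> d k p \<oplus> d k q" using d_tri[of p q k] by (simp add: d_sym[of p k])
      then show ?thesis using bP 2 by simp
    next
      case 3
      then show ?thesis using FZ by simp
    next
      case 4
      then show ?thesis using FZ[of p b' b z] by (simp add: oplus_comm d_sym[of b' b])
    next
      case 5
      have "bound (\<delta> k z \<oplus> \<delta> k z') z z'"
        unfolding bound_def
      proof (intro ballI conjI)
        fix p assume "p \<in> F"
        then have *: "d k p \<le> d z p \<oplus> \<delta> k z" "d z p \<le> d k p \<oplus> \<delta> k z"
          "d k p \<le> d z' p \<oplus> \<delta> k z'" "d z' p \<le> d k p \<oplus> \<delta> k z'"
          using \<delta>(2)[of k z] \<delta>(2)[of k z'] by (auto simp: bound_def)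
        show "d z p \<le> d z' p \<oplus> (\<delta> k z \<oplus> \<delta> k z')"
          using *(2) oplus_mono[OF *(3) order_refl, of "\<delta> k z"] by (simp add: oplus_ac)
        show "d z' p \<le> d z p \<oplus> (\<delta> k z \<oplus> \<delta> k z')"
          using *(4) oplus_mono[OF *(1) order_refl, of "\<delta> k z'"] by (simp add: oplus_ac)
      qed
      then have "\<delta> z z' \<le> \<delta> k z \<oplus> \<delta> k z'" by (intro \<delta>_le) auto
      then have "d z b \<le> (\<delta> k z \<oplus> \<delta> k z') \<oplus> d z' b"
        using canon_\<delta>[OF 5(1,2) that(1)] oplus_mono[OF _ order_refl, of "\<delta> z z'" _ "d z' b"] by (meson order_trans)
      moreover have "d b b' \<le> d z' b \<oplus> d z' b'" using d_tri[of b b' z'] by (simp add: d_sym[of b z'])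
      moreover have "d b b' \<le> d z b \<oplus> d z b'" using d_tri[of b b' z] by (simp add: d_sym[of b z])
      moreover have "d z b' \<le> (\<delta> k z \<oplus> \<delta> k z') \<oplus> d z' b'"
        using canon_\<delta>[OF 5(1,2) that(2)] oplus_mono[OF \<open>\<delta> z z' \<le> _\<close> order_refl, of "d z' b'"] by (meson order_trans)
      ultimately have "d b b' \<le> d z b \<oplus> ((\<delta> k z \<oplus> \<delta> k z') \<oplus> d z' b')"
        using oplus_mono[OF order_refl, of "d z b'" _ "d z b"] by (meson order_trans)
      then show ?thesis using 5 by (simp add: oplus_ac)
    qed
  qed
  have \<phi>_F: "\<phi> k p = d k p" if "p \<in> F" for k p
  proof (rule antisym)
    show "\<phi> k p \<le> d k p" using \<phi>_leF[OF that, of k p] by simp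
    show "d k p \<le> \<phi> k p"
      using \<phi>_cases[of k p] d_le_M d_tri[of k p] \<delta>(2)[of k] that
      by (auto simp: bound_def oplus_comm)
  qed
  define Y' where "Y' = F \<union> {y \<in> Y. y \<notin> F \<and> (\<forall>b\<in>B. d y b = \<phi> y b)}"
  have Y'B: "x \<in> F" if "x \<in> Y'" "x \<in> B" for x
  proof (rule ccontr)
    assume "x \<notin> F"
    then have "\<phi> x x = 0" using that by (auto simp: Y'_def)
    then show False using \<phi>_S[OF \<open>x \<notin> F\<close> that(2)] S_pos by auto
  qed
  show thesis
  proof (rule that)
    show "F \<subseteq> Y'" by (simp add: Y'_def)
    show "eqv B y z" if "y \<in> Y'" "z \<in> Zs" "eqv F y z" for y z
    proof -
      have "y \<notin> F" using that Zs(2) fin(2) eqv_notin by blast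
      have "d y b = d z b" if b: "b \<in> B" for b
      proof -
        have "\<phi> z b = d z b"
        proof (rule antisym)
          have "bound 0 z z" by (simp add: bound_def)
          then have "\<delta> z z \<le> 0" by (intro \<delta>_le) auto
          then have "\<delta> z z = 0" using \<delta>(1) S0_nonneg by (meson antisym)
          then show "\<phi> z b \<le> d z b" using \<phi>_leZ[OF \<open>z \<in> Zs\<close>, of z b] by simp
          show "d z b \<le> \<phi> z b" using \<phi>_cases[of z b] d_le_M d_tri[of z b] canon_\<delta> \<open>z \<in> Zs\<close> b by auto
        qed
        then show ?thesis using \<phi>_cong[OF \<open>eqv F y z\<close>] \<open>y \<in> Y'\<close> \<open>y \<notin> F\<close> b by (auto simp: Y'_def)
      qed
      then show ?thesis by (simp add: eqv_def)
    qed
    show "cone Y' Y"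
      unfolding cone_def
    proof (intro conjI allI impI)
      show "Y' \<subseteq> Y" using fin by (auto simp: Y'_def)
      fix E v assume E: "finite E \<and> E \<subseteq> Y' \<and> v \<notin> E"
      \<comment> \<open>\<open>v\<close> may lie in \<open>F\<close>, where its \<phi>-distance to
        itself would vanish; a copy \<open>v1\<close> outside \<open>F\<close> has distances in
        \<open>S\<close> to all of \<open>B\<close>.\<close>
      obtain v1 where v1: "v1 \<notin> F \<union> E" "eqv E v1 v" using fresh[of "F \<union> E" E v] finF E by blast
      define f where "f x = (if x \<in> B then \<phi> v1 x else d v1 x)" for x
      have mixed: "tri (\<phi> v1 x) (d v1 y) (d x y)" if "x \<in> B" "y \<in> E" "y \<notin> B" for x y
      proof -
        have "d x y = \<phi> y x" using that E d_sym[of x y] fin(2) by (auto simp: Y'_def)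
        moreover have "\<And>p. p \<in> F \<Longrightarrow> tri (d v1 p) (d y p) (d v1 y)"
          using tri_d[of _ v1 y] d_sym by metis
        moreover have "\<And>p. p \<in> F \<Longrightarrow> tri (d y p) (d v1 p) (d v1 y)"
          using calculation(2) tri_commute by blast
        ultimately show ?thesis
          using lip_k[of "d v1 y" v1 y x] lip_k[of "d v1 y" y v1 x] up_k[of "d v1 y" v1 y x] that(1)
          by (simp add: tri_iff \<phi>_in oplus_comm)
      qed
      obtain v' where v': "v' \<notin> E \<union> B" "\<And>x. x \<in> E \<union> B \<Longrightarrow> d v' x = f x"
      proof (rule realize[of "E \<union> B" f])
        show "finite (E \<union> B)" using E fin by blast
        show "f x \<in> S" if "x \<in> E \<union> B" for x
          using that \<phi>_S[of v1 x] d_in_S[of v1 x] v1(1) by (auto simp: f_def)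
        show "tri (f x) (f y) (d x y)" if "x \<in> E \<union> B" "y \<in> E \<union> B" for x y
        proof -
          consider "x \<in> B" "y \<in> B" | "x \<in> B" "y \<in> E" "y \<notin> B" | "y \<in> B" "x \<in> E" "x \<notin> B" | "x \<notin> B" "y \<notin> B"
            using \<open>x \<in> E \<union> B\<close> \<open>y \<in> E \<union> B\<close> by blast
          then show ?thesis
          proof cases
            case 1
            then show ?thesis using lip_b[of v1 x y] lip_b[of v1 y x] up_b[of x y v1]
              by (simp add: f_def tri_iff \<phi>_in d_sym[of y x])
          next
            case 2
            then show ?thesis using mixed[of x y] by (simp add: f_def)
          next
            case 3
            then show ?thesis using mixed[of y x] tri_commute(1) by (simp add: f_def d_sym[of y x])
          next
            case 4
            then show ?thesis by (simp add: f_def tri_d)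
          qed
        qed
      qed blast
      have v'F: "d v' p = d v1 p" if "p \<in> F" for p
        using v'(2)[of p] \<phi>_F[OF that, of v1] that fin(2) by (auto simp: f_def)
      have "eqv E v' v1"
        unfolding eqv_def
      proof
        fix x assume x: "x \<in> E"
        show "d v' x = d v1 x"
        proof (cases "x \<in> B")
          case True
          then show ?thesis using v'F Y'B x E by blast
        next
          case False
          then show ?thesis using v'(2)[of x] x by (simp add: f_def)
        qed
      qed
      moreover have "y \<in> Y'" if "y \<in> Y" "eqv (E \<union> B) y v'" for y
      proof -
        have yF: "eqv F y v1" using that(2) v'F fin(2) by (auto simp: eqv_def)
        have "y \<notin> F" using eqv_notin[OF yF] v1 by blast
        moreover have "d y b = \<phi> y b" if "b \<in> B" for b
          using \<open>eqv (E \<union> B) y v'\<close> v'(2)[of b] that \<phi>_cong[OF yF, of b] by (simp add: eqv_def f_def)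
        ultimately show ?thesis using that(1) by (simp add: Y'_def)
      qed
      moreover have "E \<union> B \<subseteq> Y" using E fin by (auto simp: Y'_def)
      ultimately show "\<exists>E' v'. finite E' \<and> E \<subseteq> E' \<and> E' \<subseteq> Y \<and> v' \<notin> E' \<and> eqv E v' v \<and> (\<forall>y\<in>Y. eqv E' y v' \<longrightarrow> y \<in> Y')"
        using E fin v' v1(2) eqv_trans
        by (intro exI[of _ "E \<union> B"] exI[of _ v']) blast
    qed
  qed
qed

lemma isom_eqv:
  assumes "isom_on A f" "E \<subseteq> A" "u \<in> A" "\<And>e. e \<in> E \<Longrightarrow> f e = e"
  shows "eqv E (f u) u"
  using assms isom_onD unfolding eqv_def by (metis subsetD)

lemma isom_comp:
  assumes "isom_on A f" "isom_on B g" "f ` A \<subseteq> B"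
  shows "isom_on A (g \<circ> f)"
  using assms unfolding isom_on_def by (auto simp: image_subset_iff)

section \<open>Types over a finite set and their closest representatives\<close>

definition admissible :: "nat set \<Rightarrow> real \<Rightarrow> nat \<Rightarrow> nat \<Rightarrow> bool" where
  "admissible A r k z \<longleftrightarrow> (\<forall>p\<in>A. tri (d k p) (d z p) r)"

lemma admissible_d: "admissible A (d k z) k z"
  unfolding admissible_def using tri_d[of _ k z] d_sym by metis

lemma admissible_sym: "admissible A r k z \<Longrightarrow> admissible A r z k"
  unfolding admissible_def using tri_commute by blast

text \<open>The bound \<open>m\<close> supplies the one inequality that does not compose:
  \<open>r \<oplus> r'\<close> must not exceed the sum of the distances to a point of
  \<open>A\<close>.\<close>

lemma admissible_trans:
  assumes "admissible A r k z" "admissible A r' z u" "r \<in> S0" "r' \<in> S0"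
    and "admissible A m k u" "m \<in> S0" "r \<oplus> r' \<le> m"
  shows "admissible A (r \<oplus> r') k u"
  unfolding admissible_def
proof
  fix p assume p: "p \<in> A"
  have *: "d k p \<le> d z p \<oplus> r" "d z p \<le> d k p \<oplus> r" "d z p \<le> d u p \<oplus> r'" "d u p \<le> d z p \<oplus> r'" "m \<le> d k p \<oplus> d u p"
    using assms p by (auto simp: admissible_def tri_iff)
  have "d k p \<le> d u p \<oplus> (r \<oplus> r')"
    using *(1) oplus_mono[OF *(3) order_refl, of r] by (simp add: oplus_ac)
  moreover have "d u p \<le> d k p \<oplus> (r \<oplus> r')"
    using *(4) oplus_mono[OF *(2) order_refl, of r'] by (simp add: oplus_ac)
  ultimately show "tri (d k p) (d u p) (r \<oplus> r')" using * assms by (simp add: tri_iff)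
qed

lemma finite_types:
  assumes "finite A"
  obtains V where "finite V" "V \<inter> A = {}" "\<And>v. v \<notin> A \<Longrightarrow> \<exists>u\<in>V. eqv A u v"
proof -
  have "(\<lambda>v. restrict (d v) A) ` (- A) \<subseteq> A \<rightarrow>\<^sub>E S"
    using d_in_S by (auto simp: PiE_iff) (metis)
  then have "finite ((\<lambda>v. restrict (d v) A) ` (- A))"
    using finite_PiE[OF assms, of "\<lambda>_. S"] finite_S finite_subset by blast
  then obtain V where V: "V \<subseteq> - A" "finite V" "(\<lambda>v. restrict (d v) A) ` V = (\<lambda>v. restrict (d v) A) ` (- A)"
    using finite_subset_image[of _ "\<lambda>v. restrict (d v) A" "- A"] by (metis order_refl)
  show thesis
  proof (rule that[OF V(2)])
    show "V \<inter> A = {}" using V(1) by blast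
    show "\<exists>u\<in>V. eqv A u v" if "v \<notin> A" for v
    proof -
      have "restrict (d v) A \<in> (\<lambda>v. restrict (d v) A) ` V" using V(3) that by blast
      then obtain u where "u \<in> V" "restrict (d v) A = restrict (d u) A" by blast
      then have "eqv A u v" unfolding eqv_def by (metis restrict_apply')
      then show ?thesis using \<open>u \<in> V\<close> by blast
    qed
  qed
qed

text \<open>Types are added one by one, each at the least admissible distance from the earlier
  representatives. If a triangle among these minima failed, \<open>admissible_trans\<close> would
  yield a smaller admissible distance. Taking \<open>r = 0\<close> shows that no type has two
  representatives.\<close>

lemma representatives:
  assumes "finite A"
  obtains J where "finite J" "J \<inter> A = {}" "\<And>v. v \<notin> A \<Longrightarrow> \<exists>z\<in>J. eqv A z v"
    "\<And>z z' r. \<lbrakk>z \<in> J; z' \<in> J; r \<in> S0; admissible A r z z'\<rbrakk> \<Longrightarrow> d z z' \<le> r"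
proof -
  obtain V where V: "finite V" "V \<inter> A = {}" "\<And>v. v \<notin> A \<Longrightarrow> \<exists>u\<in>V. eqv A u v"
    using finite_types[OF assms] by blast
  have "\<exists>J. finite J \<and> J \<inter> A = {} \<and> (\<forall>v\<in>V. \<exists>z\<in>J. eqv A z v) \<and>
      (\<forall>z\<in>J. \<forall>z'\<in>J. \<forall>r\<in>S0. admissible A r z z' \<longrightarrow> d z z' \<le> r)"
    using V(1,2)
  proof (induction V)
    case empty
    then show ?case by (intro exI[of _ "{}"]) simp
  next
    case (insert v V)
    then obtain J where J: "finite J" "J \<inter> A = {}" "\<forall>v\<in>V. \<exists>z\<in>J. eqv A z v"
      "\<forall>z\<in>J. \<forall>z'\<in>J. \<forall>r\<in>S0. admissible A r z z' \<longrightarrow> d z z' \<le> r" by blast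
    show ?case
    proof (cases "\<exists>z\<in>J. eqv A z v")
      case True
      then show ?thesis using J by blast
    next
      case False
      define \<delta> where "\<delta> z = Min {r \<in> S0. admissible A r v z}" for z
      have fin: "finite {r \<in> S0. admissible A r v z}" for z using finite_S by (simp add: S0_def)
      have \<delta>: "\<delta> z \<in> S0" "admissible A (\<delta> z) v z" for z
      proof -
        have "d v z \<in> {r \<in> S0. admissible A r v z}" using admissible_d by simp
        then have "\<delta> z \<in> {r \<in> S0. admissible A r v z}"
          unfolding \<delta>_def using fin by (intro Min_in) blast+
        then show "\<delta> z \<in> S0" "admissible A (\<delta> z) v z" by blast+
      qed
      have \<delta>_le: "\<delta> z \<le> r" if "r \<in> S0" "admissible A r v z" for r z
        unfolding \<delta>_def using fin that by (intro Min_le) auto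
      have \<delta>_S: "\<delta> z \<in> S" if "z \<in> J" for z
      proof -
        have "\<delta> z \<noteq> 0"
        proof
          assume "\<delta> z = 0"
          then have "eqv A z v" using \<delta>(2)[of z] by (auto simp: admissible_def tri_def eqv_def)
          then show False using False that by blast
        qed
        then show ?thesis using \<delta>(1)[of z] by (auto simp: S0_def)
      qed
      define f where "f x = (if x \<in> A then d v x else \<delta> x)" for x
      have vA: "v \<notin> A" using insert.prems by blast
      have AJ: "tri (d v p) (\<delta> z) (d p z)" if "p \<in> A" for p z
        using \<delta>(2)[of z] that tri_commute by (auto simp: admissible_def d_sym[of z p])
      have JJ: "tri (\<delta> z) (\<delta> z') (d z z')" if "z \<in> J" "z' \<in> J" for z z'
      proof -
        have le: "\<delta> z \<le> \<delta> z' \<oplus> d z' z" for z z'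
        proof (rule ccontr)
          assume neg: "\<not> \<delta> z \<le> \<delta> z' \<oplus> d z' z"
          then have "admissible A (\<delta> z' \<oplus> d z' z) v z"
            by (intro admissible_trans[OF \<delta>(2) admissible_d \<delta>(1) d_in \<delta>(2) \<delta>(1)]) simp
          then show False using \<delta>_le[of "\<delta> z' \<oplus> d z' z" z] neg by simp
        qed
        have "d z z' \<le> \<delta> z \<oplus> \<delta> z'"
        proof (rule ccontr)
          assume neg: "\<not> d z z' \<le> \<delta> z \<oplus> \<delta> z'"
          then have "admissible A (\<delta> z \<oplus> \<delta> z') z z'"
            by (intro admissible_trans[OF admissible_sym[OF \<delta>(2)] \<delta>(2) \<delta>(1) \<delta>(1) admissible_d d_in]) simp
          then show False using J(4) that neg oplus_in by blast
        qed
        then show ?thesis using le[of z z'] le[of z' z] \<delta>(1) by (simp add: tri_iff d_sym[of z' z])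
      qed
      obtain x where x: "x \<notin> A \<union> J" "\<And>y. y \<in> A \<union> J \<Longrightarrow> d x y = f y"
      proof (rule realize[of "A \<union> J" f])
        show "finite (A \<union> J)" using assms J(1) by blast
        show "f x \<in> S" if "x \<in> A \<union> J" for x using that \<delta>_S[of x] d_in_S[of v x] vA by (auto simp: f_def)
        show "tri (f x) (f y) (d x y)" if xy: "x \<in> A \<union> J" "y \<in> A \<union> J" for x y
        proof -
          have J: "x \<in> J" if "x \<in> A \<union> J" "x \<notin> A" for x using that by blast
          show ?thesis
            using xy AJ[of x y] AJ[of y x] JJ[of x y] tri_d[of v x y] tri_commute(1) J[of x] J[of y]
            by (cases "x \<in> A"; cases "y \<in> A") (auto simp: f_def d_sym[of y x])
        qed
      qed blast
      have xv: "eqv A x v" using x(2) by (simp add: eqv_def f_def)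
      have xJ: "d x z \<le> r" if "z \<in> J" "r \<in> S0" "admissible A r x z" for z r
      proof -
        have "z \<notin> A" using that J(2) by blast
        then have "d x z = \<delta> z" using x(2) that by (simp add: f_def)
        moreover have "admissible A r v z" using that(3) xv by (simp add: admissible_def eqv_def)
        ultimately show ?thesis using \<delta>_le that by simp
      qed
      have "\<forall>z\<in>insert x J. \<forall>z'\<in>insert x J. \<forall>r\<in>S0. admissible A r z z' \<longrightarrow> d z z' \<le> r"
        using J(4) xJ admissible_sym S0_nonneg by (auto simp: d_sym[of _ x])
      then show ?thesis using J x xv by (intro exI[of _ "insert x J"]) auto
    qed
  qed
  then obtain J where J: "finite J" "J \<inter> A = {}" "\<forall>v\<in>V. \<exists>z\<in>J. eqv A z v"
      "\<forall>z\<in>J. \<forall>z'\<in>J. \<forall>r\<in>S0. admissible A r z z' \<longrightarrow> d z z' \<le> r" by blast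
  show thesis
  proof (rule that[OF J(1,2)])
    show "\<exists>z\<in>J. eqv A z v" if "v \<notin> A" for v using V(3)[OF that] J(3) eqv_trans by blast
  qed (use J(4) in blast)
qed

end

section \<open>Rich types\<close>

locale no_mono_copy = urysohn_nat +
  fixes R :: "nat set"
  assumes no_red: "sat Z \<Longrightarrow> \<not> Z \<subseteq> R" and no_blue: "sat Z \<Longrightarrow> \<not> Z \<subseteq> - R"
begin

text \<open>Density of \<open>C\<close> in the type of \<open>w\<close>: every finite refinement
  within \<open>Y\<close> is met. This passes to larger \<open>F\<close> and to cones, which is why
  it can be carried as an invariant.\<close>

definition rich :: "nat set \<Rightarrow> nat set \<Rightarrow> nat set \<Rightarrow> nat \<Rightarrow> bool" where
  "rich C Y F w \<longleftrightarrow> (\<forall>E v. finite E \<and> F \<subseteq> E \<and> E \<subseteq> Y \<and> v \<notin> E \<and> eqv F v w \<longrightarrow>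
     (\<exists>y\<in>Y. eqv E y v \<and> y \<in> C))"

lemma richD:
  "\<lbrakk>rich C Y F w; finite E; F \<subseteq> E; E \<subseteq> Y; v \<notin> E; eqv F v w\<rbrakk> \<Longrightarrow> \<exists>y\<in>Y. eqv E y v \<and> y \<in> C"
  unfolding rich_def by blast

lemma rich_mono: "\<lbrakk>rich C Y F w; F \<subseteq> F'; eqv F w' w\<rbrakk> \<Longrightarrow> rich C Y F' w'"
  unfolding rich_def by (meson eqv_subset eqv_trans subset_trans)

lemma rich_cong: "eqv F w' w \<Longrightarrow> rich C Y F w \<Longrightarrow> rich C Y F w'"
  using rich_mono by blast

text \<open>Inside \<open>Y'\<close> the type over \<open>F\<close> carries the type over
  \<open>B\<close>, so richness over auxiliary points becomes richness over \<open>F\<close>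
  alone.\<close>

lemma rich_transfer:
  assumes "cone Y' Y" "sat Y" "rich C Y B z" "finite B" "B \<subseteq> Y" "F \<subseteq> Y'"
    and lift: "\<And>y. \<lbrakk>y \<in> Y'; eqv F y z\<rbrakk> \<Longrightarrow> eqv B y z"
  shows "rich C Y' F z"
  unfolding rich_def
proof (intro allI impI)
  fix E v assume E: "finite E \<and> F \<subseteq> E \<and> E \<subseteq> Y' \<and> v \<notin> E \<and> eqv F v z"
  obtain E' v' where E': "finite E'" "E \<subseteq> E'" "E' \<subseteq> Y" "v' \<notin> E'" "eqv E v' v"
    "\<And>y. \<lbrakk>y \<in> Y; eqv E' y v'\<rbrakk> \<Longrightarrow> y \<in> Y'" using coneE[OF assms(1), of E v] E by blast
  obtain u where u: "u \<notin> E' \<union> B" "eqv E' u v'" using fresh[of "E' \<union> B" E' v'] E'(1,4) assms(4) by blast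
  \<comment> \<open>A point of \<open>Y'\<close> in the refined type. By \<open>lift\<close> it has
    the type of \<open>z\<close> over \<open>B\<close>, so richness applies to its type over
    \<open>E' \<union> B\<close>.\<close>
  obtain y where y: "y \<in> Y" "eqv (E' \<union> B) y u" "y \<notin> E' \<union> B"
    using sat_pt[OF assms(2), of "E' \<union> B" u] E'(1,3) assms(4,5) u(1) by blast
  have *: "eqv E' y v'" using y(2) u(2) eqv_trans by simp blast
  then have "eqv F y z" using E E'(2,5) by (meson eqv_subset eqv_trans)
  then have "eqv B y z" using lift E'(6)[OF y(1) *] by blast
  with richD[OF assms(3), of "E' \<union> B" y] obtain x where x: "x \<in> Y" "eqv (E' \<union> B) x y" "x \<in> C"
    using E'(1,3) assms(4,5) y(3) by blast
  have **: "eqv E' x v'" using x(2) * eqv_trans by simp blast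
  then have "x \<in> Y'" using E'(6) x(1) by blast
  moreover have "eqv E x v" using ** E'(2,5) by (meson eqv_subset eqv_trans)
  ultimately show "\<exists>y\<in>Y'. eqv E y v \<and> y \<in> C" using x(3) by blast
qed

lemma cone_rich:
  assumes "cone Y' Y" "sat Y" "rich C Y F w" "finite F" "F \<subseteq> Y'"
  shows "rich C Y' F w"
proof -
  have "F \<subseteq> Y" using assms(1,5) by (auto simp: cone_def)
  then show ?thesis using rich_transfer[OF assms(1-4) _ assms(5)] by blast
qed

lemma large_colours:
  assumes "sat Y" "finite E" "E \<subseteq> Y" "v \<notin> E" "\<And>p. p \<in> E \<Longrightarrow> large (d v p)"
  shows "\<exists>y\<in>Y. eqv E y v \<and> y \<in> R" "\<exists>y\<in>Y. eqv E y v \<and> y \<notin> R"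
  using no_red[OF sat_large_orbit[OF assms]] no_blue[OF sat_large_orbit[OF assms]] by auto

text \<open>The invariant is richness in red of the types with some distance that is not large. It
  is vacuous at the start, and the other types contain red points in any copy by
  \<open>large_colours\<close>.\<close>

lemma red_build:
  assumes step: "\<And>F Y w. \<lbrakk>finite F; F \<subseteq> Y; sat Y; w \<in> Y; w \<notin> F;
      \<And>v. \<lbrakk>v \<notin> F; \<exists>p\<in>F. \<not> large (d v p)\<rbrakk> \<Longrightarrow> rich R Y F v\<rbrakk> \<Longrightarrow>
      \<exists>x Y'. x \<in> R \<and> eqv F x w \<and> Y' \<subseteq> Y \<and> insert x F \<subseteq> Y' \<and> sat Y' \<and>
        (\<forall>v. v \<notin> insert x F \<and> (\<exists>p\<in>insert x F. \<not> large (d v p)) \<longrightarrow> rich R Y' (insert x F) v)"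
  shows False
proof -
  define I where "I F Y \<longleftrightarrow> finite F \<and> F \<subseteq> Y \<and> sat Y \<and> F \<subseteq> R \<and>
    (\<forall>v. v \<notin> F \<and> (\<exists>p\<in>F. \<not> large (d v p)) \<longrightarrow> rich R Y F v)" for F Y
  obtain Z where Z: "sat Z" "\<And>G. \<lbrakk>finite G; G \<subseteq> Z\<rbrakk> \<Longrightarrow> \<exists>F Y. I F Y \<and> G \<subseteq> F \<and> F \<subseteq> Z"
  proof (rule build[where I = I])
    show "I {} UNIV" using sat_UNIV by (simp add: I_def)
    show "\<exists>y Y'. Y' \<subseteq> Y \<and> eqv F y w \<and> I (insert y F) Y'" if I: "I F Y" and w: "w \<in> Y" "w \<notin> F" for F Y w
    proof -
      obtain x Y' where "x \<in> R" "eqv F x w" "Y' \<subseteq> Y" "insert x F \<subseteq> Y'" "sat Y'"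
        "\<forall>v. v \<notin> insert x F \<and> (\<exists>p\<in>insert x F. \<not> large (d v p)) \<longrightarrow> rich R Y' (insert x F) v"
        using step[of F Y w] I w unfolding I_def by blast
      then show ?thesis using I unfolding I_def by (intro exI[of _ x] exI[of _ Y']) auto
    qed
  qed (auto simp: I_def)
  have "z \<in> R" if "z \<in> Z" for z using Z(2)[of "{z}"] that by (auto simp: I_def)
  then show False using no_red[OF Z(1)] by blast
qed

end

section \<open>All sums large\<close>

locale archimedean_copy = no_mono_copy +
  assumes sum_large: "\<lbrakk>s \<in> S; t \<in> S\<rbrakk> \<Longrightarrow> large (s \<oplus> t)"
    and small_double: "\<lbrakk>s \<in> S; t \<in> S; \<not> large s; \<not> large t\<rbrakk> \<Longrightarrow> s \<oplus> s = t \<oplus> t"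
begin

text \<open>Failure of richness in blue gives \<open>E\<close> and \<open>v\<close> with red
  realisations only; once \<open>E - F\<close> is forgotten, every point of the type of
  \<open>z\<close> is red. The compatibility needed for this is that twice \<open>d v p\<close> is
  at most twice \<open>d v b\<close>: the latter is \<open>M\<close> or, by
  \<open>small_double\<close>, the same.\<close>

lemma make_rich:
  assumes "sat Y" "finite F" "F \<subseteq> Y" "\<exists>p\<in>F. \<not> large (d z p)" "\<not> rich (- R) Y F z" "z \<notin> F"
  obtains Y' where "cone Y' Y" "F \<subseteq> Y'" "rich R Y' F z"
proof -
  obtain E v where E: "finite E" "F \<subseteq> E" "E \<subseteq> Y" "v \<notin> E" "eqv F v z"
    and red: "\<And>y. \<lbrakk>y \<in> Y; eqv E y v\<rbrakk> \<Longrightarrow> y \<in> R"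
    using assms(5) unfolding rich_def by auto
  obtain p where p: "p \<in> F" "\<not> large (d v p)" using assms(4) E(5) by (auto simp: eqv_def)
  obtain Y' where Y': "cone Y' Y" "F \<subseteq> Y'" "\<And>y z. \<lbrakk>y \<in> Y'; z \<in> {v}; eqv F y z\<rbrakk> \<Longrightarrow> eqv E y z"
  proof (rule forget_points[OF assms(1) E(1-3), of "{v}"])
    fix u u' r b assume u: "u \<in> {v}" "u' \<in> {v}" "r \<in> S0" "\<And>p. p \<in> F \<Longrightarrow> tri (d u p) (d u' p) r" "b \<in> E"
    have "r \<le> d v p \<oplus> d v p" using u(4)[OF p(1)] u(1-3) by (simp add: tri_iff)
    also have "\<dots> \<le> d v b \<oplus> d v b"
    proof (cases "large (d v b)")
      case True
      then show ?thesis by (simp add: large_def oplus_le_M)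
    next
      case False
      have "v \<noteq> b" "v \<noteq> p" using u(5) E(2,4) p(1) by auto
      then show ?thesis using small_double[OF d_in_S d_in_S, of v b v p] False p(2) by simp
    qed
    finally show "tri (d u b) (d u' b) r" using u(1-3) S0_nonneg[OF u(3)] by (simp add: tri_iff le_oplus1)
  qed (use E in auto)
  show thesis
  proof (rule that[OF Y'(1,2)])
    show "rich R Y' F z"
      unfolding rich_def
    proof (intro allI impI)
      fix G u assume G: "finite G \<and> F \<subseteq> G \<and> G \<subseteq> Y' \<and> u \<notin> G \<and> eqv F u z"
      obtain y where y: "y \<in> Y'" "eqv G y u"
        using sat_pt[OF cone_sat[OF Y'(1) assms(1)], of G u] G by blast
      have "eqv F y v" using G y(2) E(5) by (meson eqv_subset eqv_sym eqv_trans)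
      then have "eqv E y v" using Y'(3) y(1) by blast
      then have "y \<in> R" using red y(1) Y'(1) by (auto simp: cone_def)
      then show "\<exists>y\<in>Y'. eqv G y u \<and> y \<in> R" using y by blast
    qed
  qed
qed

text \<open>Otherwise every point of the orbit of \<open>h\<close> over \<open>B\<close> could be
  given a companion \<open>x\<close> looking like \<open>w\<close>, over which its type is rich in
  blue, and \<open>large_build\<close> would produce a blue copy.\<close>

lemma good_centre:
  assumes "sat Y" "finite B" "B \<subseteq> Y" "h \<notin> B" "\<And>p. p \<in> B \<Longrightarrow> large (d h p)" "w \<notin> B" "w \<noteq> h"
  obtains x g where "x \<in> Y" "eqv B x w" "eqv B g h" "d g x = d h w" "\<not> rich (- R) Y (insert x B) g"
proof (rule ccontr)
  note that0 = that
  assume "\<not> thesis"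
  then have blue: "rich (- R) Y (insert x B) g" if "x \<in> Y" "eqv B x w" "eqv B g h" "d g x = d h w" for x g
    using that \<open>\<not> thesis\<close> that0 by blast
  obtain Z where "sat Z" "Z \<subseteq> {y \<in> Y. y \<notin> R}"
  proof (rule large_build[OF assms(1-5), where P = "\<lambda>y. y \<notin> R"])
    fix G v assume G: "finite G" "G \<subseteq> {y \<in> Y. eqv B y h \<and> y \<notin> R}" "v \<notin> B \<union> G" "eqv B v h"
    let ?E = "B \<union> G"
    \<comment> \<open>\<open>f w\<close> is the companion that \<open>v\<close> should have. It is
      realised in \<open>Y\<close> by \<open>x\<close>, by way of a copy \<open>q\<close> outside
      \<open>?E\<close>, and \<open>v\<close> is moved along to \<open>g v\<close>, which keeps its
      type over \<open>?E\<close> and has the right distance to \<open>x\<close>.\<close>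
    obtain f where f: "isom_on (insert h B \<union> {w}) f" "\<And>b. b \<in> B \<Longrightarrow> f b = b" "f h = v"
      using move[OF assms(2) _ G(4) assms(4), of "{w}"] by blast
    have w1: "eqv B (f w) w" using isom_eqv[OF f(1), of B w] f(2) by blast
    have dw: "d v (f w) = d h w" using isom_onD[OF f(1), of h w] f(3) by simp
    have "f w \<notin> insert v B"
      using eqv_notin[OF w1 assms(6)] dw assms(7) d_eq_0 by (metis d_self insertE)
    then obtain q where q: "q \<notin> ?E" "eqv (insert v B) q (f w)"
      using fresh[of ?E "insert v B" "f w"] G(1) assms(2) by blast
    obtain x where x: "x \<in> Y" "eqv ?E x q" "x \<notin> ?E"
      using sat_pt[OF assms(1), of ?E q] G(1,2) assms(2,3) q(1) by blast
    obtain g where g: "isom_on (insert q ?E \<union> {v}) g" "\<And>b. b \<in> ?E \<Longrightarrow> g b = b" "g q = x"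
      using move[of ?E "{v}" x q] G(1) assms(2) x(2) q(1) by blast
    have v2: "eqv ?E (g v) v" using isom_eqv[OF g(1), of ?E v] g(2) by blast
    have "d (g v) x = d v q" using isom_onD[OF g(1), of v q] g(3) by simp
    also have "\<dots> = d h w" using q(2) dw by (simp add: d_sym[of v])
    finally have dx: "d (g v) x = d h w" .
    have "rich (- R) Y (insert x B) (g v)"
      using blue[OF x(1) _ _ dx] x(2) q(2) w1 v2 G(4) eqv_trans by (metis eqv_Un eqv_insert)
    moreover have gv: "g v \<notin> insert x ?E"
      using eqv_notin[OF v2 G(3)] dx assms(7) d_eq_0 by (metis d_self insertE)
    moreover have "finite (insert x ?E)" "insert x B \<subseteq> insert x ?E" "insert x ?E \<subseteq> Y"
      using G(1,2) assms(2,3) x(1) by auto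
    ultimately obtain y where "y \<in> Y" "eqv (insert x ?E) y (g v)" "y \<in> - R"
      using richD[of "- R" Y "insert x B" "g v" "insert x ?E" "g v"] eqv_refl by blast
    then show "\<exists>y\<in>Y. eqv ?E y v \<and> y \<notin> R" using v2 eqv_trans by (metis ComplD eqv_insert)
  qed
  then show False using no_blue by blast
qed

text \<open>A path of two nonzero steps is large here, so free amalgamation creates no small
  distances.\<close>

lemma large_path:
  assumes "w \<notin> D" "y \<notin> D" "t = M \<or> (\<exists>x\<in>D. t = d w x \<oplus> d x y)"
  shows "large t"
proof -
  have "large (d w x \<oplus> d x y)" if "x \<in> D" for x
    using assms(1,2) that by (intro sum_large d_in_S) auto
  then show ?thesis using assms(3) large_M by auto
qed

text \<open>The configuration \<open>f\<close> is a moved copy of \<open>w\<close> and \<open>J\<close> over \<open>F\<close>.  For each \<open>z\<close> in \<open>D\<close>, the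
  auxiliary points in \<open>B\<close> have made the (small) type of \<open>f z\<close> rich.\<close>

definition config where
  "config F w J f B Y D \<longleftrightarrow> isom_on (insert w (F \<union> J)) f \<and> (\<forall>p\<in>F. f p = p) \<and>
    finite B \<and> F \<subseteq> B \<and> B \<subseteq> Y \<and> sat Y \<and> f w \<notin> B \<and> (\<forall>z\<in>J. f z \<notin> B) \<and>
    ((\<forall>p\<in>F. large (d w p)) \<longrightarrow> (\<forall>p\<in>B. large (d (f w) p))) \<and>
    (\<forall>z\<in>J - D. \<forall>p\<in>B. large (d (f z) p)) \<and>
    (\<forall>z\<in>J. \<forall>z'\<in>J. \<forall>r\<in>S0. admissible (insert w F) r z z' \<longrightarrow> (\<forall>b\<in>B. tri (d (f z) b) (d (f z') b) r)) \<and>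
    (\<forall>z\<in>D. rich R Y B (f z))"

text \<open>The auxiliary point \<open>x\<close> makes the type of \<open>f k\<close> fail to be
  rich in blue, so that \<open>make_rich\<close> applies. It cannot be the centre, which is chosen
  last: \<open>x\<close> replaces a free copy \<open>p\<close> of the centre over \<open>f k\<close>
  and \<open>B\<close>, and therefore is at a large distance from the centre and from the points not
  yet treated.\<close>

lemma config_step:
  assumes c: "config F w J f B Y D" and k: "k \<in> J - D" and finJ: "finite J" and D: "D \<subseteq> J"
    and J: "w \<notin> J" "w \<notin> F" "J \<inter> F = {}" "\<not> large (d w k)"
    and min: "\<And>z z' r. \<lbrakk>z \<in> J; z' \<in> J; r \<in> S0; admissible (insert w F) r z z'\<rbrakk> \<Longrightarrow> d z z' \<le> r"
  obtains f' B' Y' where "config F w J f' B' Y' (insert k D)" "cone Y' Y"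
proof -
  let ?A = "insert w (F \<union> J)"
  have iso: "isom_on ?A f" and fF: "\<And>p. p \<in> F \<Longrightarrow> f p = p" and finB: "finite B" and FB: "F \<subseteq> B"
    and BY: "B \<subseteq> Y" and satY: "sat Y" and fw: "f w \<notin> B" and fJ: "\<And>z. z \<in> J \<Longrightarrow> f z \<notin> B"
    and wl: "(\<forall>p\<in>F. large (d w p)) \<Longrightarrow> (\<And>p. p \<in> B \<Longrightarrow> large (d (f w) p))"
    and zl: "\<And>z p. z \<in> J - D \<Longrightarrow> p \<in> B \<Longrightarrow> large (d (f z) p)"
    and can: "\<And>z z' r b. \<lbrakk>z \<in> J; z' \<in> J; r \<in> S0; admissible (insert w F) r z z'; b \<in> B\<rbrakk> \<Longrightarrow> tri (d (f z) b) (d (f z') b) r"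
    and ri: "\<And>z. z \<in> D \<Longrightarrow> rich R Y B (f z)"
    using c unfolding config_def by blast+
  have dJ: "d (f z) (f z') = d z z'" if "z \<in> insert w J" "z' \<in> insert w J" for z z'
    using isom_onD[OF iso] that by blast
  have inj: "f z = f z' \<longleftrightarrow> z = z'" if "z \<in> insert w J" "z' \<in> insert w J" for z z'
    using dJ[OF that] by (metis d_eq_0)
  let ?z = "f k" and ?w = "f w"
  have kJ: "k \<in> J" using k by blast
  have wz: "?w \<noteq> ?z" using inj[of w k] kJ J(1) by auto
  obtain p where p: "p \<notin> B \<union> f ` insert w J" "eqv (insert ?z B) p ?w"
    "\<And>y. y \<in> (B \<union> f ` insert w J) - insert ?z B \<Longrightarrow> d p y = M \<or> (\<exists>x\<in>insert ?z B. d p y = d ?w x \<oplus> d x y)"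
    using free_point[of "B \<union> f ` insert w J" "insert ?z B" ?w] finB finJ kJ fw wz by (auto simp: image_iff)
  \<comment> \<open>\<open>p\<close> is no closer to the configuration than its centre is. This
    gives the upper bound in the compatibility condition at \<open>x\<close>; the other two bounds
    come from \<open>min\<close>.\<close>
  have p_ge: "d ?w (f u) \<le> d p (f u)" if "u \<in> insert w J" for u
  proof (cases "f u = ?z")
    case True
    then show ?thesis using p(2) by simp
  next
    case False
    then have "f u \<in> (B \<union> f ` insert w J) - insert ?z B" using that fw fJ by auto
    then show ?thesis using p(3)[of "f u"] d_le_M d_tri[of ?w "f u"] by auto
  qed
  obtain x g where x: "x \<in> Y" "eqv B x ?w" "eqv B g ?z" "d g x = d ?z ?w" "\<not> rich (- R) Y (insert x B) g"
    using good_centre[OF satY finB BY fJ[OF kJ] zl[OF k] fw wz] by blast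
  have xp: "eqv B x p" "p \<notin> B" using x(2) p(1,2) by (auto simp: eqv_def)
  obtain m where m: "isom_on (insert p B \<union> f ` insert w J) m" "\<And>b. b \<in> B \<Longrightarrow> m b = b" "m p = x"
    using move[OF finB _ xp, of "f ` insert w J"] finJ by blast
  define f' where "f' = m \<circ> f"
  have mB: "d (m u) b = d u b" if "u \<in> f ` insert w J" "b \<in> B" for u b
    using isom_onD[OF m(1), of u b] m(2)[OF that(2)] that by auto
  have mx: "d (m u) x = d u p" if "u \<in> f ` insert w J" for u
    using isom_onD[OF m(1), of u p] m(3) that by auto
  have f'B: "d (f' u) b = d (f u) b" if "u \<in> insert w J" "b \<in> B" for u b
    using mB that by (auto simp: f'_def)
  have f'x: "d (f' u) x = d (f u) p" if "u \<in> insert w J" for u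
    using mx that by (auto simp: f'_def)
  have f'notin: "f' u \<notin> insert x B" if "u \<in> insert w J" for u
  proof -
    have "f u \<notin> B" "f u \<noteq> p" using that fw fJ p(1) by auto
    then have "d (f' u) x \<noteq> 0" "b \<in> B \<Longrightarrow> d (f' u) b \<noteq> 0" for b
      using f'x[OF that] f'B[OF that] by auto
    then show ?thesis using d_eq_0 by blast
  qed
  have "eqv B (f' k) g" using f'B[of k] kJ x(3) by (auto simp: eqv_def)
  moreover have "d (f' k) x = d g x"
    using f'x[of k] kJ p(2) x(4) by (simp add: d_sym[of ?z])
  ultimately have "eqv (insert x B) g (f' k)" by (simp add: eqv_sym)
  then have nb: "\<not> rich (- R) Y (insert x B) (f' k)" using x(5) rich_cong by blast
  have "d (f' k) x = d w k" using f'x[of k] kJ p(2) dJ[of w k] by (simp add: d_sym[of ?z])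
  then have small: "\<exists>p\<in>insert x B. \<not> large (d (f' k) p)" using J(4) by simp
  obtain Y' where Y': "cone Y' Y" "insert x B \<subseteq> Y'" "rich R Y' (insert x B) (f' k)"
    using make_rich[OF satY _ _ small nb f'notin] finB BY x(1) kJ by auto
  show thesis
  proof (rule that[OF _ Y'(1)])
    have "isom_on ?A f'"
      unfolding f'_def
    proof (rule isom_comp[OF iso m(1)])
      show "f ` ?A \<subseteq> insert p B \<union> f ` insert w J" using fF FB by auto
    qed
    moreover have "f' q = q" if "q \<in> F" for q using that fF m(2) FB by (auto simp: f'_def)
    moreover have "large (d (f' w) q)" if "\<forall>p\<in>F. large (d w p)" "q \<in> insert x B" for q
    proof (cases "q = x")
      case True
      have "?w \<in> (B \<union> f ` insert w J) - insert ?z B" using fw wz by auto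
      then have "large (d p ?w)"
        using large_path[of ?w "insert ?z B" ?w "d p ?w"] p(3) by blast
      then show ?thesis using True f'x[of w] by (simp add: d_sym[of p])
    next
      case False
      then show ?thesis using that wl f'B[of w q] by auto
    qed
    moreover have "large (d (f' u) q)" if "u \<in> J - insert k D" "q \<in> insert x B" for u q
    proof (cases "q = x")
      case True
      have "f u \<in> (B \<union> f ` insert w J) - insert ?z B" using that fJ inj[of u k] kJ by auto
      then have "large (d p (f u))"
        using large_path[of ?w "insert ?z B" "f u" "d p (f u)"] p(3) fw wz by blast
      then show ?thesis using True f'x[of u] that by (simp add: d_sym[of p])
    next
      case False
      then show ?thesis using that zl f'B[of u q] by auto
    qed
    moreover have "tri (d (f' u) b) (d (f' u') b) r"
      if u: "u \<in> J" "u' \<in> J" "r \<in> S0" "admissible (insert w F) r u u'" "b \<in> insert x B" for u u' r b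
    proof (cases "b = x")
      case True
      have le: "d v p \<le> d v' p \<oplus> r" if "d v v' \<le> r" for v v'
        using d_tri[of v p v'] oplus_mono[OF that order_refl, of "d v' p"] by (simp add: oplus_comm)
      have "d (f u) (f u') \<le> r" using min[OF u(1-4)] dJ u by simp
      then have "d (f u) p \<le> d (f u') p \<oplus> r" "d (f u') p \<le> d (f u) p \<oplus> r"
        using le[of "f u" "f u'"] le[of "f u'" "f u"] by (simp_all add: d_sym[of "f u'" "f u"])
      moreover have "r \<le> d (f u) p \<oplus> d (f u') p"
      proof -
        have "r \<le> d u w \<oplus> d u' w" using u(3,4) by (auto simp: admissible_def tri_iff)
        also have "\<dots> \<le> d (f u) p \<oplus> d (f u') p"
          using p_ge[of u] p_ge[of u'] dJ[of w u] dJ[of w u'] u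
          by (intro oplus_mono) (simp_all add: d_sym[of _ p] d_sym[of u w] d_sym[of u' w])
        finally show ?thesis .
      qed
      ultimately show ?thesis using True u f'x by (simp add: tri_iff)
    next
      case False
      then show ?thesis using can[OF u(1-4), of b] u f'B by auto
    qed
    moreover have "rich R Y' (insert x B) (f' u)" if "u \<in> insert k D" for u
    proof (cases "u = k")
      case True
      then show ?thesis using Y' by simp
    next
      case False
      then have u: "u \<in> D" "u \<in> insert w J" using that D by auto
      have "rich R Y' B (f u)" using cone_rich[OF Y'(1) satY ri[OF u(1)] finB] Y'(2) by blast
      moreover have "eqv B (f' u) (f u)" using f'B[OF u(2)] by (simp add: eqv_def)
      ultimately show ?thesis using rich_mono by blast
    qed
    ultimately show "config F w J f' (insert x B) Y' (insert k D)"
      unfolding config_def using finB FB Y'(2) cone_sat[OF Y'(1) satY] f'notin by blast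
  qed
qed

lemma config_all:
  assumes "config F w J f B Y D" and finJ: "finite J" and D: "D \<subseteq> J"
    and J: "w \<notin> J" "w \<notin> F" "J \<inter> F = {}" "\<And>k. k \<in> J \<Longrightarrow> \<not> large (d w k)"
    and min: "\<And>z z' r. \<lbrakk>z \<in> J; z' \<in> J; r \<in> S0; admissible (insert w F) r z z'\<rbrakk> \<Longrightarrow> d z z' \<le> r"
  shows "\<exists>f' B' Y'. config F w J f' B' Y' J \<and> Y' \<subseteq> Y \<and>
    (\<forall>v. rich R Y F v \<longrightarrow> rich R Y' F v)"
  using assms(1,3)
proof (induction "card (J - D)" arbitrary: f B Y D)
  case 0
  then have "D = J" using finJ by auto
  then show ?case using 0 by blast
next
  case (Suc n)
  then obtain k where k: "k \<in> J - D" by (metis card.empty ex_in_conv nat.distinct(1))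
  obtain f' B' Y' where *: "config F w J f' B' Y' (insert k D)" "cone Y' Y"
    using config_step[OF Suc.prems(1) k finJ Suc.prems(2) J(1-3) J(4) min] k by blast
  have "n = card (J - insert k D)" using Suc.hyps(2) k finJ by (metis Diff_insert card_Diff_singleton diff_Suc_1)
  from Suc.hyps(1)[OF this *(1)] k Suc.prems(2) obtain f'' B'' Y'' where
    **: "config F w J f'' B'' Y'' J" "Y'' \<subseteq> Y'" "\<forall>v. rich R Y' F v \<longrightarrow> rich R Y'' F v" by blast
  moreover have "rich R Y' F v" if "rich R Y F v" for v
  proof (rule cone_rich[OF *(2) _ that])
    show "sat Y" using Suc.prems(1) by (simp add: config_def)
    have FB: "finite B'" "F \<subseteq> B'" "B' \<subseteq> Y'" using *(1) unfolding config_def by blast+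
    then show "finite F" "F \<subseteq> Y'" using finite_subset by blast+
  qed
  ultimately show ?case using *(2) by (metis cone_def subset_trans)
qed

text \<open>The types that become small through the new point are made rich over auxiliary points
  \<open>B\<close> beforehand; then the new point is chosen red in the type of the moved centre over
  \<open>B\<close>, and \<open>B\<close> is forgotten.\<close>

lemma inconsistent: False
proof (rule red_build)
  fix F Y w assume finF: "finite F" and FY: "F \<subseteq> Y" and satY: "sat Y" and w: "w \<in> Y" "w \<notin> F"
    and IF: "\<And>v. \<lbrakk>v \<notin> F; \<exists>p\<in>F. \<not> large (d v p)\<rbrakk> \<Longrightarrow> rich R Y F v"
  obtain J0 where J0: "finite J0" "J0 \<inter> insert w F = {}" "\<And>v. v \<notin> insert w F \<Longrightarrow> \<exists>z\<in>J0. eqv (insert w F) z v"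
    "\<And>z z' r. \<lbrakk>z \<in> J0; z' \<in> J0; r \<in> S0; admissible (insert w F) r z z'\<rbrakk> \<Longrightarrow> d z z' \<le> r"
    using representatives[of "insert w F"] finF by blast
  \<comment> \<open>Only types that become small through the new point alone; those small over
    \<open>F\<close> are rich already.\<close>
  define J where "J = {z \<in> J0. \<not> large (d w z) \<and> (\<forall>p\<in>F. large (d z p))}"
  have J: "finite J" "w \<notin> J" "J \<inter> F = {}" "\<And>k. k \<in> J \<Longrightarrow> \<not> large (d w k)"
    "\<And>z z' r. \<lbrakk>z \<in> J; z' \<in> J; r \<in> S0; admissible (insert w F) r z z'\<rbrakk> \<Longrightarrow> d z z' \<le> r"
    using J0(1,2,4) by (auto simp: J_def)
  have "config F w J id F Y {}"
    unfolding config_def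
    using finF FY satY w(2) J(3) by (auto simp: isom_on_def J_def admissible_def)
  from config_all[OF this J(1) _ J(2) w(2) J(3) J(4) J(5)] obtain f B Y1 where
    c: "config F w J f B Y1 J" and Y1: "Y1 \<subseteq> Y" "\<And>v. rich R Y F v \<Longrightarrow> rich R Y1 F v" by auto
  have iso: "isom_on (insert w (F \<union> J)) f" and fF: "\<And>p. p \<in> F \<Longrightarrow> f p = p" and finB: "finite B" and FB: "F \<subseteq> B"
    and BY: "B \<subseteq> Y1" and satY1: "sat Y1" and fw: "f w \<notin> B" and fJ: "\<And>z. z \<in> J \<Longrightarrow> f z \<notin> B"
    and wl: "(\<forall>p\<in>F. large (d w p)) \<Longrightarrow> (\<And>p. p \<in> B \<Longrightarrow> large (d (f w) p))"
    and can: "\<And>z z' r b. \<lbrakk>z \<in> J; z' \<in> J; r \<in> S0; admissible (insert w F) r z z'; b \<in> B\<rbrakk> \<Longrightarrow> tri (d (f z) b) (d (f z') b) r"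
    and ri: "\<And>z. z \<in> J \<Longrightarrow> rich R Y1 B (f z)"
    using c unfolding config_def by blast+
  have fwF: "eqv F (f w) w" using isom_eqv[OF iso, of F w] fF by blast
  obtain x where x: "x \<in> Y1" "x \<in> R" "eqv B x (f w)"
  \<comment> \<open>If the centre has large distances to \<open>F\<close>, then
    \<open>config\<close> has kept its distances to \<open>B\<close> large and both colours occur;
    otherwise its type over \<open>F\<close> is rich in red by the invariant.\<close>
  proof (cases "\<forall>p\<in>F. large (d w p)")
    case True
    then show thesis using large_colours(1)[OF satY1 finB BY fw wl] that by blast
  next
    case False
    then have "rich R Y1 F w" using IF w(2) Y1(2) by blast
    then show thesis using richD[of R Y1 F w B "f w"] finB FB BY fw fwF that by blast
  qed
  have xB: "x \<notin> B" using eqv_notin[OF x(3) fw] .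
  obtain m where m: "isom_on (insert (f w) B \<union> f ` J) m" "\<And>b. b \<in> B \<Longrightarrow> m b = b" "m (f w) = x"
    using move[OF finB _ x(3) fw, of "f ` J"] J(1) by blast
  have mB: "d (m (f z)) b = d (f z) b" if "z \<in> J" "b \<in> B" for z b
    using isom_onD[OF m(1), of "f z" b] m(2) that by simp
  have mx: "d (m (f z)) x = d z w" if "z \<in> J" for z
    using isom_onD[OF m(1), of "f z" "f w"] isom_onD[OF iso, of z w] m(3) that by simp
  have fzF: "d (f z) p = d z p" if "z \<in> J" "p \<in> F" for z p
    using isom_onD[OF iso, of z p] fF that by simp
  define Zs where "Zs = (\<lambda>z. m (f z)) ` J"
  obtain Y2 where Y2: "cone Y2 Y1" "insert x F \<subseteq> Y2"
    "\<And>y z. \<lbrakk>y \<in> Y2; z \<in> Zs; eqv (insert x F) y z\<rbrakk> \<Longrightarrow> eqv (insert x B) y z"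
  proof (rule forget_points[OF satY1, of "insert x B" "insert x F" Zs])
    show "Zs \<inter> insert x B = {}"
    proof -
      have "m (f z) \<noteq> x" "m (f z) \<notin> B" if "z \<in> J" for z
        using mx[OF that] mB[OF that] fJ[OF that] J(2) that d_eq_0 by metis+
      then show ?thesis by (auto simp: Zs_def)
    qed
    fix u u' r b assume u: "u \<in> Zs" "u' \<in> Zs" "r \<in> S0" "\<And>p. p \<in> insert x F \<Longrightarrow> tri (d u p) (d u' p) r" "b \<in> insert x B"
    then obtain z z' where z: "z \<in> J" "z' \<in> J" "u = m (f z)" "u' = m (f z')" by (auto simp: Zs_def)
    have "admissible (insert w F) r z z'"
      unfolding admissible_def
    proof
      fix p assume "p \<in> insert w F"
      then consider "p = w" | "p \<in> F" by blast
      then show "tri (d z p) (d z' p) r"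
      proof cases
        case 1
        then show ?thesis using u(4)[of x] mx z by simp
      next
        case 2
        then have "p \<in> B" using FB by blast
        then show ?thesis using u(4)[of p] mB[OF z(1), of p] mB[OF z(2), of p] fzF[OF z(1)] fzF[OF z(2)] 2 z by simp
      qed
    qed
    from can[OF z(1,2) u(3) this] show "tri (d u b) (d u' b) r"
      using u(4)[of x] u(5) z mB by (cases "b = x") auto
  qed (use finB FB BY x(1) J(1) in \<open>auto simp: Zs_def\<close>)
  show "\<exists>x Y'. x \<in> R \<and> eqv F x w \<and> Y' \<subseteq> Y \<and> insert x F \<subseteq> Y' \<and> sat Y' \<and>
        (\<forall>v. v \<notin> insert x F \<and> (\<exists>p\<in>insert x F. \<not> large (d v p)) \<longrightarrow> rich R Y' (insert x F) v)"
  proof (intro exI[of _ x] exI[of _ Y2] conjI allI impI)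
    show xF: "eqv F x w" using x(3) FB fwF eqv_trans eqv_subset by blast
    show "Y2 \<subseteq> Y" using Y2(1) Y1(1) by (auto simp: cone_def)
    show "sat Y2" using cone_sat Y2(1) satY1 by blast
    fix v assume v: "v \<notin> insert x F \<and> (\<exists>p\<in>insert x F. \<not> large (d v p))"
    show "rich R Y2 (insert x F) v"
    proof (cases "\<exists>p\<in>F. \<not> large (d v p)")
      case True
      then have "rich R Y1 F v" using IF v Y1(2) by blast
      then have "rich R Y2 F v" using cone_rich[OF Y2(1) satY1] finF Y2(2) by blast
      then show ?thesis using rich_mono by (meson eqv_refl subset_insertI)
    next
      case False
      then have vx: "\<not> large (d v x)" using v by blast
      have "x \<notin> F" using xB FB by blast
      \<comment> \<open>Carries \<open>v\<close> from \<open>insert x F\<close> back to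
        \<open>insert w F\<close>, where the representatives live.\<close>
      then obtain h where h: "isom_on (insert x F \<union> {v}) h" "\<And>b. b \<in> F \<Longrightarrow> h b = b" "h x = w"
        using move[OF finF _ eqv_sym[OF xF], of "{v}"] by blast
      have hF: "eqv F (h v) v" using isom_eqv[OF h(1), of F v] h(2) by blast
      have hw: "d (h v) w = d v x" using isom_onD[OF h(1), of v x] h(3) by simp
      have "h v \<notin> insert w F"
        using eqv_notin[OF hF] v hw d_eq_0 by (metis d_self insert_iff)
      then obtain z where z: "z \<in> J0" "eqv (insert w F) z (h v)" using J0(3) by blast
      have zF: "d z p = d v p" if "p \<in> F" for p using z(2) hF that by (simp add: eqv_def)
      have zw: "d z w = d v x" using z(2) hw by simp
      have zJ: "z \<in> J" using z(1) zF zw vx False by (auto simp: J_def d_sym[of w])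
      let ?u = "m (f z)"
      have uv: "eqv (insert x F) ?u v"
        using mx[OF zJ] zw mB[OF zJ] fzF[OF zJ] zF FB by (auto simp: eqv_def)
      have "eqv B ?u (f z)" using mB[OF zJ] by (simp add: eqv_def)
      then have "rich R Y1 (insert x B) ?u" using ri[OF zJ] rich_mono by (meson subset_insertI)
      then have "rich R Y2 (insert x F) ?u"
        by (rule rich_transfer[OF Y2(1) satY1]) (use finB BY x(1) Y2 zJ in \<open>auto simp: Zs_def\<close>)
      then show ?thesis using rich_cong eqv_sym[OF uv] by blast
    qed
  qed (use x Y2 in auto)
qed

end

section \<open>Clusters\<close>

locale two_level_copy = no_mono_copy +
  fixes i :: real
  assumes i_in: "i \<in> S" and i_small: "\<not> large i"
    and small_sum: "\<lbrakk>s \<in> S; t \<in> S; \<not> large s; \<not> large t\<rbrakk> \<Longrightarrow> s \<oplus> t = i"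
    and cross_sum: "\<lbrakk>s \<in> S; t \<in> S; \<not> large s; large t\<rbrakk> \<Longrightarrow> s \<oplus> t = i \<oplus> t"
begin

definition near where "near x y \<longleftrightarrow> \<not> large (d x y)"

lemma near_refl [simp]: "near x x"
proof -
  have "0 \<oplus> 0 \<noteq> M" using M_in S_pos by auto
  then show ?thesis by (simp add: near_def large_def)
qed

lemma near_sym: "near x y \<Longrightarrow> near y x" by (simp add: near_def d_sym)

lemma near_trans:
  assumes "near x y" "near y z" shows "near x z"
proof (cases "x = y \<or> y = z")
  case True
  then show ?thesis using assms by auto
next
  case False
  then have "d x y \<oplus> d y z = i" using small_sum d_in_S assms by (simp add: near_def)
  then have "d x z \<le> i" using d_tri[of x z y] by simp
  then show ?thesis using large_mono i_small by (auto simp: near_def)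
qed

lemma small_le_i: "s \<in> S \<Longrightarrow> \<not> large s \<Longrightarrow> s \<le> i"
  using le_oplus1[OF S_S0, of s s] small_sum[of s s] by simp

lemma i_less_large: "large t \<Longrightarrow> i < t"
  using large_mono[of t i] i_small by force

text \<open>Small distances act alike: two of them sum to \<open>i\<close>, which bounds all of
  them, and added to a large distance each has the effect of \<open>i\<close>. So the distance
  between two points of a cluster can be changed to any small one.\<close>

lemma cluster_free:
  assumes "near z z'" "b \<noteq> z" "b \<noteq> z'" "r \<in> S" "\<not> large r"
  shows "tri (d z b) (d z' b) r"
proof -
  have S: "d z b \<in> S" "d z' b \<in> S" using assms(2,3) d_in_S by metis+
  show ?thesis
  proof (cases "near z b")
    case True
    then have "near z' b" using assms(1) near_sym near_trans by blast
    then show ?thesis using True S assms(4,5) small_sum small_le_i S_S0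
      by (simp add: tri_iff near_def)
  next
    case False
    then have "\<not> near z' b" using assms(1) near_sym near_trans by blast
    then have L: "large (d z b)" "large (d z' b)" using False by (auto simp: near_def)
    have le: "d u b \<le> d u' b \<oplus> r" if "near u u'" "u' \<noteq> b" "large (d u' b)" for u u'
    proof (cases "u = u'")
      case True
      then show ?thesis by (simp add: le_oplus1)
    next
      case False
      then have "d u u' \<oplus> d u' b = r \<oplus> d u' b"
        using that assms(4,5) d_in_S cross_sum[of r "d u' b"] cross_sum[of "d u u'" "d u' b"]
        by (simp add: near_def)
      then show ?thesis using d_tri[of u b u'] by (simp add: oplus_comm)
    qed
    have "r \<le> d z b" using small_le_i[OF assms(4,5)] i_less_large[OF L(1)] by simp
    then have "r \<le> d z b \<oplus> d z' b" using le_oplus1[of "d z b" "d z' b"] by (simp del: oplus_in)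
    then show ?thesis using le[of z z'] le[of z' z] L assms near_sym S_S0 by (simp add: tri_iff)
  qed
qed

text \<open>A new point near \<open>F\<close> creates no new small types, since nearness is
  transitive. Otherwise it opens a cluster, and one is sought in which finitely many auxiliary
  points force every type in \<open>J\<close> to be red.\<close>

lemma inconsistent: False
proof (rule red_build)
  fix F Y w assume finF: "finite F" and FY: "F \<subseteq> Y" and satY: "sat Y" and w: "w \<in> Y" "w \<notin> F"
    and IF: "\<And>v. \<lbrakk>v \<notin> F; \<exists>p\<in>F. \<not> large (d v p)\<rbrakk> \<Longrightarrow> rich R Y F v"
  let ?goal = "\<exists>x Y'. x \<in> R \<and> eqv F x w \<and> Y' \<subseteq> Y \<and> insert x F \<subseteq> Y' \<and> sat Y' \<and>
        (\<forall>v. v \<notin> insert x F \<and> (\<exists>p\<in>insert x F. \<not> large (d v p)) \<longrightarrow> rich R Y' (insert x F) v)"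
  show ?goal
  proof (cases "\<exists>p\<in>F. near w p")
    case True
    then obtain p where p: "p \<in> F" "near w p" by blast
    then have "rich R Y F w" using IF w(2) by (auto simp: near_def)
    from richD[OF this finF order_refl FY w(2) eqv_refl]
    obtain x where x: "x \<in> Y" "eqv F x w" "x \<in> R" by blast
    have "rich R Y (insert x F) v" if v: "v \<notin> insert x F" "\<exists>q\<in>insert x F. \<not> large (d v q)" for v
    proof -
      have "near x p" using x(2) p by (simp add: eqv_def near_def)
      then have "\<exists>q\<in>F. near v q" using v(2) near_trans p(1) by (auto simp: near_def[symmetric])
      then have "rich R Y F v" using IF v(1) by (auto simp: near_def)
      then show ?thesis using rich_mono by (meson eqv_refl subset_insertI)
    qed
    then show ?goal using x FY satY by (intro exI[of _ x] exI[of _ Y]) auto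
  next
    case False
    then have wl: "large (d w p)" if "p \<in> F" for p using that by (auto simp: near_def)
    obtain J0 where J0: "finite J0" "J0 \<inter> insert w F = {}" "\<And>v. v \<notin> insert w F \<Longrightarrow> \<exists>z\<in>J0. eqv (insert w F) z v"
      "\<And>z z' r. \<lbrakk>z \<in> J0; z' \<in> J0; r \<in> S0; admissible (insert w F) r z z'\<rbrakk> \<Longrightarrow> d z z' \<le> r"
      using representatives[of "insert w F"] finF by blast
    define J where "J = {z \<in> J0. near z w}"
    have J: "finite J" "w \<notin> J" "J \<inter> F = {}" using J0(1,2) by (auto simp: J_def)
    have J_inj: "z = z'" if "z \<in> J" "z' \<in> J" "eqv (insert w F) z z'" for z z'
    proof -
      have "admissible (insert w F) 0 z z'" using that(3) unfolding admissible_def tri_def eqv_def by simp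
      then have "d z z' \<le> 0" using J0(4) that by (simp add: J_def)
      then have "d z z' = 0" using d_nonneg by (rule antisym)
      then show ?thesis by simp
    qed
    \<comment> \<open>\<open>hot z\<close> and hence \<open>col\<close> are constant on clusters. A set \<open>vals G v\<close> of least size no longer
      shrinks when \<open>G\<close> grows, so one colour is found over all further finite sets.\<close>
    define hot where "hot z y \<longleftrightarrow> (\<exists>E q. finite E \<and> F \<subseteq> E \<and> E \<subseteq> Y \<and> q \<notin> E \<and> eqv F q z \<and>
       (\<exists>e\<in>E. near e y \<and> near q e) \<and> (\<forall>u\<in>Y. eqv E u q \<longrightarrow> u \<in> R))" for z y
    define col where "col y = {z \<in> J. hot z y}" for y
    have hot_near: "hot z y'" if hy: "hot z y" and n: "near y y'" for z y y'
    proof -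
      obtain E q e where "finite E" "F \<subseteq> E" "E \<subseteq> Y" "q \<notin> E" "eqv F q z" "e \<in> E" "near e y" "near q e"
        "\<forall>u\<in>Y. eqv E u q \<longrightarrow> u \<in> R" using hy unfolding hot_def by blast
      moreover have "near e y'" using \<open>near e y\<close> n near_trans by blast
      ultimately show ?thesis unfolding hot_def by (intro exI[of _ E] exI[of _ q]) blast
    qed
    have col_near: "col y = col y'" if "near y y'" for y y'
      using hot_near that near_sym[OF that] by (auto simp: col_def)
    define gd where "gd G v \<longleftrightarrow> finite G \<and> F \<subseteq> G \<and> G \<subseteq> Y \<and> v \<notin> G \<and> eqv F v w \<and> (\<forall>p\<in>G. large (d v p))" for G v
    define vals where "vals G v = col ` {c \<in> Y. eqv G c v}" for G v
    have fin_vals: "finite (vals G v)" for G v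
      by (rule finite_subset[of _ "Pow J"]) (auto simp: vals_def col_def J(1))
    have "gd F w" using finF FY w(2) wl by (simp add: gd_def)
    then have "\<exists>s. gd (fst s) (snd s)" by auto
    then obtain s where s: "gd (fst s) (snd s)"
      "\<And>t. gd (fst t) (snd t) \<Longrightarrow> card (vals (fst s) (snd s)) \<le> card (vals (fst t) (snd t))"
      using ex_has_least_nat[of "\<lambda>s. gd (fst s) (snd s)" _ "\<lambda>s. card (vals (fst s) (snd s))"] by blast
    define F' w' where "F' = fst s" "w' = snd s"
    have F': "finite F'" "F \<subseteq> F'" "F' \<subseteq> Y" "w' \<notin> F'" "eqv F w' w" "\<And>p. p \<in> F' \<Longrightarrow> large (d w' p)"
      using s(1) by (auto simp: gd_def F'_w'_def)
    obtain c0 where c0: "c0 \<in> Y" "eqv F' c0 w'" using sat_pt[OF satY F'(1,3,4)] by blast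
    have dense: "\<exists>c\<in>Y. eqv E c v \<and> col c = col c0"
      if E: "finite E" "F' \<subseteq> E" "E \<subseteq> Y" "v \<notin> E" "eqv F' v w'" "\<And>e. e \<in> E \<Longrightarrow> \<not> near v e" for E v
    proof -
      have "eqv F v w" using E(5) F'(2,5) eqv_subset eqv_trans by blast
      then have "gd E v" using E F'(2) by (auto simp: gd_def near_def)
      then have "card (vals F' w') \<le> card (vals E v)" using s(2)[of "(E, v)"] by (simp add: F'_w'_def)
      moreover have "vals E v \<subseteq> vals F' w'"
        using E(2,5) eqv_subset eqv_trans unfolding vals_def by blast
      ultimately have "vals E v = vals F' w'" using card_seteq fin_vals by blast
      moreover have "col c0 \<in> vals F' w'" using c0 by (auto simp: vals_def)
      ultimately have "col c0 \<in> vals E v" by simp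
      then obtain c where "c \<in> Y" "eqv E c v" "col c0 = col c" unfolding vals_def by blast
      then show ?thesis by metis
    qed
    \<comment> \<open>If \<open>z\<close> is not hot at \<open>c0\<close>, then in clusters of the
      colour of \<open>c0\<close> its refinements all contain blue points. Staying in such clusters
      gives a blue copy in the orbit of \<open>h\<close>, which is placed relative to
      \<open>w'\<close> as \<open>z\<close> is to \<open>w\<close>.\<close>
    have all_hot: "hot z c0" if zJ: "z \<in> J" for z
    proof (rule ccontr)
      assume "\<not> hot z c0"
      then have z_not: "z \<notin> col c0" by (simp add: col_def)
      have cold: "\<exists>u\<in>Y. eqv E u q \<and> u \<notin> R"
        if "col y = col c0" "finite E" "F \<subseteq> E" "E \<subseteq> Y" "q \<notin> E" "eqv F q z" "e \<in> E" "near e y" "near q e" for y E q e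
      proof (rule ccontr)
        assume "\<not> ?thesis"
        then have "hot z y" using that(2-) unfolding hot_def by (intro exI[of _ E] exI[of _ q]) blast
        then show False using z_not that(1) zJ by (auto simp: col_def)
      qed
      obtain f where f: "isom_on (insert w F \<union> {z}) f" "\<And>b. b \<in> F \<Longrightarrow> f b = b" "f w = w'"
        using move[OF finF _ F'(5) w(2), of "{z}"] by blast
      define h where "h = f z"
      have hF: "eqv F h z" using isom_eqv[OF f(1), of F z] f(2) by (auto simp: h_def)
      have hw: "d h w' = d z w" using isom_onD[OF f(1), of z w] f(3) by (simp add: h_def)
      have zw: "z \<noteq> w" "near z w" using zJ J(2) by (auto simp: J_def)
      have near_hw: "near h w'" using hw zw by (simp add: near_def)
      have hl: "\<not> near h p" if "p \<in> F'" for p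
        using near_trans[OF near_sym[OF near_hw]] F'(6)[OF that] by (auto simp: near_def)
      have hF': "h \<notin> F'" using hl near_refl by blast
      obtain Z where "sat Z" "Z \<subseteq> {y \<in> Y. y \<notin> R \<and> col y = col c0}"
      proof (rule large_build[OF satY F'(1,3) hF', where P = "\<lambda>y. y \<notin> R \<and> col y = col c0"])
        show "large (d h p)" if "p \<in> F'" for p using hl[OF that] by (simp add: near_def)
        fix G v assume G: "finite G" "G \<subseteq> {y \<in> Y. eqv F' y h \<and> (y \<notin> R \<and> col y = col c0)}"
          and v: "v \<notin> F' \<union> G" "eqv F' v h"
        let ?E = "F' \<union> G"
        have E: "finite ?E" "F \<subseteq> ?E" "?E \<subseteq> Y" using F' G by auto
        have vz: "eqv F v z" using v(2) F'(2) hF eqv_subset eqv_trans by blast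
        show "\<exists>y\<in>Y. eqv ?E y v \<and> (y \<notin> R \<and> col y = col c0)"
        \<comment> \<open>If \<open>v\<close> joins a cluster already present, that cluster has the
          right colour. Otherwise \<open>dense\<close> finds one, which is entered next to the
          auxiliary point \<open>c\<close>.\<close>
        proof (cases "\<exists>e\<in>?E. near v e")
          case True
          then obtain e where e: "e \<in> ?E" "near v e" by blast
          have "e \<in> G" using e hl[of e] v(2) by (auto simp: eqv_def near_def)
          then have ce: "col e = col c0" using G by blast
          obtain u where u: "u \<in> Y" "eqv ?E u v" "u \<notin> R"
            using cold[OF ce E v(1) vz e(1) near_refl e(2)] by blast
          have "near u e" using u(2) e by (auto simp: eqv_def near_def)
          then show ?thesis using u col_near ce by blast
        next
          case False
          obtain g where g: "isom_on (insert h F' \<union> {w'}) g" "\<And>b. b \<in> F' \<Longrightarrow> g b = b" "g h = v"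
            using move[OF F'(1) _ v(2) hF', of "{w'}"] by blast
          have v1: "eqv F' (g w') w'" using isom_eqv[OF g(1), of F' w'] g(2) by blast
          have dv1: "d v (g w') = d z w" using isom_onD[OF g(1), of h w'] g(3) hw by simp
          have nv: "near v (g w')" using dv1 zw by (simp add: near_def)
          have v1E: "\<not> near (g w') e" if "e \<in> ?E" for e using False near_trans[OF nv] that by blast
          then have v1n: "g w' \<notin> ?E" using near_refl by blast
          obtain c where c: "c \<in> Y" "eqv ?E c (g w')" "col c = col c0"
            using dense[OF E(1) _ E(3) v1n v1 v1E] by blast
          obtain m where m: "isom_on (insert (g w') ?E \<union> {v}) m" "\<And>b. b \<in> ?E \<Longrightarrow> m b = b" "m (g w') = c"
            using move[OF E(1) _ c(2) v1n, of "{v}"] by blast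
          have v2: "eqv ?E (m v) v" using isom_eqv[OF m(1), of ?E v] m(2) by blast
          have dv2: "d (m v) c = d z w" using isom_onD[OF m(1), of v "g w'"] m(3) dv1 by simp
          have nc: "near (m v) c" using dv2 zw by (simp add: near_def)
          have "m v \<noteq> c" using dv2 zw(1) d_eq_0 by metis
          then have "m v \<notin> insert c ?E" using eqv_notin[OF v2 v(1)] by blast
          moreover have "eqv F (m v) z" using v2 E(2) vz eqv_subset eqv_trans by blast
          moreover have "finite (insert c ?E)" "F \<subseteq> insert c ?E" "insert c ?E \<subseteq> Y" using E c(1) by auto
          ultimately obtain u where u: "u \<in> Y" "eqv (insert c ?E) u (m v)" "u \<notin> R"
            using cold[OF c(3) _ _ _ _ _ insertI1 near_refl nc] by blast
          have "near u c" using u(2) nc by (simp add: near_def)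
          then have "col u = col c0" using col_near c(3) by blast
          moreover have "eqv ?E u v" using u(2) v2 eqv_trans by (metis eqv_insert)
          ultimately show ?thesis using u by blast
        qed
      qed
      then show False using no_blue by blast
    qed
    have "\<forall>z\<in>J. \<exists>E q e. finite E \<and> F \<subseteq> E \<and> E \<subseteq> Y \<and> q \<notin> E \<and> eqv F q z \<and>
       e \<in> E \<and> near e c0 \<and> near q e \<and> (\<forall>u\<in>Y. eqv E u q \<longrightarrow> u \<in> R)"
    proof
      fix z assume "z \<in> J"
      then have "hot z c0" by (rule all_hot)
      then show "\<exists>E q e. finite E \<and> F \<subseteq> E \<and> E \<subseteq> Y \<and> q \<notin> E \<and> eqv F q z \<and>
         e \<in> E \<and> near e c0 \<and> near q e \<and> (\<forall>u\<in>Y. eqv E u q \<longrightarrow> u \<in> R)"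
        unfolding hot_def by (elim exE conjE bexE, intro exI conjI)
    qed
    then obtain E q e where Eqe: "\<And>z. z \<in> J \<Longrightarrow> finite (E z) \<and> F \<subseteq> E z \<and> E z \<subseteq> Y \<and> q z \<notin> E z \<and> eqv F (q z) z \<and>
       e z \<in> E z \<and> near (e z) c0 \<and> near (q z) (e z) \<and> (\<forall>u\<in>Y. eqv (E z) u (q z) \<longrightarrow> u \<in> R)"
      by metis
    define B where "B = F \<union> (\<Union>z\<in>J. E z)"
    have B: "finite B" "F \<subseteq> B" "B \<subseteq> Y" "\<And>z. z \<in> J \<Longrightarrow> E z \<subseteq> B"
      using Eqe finF FY J(1) by (auto simp: B_def)
    have near_c0: "near u c0" if "z \<in> J" "eqv (E z) u (q z)" for u z
    proof -
      have "near u (e z)" using Eqe[OF that(1)] that(2) by (auto simp: eqv_def near_def)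
      then show ?thesis using Eqe[OF that(1)] near_trans by blast
    qed
    \<comment> \<open>The new point must be red and look like \<open>w\<close> over
      \<open>F\<close>. A twin of \<open>w\<close> at distance \<open>i\<close> shows that this type
      over \<open>F\<close> occurs in \<open>J\<close>, whose types are all forced to be red near
      \<open>c0\<close>.\<close>
    obtain z0 where z0: "z0 \<in> J" "eqv F z0 w"
    proof -
      have "i \<le> d w y \<oplus> d w y" if "y \<noteq> w" for y
      proof (cases "large (d w y)")
        case True
        then show ?thesis using le_M[OF S_S0[OF i_in]] by (simp add: large_def)
      next
        case False
        then show ?thesis using small_sum d_in_S that by simp
      qed
      then obtain v where v: "v \<notin> F" "v \<noteq> w" "eqv (F - {w}) v w" "d v w = i"
        using twin[OF finF i_in, of w] by blast
      obtain z where z: "z \<in> J0" "eqv (insert w F) z v" using J0(3)[of v] v by blast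
      have "near z w" using z(2) v(4) i_small by (simp add: near_def)
      moreover have "eqv F z w" using z(2) v(3) w(2) by (auto simp: eqv_def)
      ultimately show thesis using that z(1) by (auto simp: J_def)
    qed
    obtain q0 where q0: "q0 \<notin> B" "eqv (E z0) q0 (q z0)"
      using fresh[OF B(1), of "E z0" "q z0"] Eqe[OF z0(1)] by blast
    obtain x where x: "x \<in> Y" "eqv B x q0" "x \<notin> B" using sat_pt[OF satY B(1,3) q0(1)] by blast
    have xq: "eqv (E z0) x (q z0)" using x(2) q0(2) B(4)[OF z0(1)] eqv_subset eqv_trans by blast
    have xR: "x \<in> R" using Eqe[OF z0(1)] x(1) xq by blast
    have xw: "eqv F x w" using Eqe[OF z0(1)] xq z0(2) eqv_subset eqv_trans by metis
    have xc: "near x c0" using near_c0[OF z0(1) xq] .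
    \<comment> \<open>All forced points lie in the cluster of \<open>c0\<close>, which is that of
      \<open>x\<close>, so their distance to \<open>x\<close> can be prescribed by
      \<open>cluster_free\<close>.\<close>
    have "\<exists>y. y \<notin> insert x B \<and> eqv (E z) y (q z) \<and> d y x = d z w" if z: "z \<in> J" for z
    proof -
      obtain u where u: "u \<notin> insert x B" "eqv (E z) u (q z)"
        using fresh[of "insert x B" "E z" "q z"] B(1) Eqe[OF z] by blast
      have nux: "near u x" using near_c0[OF z u(2)] xc near_sym near_trans by blast
      have "z \<noteq> w" using z J(2) by blast
      then have r: "d z w \<in> S" "\<not> large (d z w)" using z d_in_S by (auto simp: J_def near_def)
      define f where "f b = (if b = x then d z w else d u b)" for b
      have fr: "tri (d z w) (d u b) (d x b)" if "b \<in> B" for b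
        using cluster_free[OF nux _ _ r, of b] u(1) x(3) that tri_commute by blast
      obtain y where y: "y \<notin> insert x B" "\<And>b. b \<in> insert x B \<Longrightarrow> d y b = f b"
      proof (rule realize[of "insert x B" f])
        show "f b \<in> S" if "b \<in> insert x B" for b using that r(1) u(1) d_in_S[of u b] by (auto simp: f_def)
        show "tri (f a) (f b) (d a b)" if "a \<in> insert x B" "b \<in> insert x B" "a \<noteq> b" for a b
          using that fr[of a] fr[of b] tri_d[of u a b] tri_commute(1) by (auto simp: f_def d_sym[of a x])
      qed (use B(1) in auto)
      have "eqv (E z) y (q z)" using y(2) u(2) B(4)[OF z] x(3) by (auto simp: eqv_def f_def)
      then show ?thesis using y by (intro exI[of _ y]) (auto simp: f_def)
    qed
    then obtain y where y: "\<And>z. z \<in> J \<Longrightarrow> y z \<notin> insert x B \<and> eqv (E z) (y z) (q z) \<and> d (y z) x = d z w"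
      by metis
    have yF: "d (y z) p = d z p" if "z \<in> J" "p \<in> F" for z p
      using y[OF that(1)] Eqe[OF that(1)] that(2) by (auto simp: eqv_def)
    have yc: "near (y z) c0" if "z \<in> J" for z using near_c0 y that by blast
    obtain Y2 where Y2: "cone Y2 Y" "insert x F \<subseteq> Y2"
      "\<And>u z. \<lbrakk>u \<in> Y2; z \<in> y ` J; eqv (insert x F) u z\<rbrakk> \<Longrightarrow> eqv (insert x B) u z"
    proof (rule forget_points[OF satY, of "insert x B" "insert x F" "y ` J"])
      show "y ` J \<inter> insert x B = {}" using y by blast
      fix u u' r b assume u: "u \<in> y ` J" "u' \<in> y ` J" "r \<in> S0" "\<And>p. p \<in> insert x F \<Longrightarrow> tri (d u p) (d u' p) r" "b \<in> insert x B"
      then obtain z z' where z: "z \<in> J" "z' \<in> J" "u = y z" "u' = y z'" by blast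
      show "tri (d u b) (d u' b) r"
      \<comment> \<open>\<open>r = 0\<close> forces equal types and hence equal representatives; any
        other \<open>r\<close> is at most \<open>i\<close> and so small, as
        \<open>cluster_free\<close> requires.\<close>
      proof (cases "r = 0")
        case True
        then have "d u p = d u' p" if "p \<in> insert x F" for p using u(4)[OF that] by (simp add: tri_def)
        then have "eqv (insert w F) z z'"
          unfolding eqv_def using y[OF z(1)] y[OF z(2)] yF[OF z(1)] yF[OF z(2)] z(3,4) by force
        then have "z = z'" using J_inj z by blast
        then show ?thesis using True z by (simp add: tri_def)
      next
        case False
        then have rS: "r \<in> S" using u(3) by (auto simp: S0_def)
        have "r \<le> d z w \<oplus> d z' w" using u(3) u(4)[of x] y[OF z(1)] y[OF z(2)] z by (simp add: tri_iff)
        also have "\<dots> = i"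
        proof -
          have "z \<noteq> w" "z' \<noteq> w" using z J(2) by blast+
          then show ?thesis using z d_in_S by (intro small_sum) (auto simp: J_def near_def)
        qed
        finally have "\<not> large r" using large_mono i_small by blast
        moreover have "near u u'" using yc z near_sym near_trans by blast
        moreover have "b \<noteq> u" "b \<noteq> u'" using u(5) y z by auto
        ultimately show ?thesis using cluster_free rS by blast
      qed
    qed (use B x(1) J(1) in auto)
    show ?goal
    proof (intro exI[of _ x] exI[of _ Y2] conjI allI impI)
      show "Y2 \<subseteq> Y" using Y2(1) by (auto simp: cone_def)
      show satY2: "sat Y2" using cone_sat Y2(1) satY by blast
      fix v assume v: "v \<notin> insert x F \<and> (\<exists>p\<in>insert x F. \<not> large (d v p))"
      show "rich R Y2 (insert x F) v"
      proof (cases "\<exists>p\<in>F. \<not> large (d v p)")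
        case True
        then have "rich R Y F v" using IF v by blast
        then have "rich R Y2 F v" using cone_rich[OF Y2(1) satY] finF Y2(2) by blast
        then show ?thesis using rich_mono by (meson eqv_refl subset_insertI)
      next
        case False
        then have vx: "near v x" using v by (auto simp: near_def)
        have "x \<notin> F" using x(3) B(2) by blast
        then obtain h where h: "isom_on (insert x F \<union> {v}) h" "\<And>b. b \<in> F \<Longrightarrow> h b = b" "h x = w"
          using move[OF finF _ eqv_sym[OF xw], of "{v}"] by blast
        have hF: "eqv F (h v) v" using isom_eqv[OF h(1), of F v] h(2) by blast
        have hw: "d (h v) w = d v x" using isom_onD[OF h(1), of v x] h(3) by simp
        have "h v \<notin> insert w F"
          using eqv_notin[OF hF] v hw d_eq_0 by (metis d_self insert_iff)
        then obtain z where z: "z \<in> J0" "eqv (insert w F) z (h v)" using J0(3) by blast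
        have zw: "d z w = d v x" using z(2) hw by simp
        have zJ: "z \<in> J" using z(1) zw vx by (auto simp: J_def near_def)
        have uv: "eqv (insert x F) (y z) v"
          using y[OF zJ] yF[OF zJ] zw z(2) hF by (auto simp: eqv_def)
        have "rich R Y2 (insert x F) (y z)"
          unfolding rich_def
        proof (intro allI impI)
          fix G u assume G: "finite G \<and> insert x F \<subseteq> G \<and> G \<subseteq> Y2 \<and> u \<notin> G \<and> eqv (insert x F) u (y z)"
          then have G': "finite G" "G \<subseteq> Y2" "u \<notin> G" by blast+
          obtain t where t: "t \<in> Y2" "eqv G t u" by (rule sat_pt[OF satY2 G'])
          have "eqv (insert x F) t u" by (rule eqv_subset[OF t(2)]) (use G in blast)
          then have "eqv (insert x F) t (y z)" by (rule eqv_trans) (use G in blast)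
          then have "eqv (insert x B) t (y z)" using Y2(3) t(1) zJ by blast
          then have "eqv (E z) t (y z)" by (rule eqv_subset) (use B(4)[OF zJ] in blast)
          then have "eqv (E z) t (q z)" by (rule eqv_trans) (use y[OF zJ] in blast)
          then have "t \<in> R" using Eqe[OF zJ] t(1) Y2(1) by (auto simp: cone_def)
          then show "\<exists>t\<in>Y2. eqv G t u \<and> t \<in> R" using t by blast
        qed
        then show ?thesis using rich_cong eqv_sym[OF uv] by blast
      qed
    qed (use xR xw Y2 in auto)
  qed
qed

end

section \<open>Unconstrained large distances\<close>

lemma finite_patterns:
  assumes "finite A" "finite B"
  shows "finite {f :: 'a \<rightharpoonup> 'b. dom f = A \<and> ran f \<subseteq> B}"
  using finite_set_of_finite_maps[OF assms] by simp

text \<open>Finitely many thinnings in succession; \<open>mono\<close> preserves what was achieved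
  before.\<close>

lemma infinite_subset_all:
  assumes "finite \<Gamma>" "infinite A0"
    and mono: "\<And>A A' t. \<lbrakk>Q A t; A' \<subseteq> A\<rbrakk> \<Longrightarrow> Q A' t"
    and ex: "\<And>t A. \<lbrakk>t \<in> \<Gamma>; A \<subseteq> A0; infinite A\<rbrakk> \<Longrightarrow> \<exists>A' \<subseteq> A. infinite A' \<and> Q A' t"
  shows "\<exists>A \<subseteq> A0. infinite A \<and> (\<forall>t\<in>\<Gamma>. Q A t)"
  using assms(1) ex
proof (induction \<Gamma>)
  case empty
  then show ?case using assms(2) by blast
next
  case (insert t \<Gamma>)
  have "\<exists>A' \<subseteq> A. infinite A' \<and> Q A' s" if "s \<in> \<Gamma>" "A \<subseteq> A0" "infinite A" for s A
    using insert.prems that by blast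
  from insert.IH[OF this] obtain A where A: "A \<subseteq> A0" "infinite A" "\<forall>t\<in>\<Gamma>. Q A t" by blast
  then obtain A' where A': "A' \<subseteq> A" "infinite A'" "Q A' t" using insert.prems[of t A] by blast
  have "\<forall>s\<in>insert t \<Gamma>. Q A' s" using A(3) A' mono by blast
  then show ?case using A(1) A'(1,2) by blast
qed

locale free_cross = urysohn_nat +
  fixes a b :: real
  assumes a_in: "a \<in> S" and b_in: "b \<in> S" and a_less_b: "a < b" and b_less_M: "b < M"
    and a_a: "a \<oplus> a = a" and b_b: "b \<oplus> b = b"
    and S_cases: "s \<in> S \<Longrightarrow> s = a \<or> s = b \<or> b < s"
    and cross: "\<lbrakk>s \<in> S; t \<in> S; b < t\<rbrakk> \<Longrightarrow> s \<oplus> t = M"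
begin

section \<open>Classes and blocks: the equivalence relations of the two idempotents\<close>

definition "T = {t \<in> S. b < t}"

definition "cls x = {y. d x y \<le> a}"

definition "blk x = {y. d x y \<le> b}"

lemma T_S: "t \<in> T \<Longrightarrow> t \<in> S" by (simp add: T_def)

lemma finite_T: "finite T" using finite_S by (simp add: T_def)

lemma pos: "0 < a" "0 < b" using a_in b_in S_pos by auto

lemma cls_refl [simp]: "x \<in> cls x" and blk_refl [simp]: "x \<in> blk x"
  using pos by (auto simp: cls_def blk_def)

lemma cls_blk: "y \<in> cls x \<Longrightarrow> y \<in> blk x" using a_less_b by (auto simp: cls_def blk_def)

lemma cls_sym: "y \<in> cls x \<Longrightarrow> x \<in> cls y" and blk_sym: "y \<in> blk x \<Longrightarrow> x \<in> blk y"
  by (auto simp: cls_def blk_def d_sym)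

lemma cls_trans: "y \<in> cls x \<Longrightarrow> z \<in> cls y \<Longrightarrow> z \<in> cls x"
  using d_tri[of x z y] oplus_mono[of "d x y" a "d y z" a] a_a by (simp add: cls_def)

lemma blk_trans: "y \<in> blk x \<Longrightarrow> z \<in> blk y \<Longrightarrow> z \<in> blk x"
  using d_tri[of x z y] oplus_mono[of "d x y" b "d y z" b] b_b by (simp add: blk_def)

lemma cls_eq: "y \<in> cls x \<Longrightarrow> cls y = cls x"
  using cls_sym cls_trans by blast

lemma blk_eq: "y \<in> blk x \<Longrightarrow> blk y = blk x"
  using blk_sym blk_trans by blast

lemma d_cls: "y \<in> cls x \<Longrightarrow> y \<noteq> x \<Longrightarrow> d x y = a"
  using S_cases[OF d_in_S[of x y]] a_less_b by (auto simp: cls_def)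

lemma d_blk: "y \<in> blk x \<Longrightarrow> y \<notin> cls x \<Longrightarrow> d x y = b"
  using S_cases[OF d_in_S[of x y]] pos by (cases "x = y") (auto simp: cls_def blk_def)

lemma d_T: "y \<notin> blk x \<Longrightarrow> d x y \<in> T"
  using d_in_S[of x y] pos by (cases "x = y") (auto simp: blk_def T_def)

lemma T_blk: "d x y \<in> T \<Longrightarrow> y \<notin> blk x"
  by (auto simp: blk_def T_def)

text \<open>Every sum with a summand in \<open>T\<close> is \<open>M\<close>, so all three bounds
  are trivial.\<close>

lemma tri_TT: "t \<in> T \<Longrightarrow> t' \<in> T \<Longrightarrow> s \<in> S \<Longrightarrow> tri t t' s"
  using cross[of t t'] cross[of s t] cross[of s t'] le_M[OF S_S0] S_S0
  by (simp add: T_def tri_iff oplus_comm)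

lemma tri_low: "tri a a a" "tri a b b" "tri b b a" "tri b b b" "tri b a b"
  using pos a_less_b by (auto simp: tri_def)

text \<open>\<open>g = a\<close> serves to enter the class of \<open>x\<close>, \<open>g = b\<close>
  to open a new class in its block. Distances to other blocks are free by
  \<open>tri_TT\<close>.\<close>

lemma realize_cls:
  assumes "finite E" "\<And>e. e \<in> E \<Longrightarrow> e \<notin> blk x \<Longrightarrow> f e \<in> T"
    and "\<And>e. e \<in> E \<Longrightarrow> e \<in> blk x \<Longrightarrow> f e = (if e \<in> cls x then g else b)" "g = a \<or> g = b"
  obtains y where "y \<notin> E" "\<And>e. e \<in> E \<Longrightarrow> d y e = f e"
proof (rule realize[OF assms(1), of f])
  show "f e \<in> S" if "e \<in> E" for e using assms(2-4) that T_S a_in b_in by (cases "e \<in> blk x") auto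
  show "tri (f u) (f v) (d u v)" if uv: "u \<in> E" "v \<in> E" "u \<noteq> v" for u v
  proof -
    have far: "d u v \<in> T" if "u \<in> blk x" "v \<notin> blk x" for u v
      using d_T that blk_eq by blast
    consider "u \<notin> blk x" "v \<notin> blk x" | "u \<in> blk x" "v \<notin> blk x" | "u \<notin> blk x" "v \<in> blk x"
      | "u \<in> cls x" "v \<in> cls x" | "u \<in> cls x" "v \<in> blk x" "v \<notin> cls x" | "u \<in> blk x" "u \<notin> cls x" "v \<in> cls x"
      | "u \<in> blk x" "u \<notin> cls x" "v \<in> blk x" "v \<notin> cls x" using cls_blk by blast
    then show ?thesis
    proof cases
      case 1
      then show ?thesis using tri_TT assms(2) uv d_in_S by blast
    next
      case 2
      have "f u \<in> S" using assms(3)[OF uv(1) 2(1)] assms(4) a_in b_in by auto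
      then have "tri (f v) (d u v) (f u)" using tri_TT assms(2)[OF uv(2) 2(2)] far[OF 2] by blast
      then show ?thesis using tri_commute by blast
    next
      case 3
      have "f v \<in> S" using assms(3)[OF uv(2) 3(2)] assms(4) a_in b_in by auto
      then have "tri (f u) (d u v) (f v)" using tri_TT assms(2)[OF uv(1) 3(1)] far[OF 3(2,1)] d_sym by metis
      then show ?thesis using tri_commute by blast
    next
      case 4
      then have "d u v = a" using d_cls cls_eq uv(3) by metis
      then show ?thesis using assms(3)[OF uv(1)] assms(3)[OF uv(2)] 4 cls_blk tri_low assms(4) by auto
    next
      case 5
      then have "d u v = b" using d_blk cls_eq blk_eq cls_blk by metis
      then show ?thesis using assms(3)[OF uv(1)] assms(3)[OF uv(2)] 5 cls_blk tri_low assms(4) by auto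
    next
      case 6
      then have "d u v = b" using d_blk[of u v] cls_eq[of v x] blk_eq cls_blk d_sym[of u v] by metis
      then show ?thesis using assms(3)[OF uv(1)] assms(3)[OF uv(2)] 6 cls_blk tri_low assms(4) by auto
    next
      case 7
      then have "v \<in> blk u" using blk_eq by blast
      then have "d u v = a \<or> d u v = b" using d_cls d_blk uv(3) by metis
      then show ?thesis using assms(3)[OF uv(1)] assms(3)[OF uv(2)] 7 tri_low by auto
    qed
  qed
qed blast

text \<open>A pattern prescribes distances to finitely many points outside the block of \<open>x\<close>. By \<open>tri_TT\<close>
  these distances can be chosen independently of each other.\<close>

definition valid :: "nat \<Rightarrow> (nat \<rightharpoonup> real) \<Rightarrow> bool" where
  "valid x \<sigma> \<longleftrightarrow> finite (dom \<sigma>) \<and> dom \<sigma> \<inter> blk x = {} \<and> ran \<sigma> \<subseteq> T"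

definition orb :: "(nat \<rightharpoonup> real) \<Rightarrow> nat set" where
  "orb \<sigma> = {y. \<forall>e t. \<sigma> e = Some t \<longrightarrow> d y e = t}"

lemma valid_cong: "y \<in> blk x \<Longrightarrow> valid y \<sigma> = valid x \<sigma>"
  using blk_eq by (simp add: valid_def)

lemma orb_infinite:
  assumes "valid x \<sigma>" shows "infinite (cls x \<inter> orb \<sigma>)"
proof
  assume fin: "finite (cls x \<inter> orb \<sigma>)"
  define f where "f e = (if e \<in> blk x then if e \<in> cls x then a else b else
      case \<sigma> e of Some t \<Rightarrow> t | None \<Rightarrow> M)" for e
  let ?E = "insert x ((cls x \<inter> orb \<sigma>) \<union> dom \<sigma>)"
  have MT: "M \<in> T" using M_in b_less_M by (simp add: T_def)
  obtain y where y: "y \<notin> ?E" "\<And>e. e \<in> ?E \<Longrightarrow> d y e = f e"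
  proof (rule realize_cls[of ?E x f a])
    show "finite ?E" using fin assms by (auto simp: valid_def)
    show "f e \<in> T" if "e \<notin> blk x" for e
      using that assms MT by (auto simp: f_def valid_def ran_def split: option.splits)
  qed (auto simp: f_def)
  have "d y x = a" using y(2)[of x] by (simp add: f_def)
  then have "y \<in> cls x" by (simp add: cls_def d_sym[of x])
  moreover have "y \<in> orb \<sigma>"
    unfolding orb_def
  proof (intro CollectI allI impI)
    fix e t assume "\<sigma> e = Some t"
    moreover have "e \<in> dom \<sigma>" using calculation by blast
    moreover have "e \<notin> blk x" using calculation(2) assms by (auto simp: valid_def)
    ultimately show "d y e = t" using y(2)[of e] by (simp add: f_def)
  qed
  ultimately show False using y(1) by blast
qed

lemma fresh_cls:
  assumes "finite D"
  obtains y where "y \<in> blk x" "\<And>u. u \<in> D \<Longrightarrow> u \<notin> cls y"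
proof -
  obtain y where y: "y \<notin> insert x D" "\<And>e. e \<in> insert x D \<Longrightarrow> d y e = (if e \<in> blk x then b else d x e)"
  proof (rule realize_cls[of "insert x D" x "\<lambda>e. if e \<in> blk x then b else d x e" b])
  qed (use assms d_T in auto)
  have "d y x = b" using y(2)[of x] by simp
  then have "y \<in> blk x" by (simp add: blk_def d_sym[of x])
  moreover have "u \<notin> cls y" if "u \<in> D" for u
    using y(2)[of u] that a_less_b d_T[of u x] by (auto simp: cls_def T_def split: if_splits)
  ultimately show thesis using that by blast
qed

text \<open>A sample of infinitely many classes of one block. Conditions will be imposed on all but
  finitely many of them, so passing to infinite subsets is harmless.\<close>

definition spread :: "nat \<Rightarrow> nat set \<Rightarrow> bool" where
  "spread x A \<longleftrightarrow> A \<subseteq> blk x \<and> infinite A \<and> (\<forall>y\<in>A. \<forall>z\<in>A. z \<in> cls y \<longrightarrow> y = z)"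

lemma spread_ex: "\<exists>A. spread x A"
proof -
  define A where "A = {y \<in> blk x. \<forall>z<y. z \<notin> cls y}"
  have "infinite A"
  proof
    assume "finite A"
    then obtain y where y: "y \<in> blk x" "\<And>u. u \<in> A \<Longrightarrow> u \<notin> cls y" using fresh_cls by blast
    define z where "z = (LEAST z. z \<in> cls y)"
    have z: "z \<in> cls y" unfolding z_def by (rule LeastI[of _ y]) simp
    have "u \<notin> cls z" if "u < z" for u using not_less_Least[of u "\<lambda>z. z \<in> cls y"] that cls_eq[OF z] by (simp add: z_def)
    moreover have "z \<in> blk x" using cls_blk[OF z] y(1) blk_trans by blast
    ultimately have "z \<in> A" by (simp add: A_def)
    then show False using y(2) z by blast
  qed
  moreover have "y = z" if "y \<in> A" "z \<in> A" "z \<in> cls y" for y z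
  proof -
    have "y \<in> cls z" using that(3) cls_sym by blast
    then show ?thesis using that by (auto simp: A_def) (meson linorder_neqE_nat)
  qed
  ultimately have "spread x A" unfolding spread_def by (auto simp: A_def)
  then show ?thesis by blast
qed

lemma spread_subset: "spread x A \<Longrightarrow> A' \<subseteq> A \<Longrightarrow> infinite A' \<Longrightarrow> spread x A'"
  unfolding spread_def by (simp add: subset_iff)

definition patterns :: "nat \<Rightarrow> nat set \<Rightarrow> (nat \<rightharpoonup> real) \<Rightarrow> (nat \<rightharpoonup> real) set" where
  "patterns x X \<pi> = {\<tau>. dom \<tau> = X - blk x \<and> ran \<tau> \<subseteq> T \<and> \<pi> \<subseteq>\<^sub>m \<tau>}"

lemma finite_patterns_at: "finite X \<Longrightarrow> finite (patterns x X \<pi>)"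
  unfolding patterns_def
  by (rule finite_subset[OF _ finite_patterns[of "X - blk x" T]]) (auto simp: finite_T)

lemma patterns_cong: "y \<in> blk x \<Longrightarrow> patterns y X \<pi> = patterns x X \<pi>"
  using blk_eq by (simp add: patterns_def)

lemma patterns_insert: "y \<in> blk x \<Longrightarrow> patterns x (insert y X) \<pi> = patterns x X \<pi>"
  by (simp add: patterns_def insert_Diff_if)

lemma patterns_valid: "finite X \<Longrightarrow> \<tau> \<in> patterns x X \<pi> \<Longrightarrow> valid x \<tau>"
  by (auto simp: patterns_def valid_def)

text \<open>The patterns are the demands that a point of the block may face. \<open>Q\<close> is
  asked only of an extension, as it may depend on further auxiliary points.\<close>

definition covers where
  "covers x X \<pi> Q \<longleftrightarrow> (\<forall>\<tau>\<in>patterns x X \<pi>. \<exists>\<sigma>. \<tau> \<subseteq>\<^sub>m \<sigma> \<and> valid x \<sigma> \<and> Q \<sigma>)"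

text \<open>There are finitely many patterns and chosen extensions. A point outside all their
  domains can be given any value in \<open>T\<close> in addition, and \<open>Q\<close> is
  hereditary.\<close>

lemma covers_extend:
  assumes "covers x X \<pi> Q" "finite X" "dom \<pi> \<subseteq> X - blk x"
    and her: "\<And>\<sigma> \<sigma>'. \<lbrakk>Q \<sigma>; \<sigma> \<subseteq>\<^sub>m \<sigma>'; valid x \<sigma>'\<rbrakk> \<Longrightarrow> Q \<sigma>'"
  shows "\<exists>D. finite D \<and> (\<forall>y. y \<notin> D \<longrightarrow> covers x (insert y X) \<pi> Q)"
proof -
  obtain s where s: "\<And>\<tau>. \<tau> \<in> patterns x X \<pi> \<Longrightarrow> \<tau> \<subseteq>\<^sub>m s \<tau> \<and> valid x (s \<tau>) \<and> Q (s \<tau>)"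
    using assms(1) unfolding covers_def by metis
  define D where "D = X \<union> (\<Union>\<tau>\<in>patterns x X \<pi>. dom (s \<tau>))"
  have "finite D" using s finite_patterns_at assms(2) by (auto simp: D_def valid_def)
  moreover have "covers x (insert y X) \<pi> Q" if y: "y \<notin> D" for y
  proof (cases "y \<in> blk x")
    case True
    then show ?thesis using assms(1) patterns_insert by (simp add: covers_def)
  next
    case False
    show ?thesis
      unfolding covers_def
    proof
      fix \<tau>' assume \<tau>': "\<tau>' \<in> patterns x (insert y X) \<pi>"
      define \<tau> where "\<tau> = \<tau>' |` (X - blk x)"
      have yX: "y \<notin> X" using y by (simp add: D_def)
      have dom': "dom \<tau>' = insert y (X - blk x)" using \<tau>' False by (auto simp: patterns_def)
      have "dom \<tau> = X - blk x" using dom' by (auto simp: \<tau>_def)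
      then have "\<tau> \<in> patterns x X \<pi>"
        using \<tau>' assms(3) unfolding patterns_def \<tau>_def
        by (auto simp: map_le_def restrict_map_def ran_def split: if_splits)
      note s' = s[OF this]
      have yd: "y \<notin> dom (s \<tau>)" using y \<open>\<tau> \<in> _\<close> by (auto simp: D_def)
      have "y \<in> dom \<tau>'" using dom' by simp
      then obtain t where t: "\<tau>' y = Some t" by blast
      then have "t \<in> T" using \<tau>' by (auto simp: patterns_def ran_def)
      note t = t this
      let ?\<sigma> = "(s \<tau>)(y \<mapsto> t)"
      have "\<tau>' \<subseteq>\<^sub>m ?\<sigma>"
        unfolding map_le_def
      proof
        fix e assume "e \<in> dom \<tau>'"
        show "\<tau>' e = ?\<sigma> e"
        proof (cases "e = y")
          case True
          then show ?thesis using t by simp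
        next
          case False
          then have "e \<in> dom \<tau>" "\<tau>' e = \<tau> e" using \<open>e \<in> dom \<tau>'\<close> dom' by (auto simp: \<tau>_def)
          then show ?thesis using s' False by (auto simp: map_le_def)
        qed
      qed
      moreover have "valid x ?\<sigma>" using s' t(2) False yd by (auto simp: valid_def ran_def)
      moreover have "s \<tau> \<subseteq>\<^sub>m ?\<sigma>" using yd by (auto simp: map_le_def)
      ultimately show "\<exists>\<sigma>. \<tau>' \<subseteq>\<^sub>m \<sigma> \<and> valid x \<sigma> \<and> Q \<sigma>" using her s' by blast
    qed
  qed
  ultimately show ?thesis by blast
qed

definition able where
  "able G x \<sigma> \<longleftrightarrow> (\<exists>\<sigma>'. \<sigma> \<subseteq>\<^sub>m \<sigma>' \<and> valid x \<sigma>' \<and> G x \<sigma>')"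

definition mostly where
  "mostly G x A \<sigma> \<longleftrightarrow> (\<forall>\<sigma>'. \<sigma> \<subseteq>\<^sub>m \<sigma>' \<and> valid x \<sigma>' \<longrightarrow> finite {z \<in> A. \<not> able G z \<sigma>'})"

text \<open>A ready block can always supply a new class: finitely many patterns exclude only
  finitely many of the sampled classes.\<close>

definition ready where
  "ready G x X \<pi> \<longleftrightarrow> (\<exists>A. spread x A \<and> covers x X \<pi> (mostly G x A))"

lemma mostly_her: "mostly G x A \<sigma> \<Longrightarrow> \<sigma> \<subseteq>\<^sub>m \<sigma>' \<Longrightarrow> mostly G x A \<sigma>'"
  unfolding mostly_def by (meson map_le_trans)

lemma mostly_subset: "mostly G x A \<sigma> \<Longrightarrow> A' \<subseteq> A \<Longrightarrow> mostly G x A' \<sigma>"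
  unfolding mostly_def by (auto elim!: rev_finite_subset)

lemma ready_cong: "y \<in> blk x \<Longrightarrow> ready G y X \<pi> = ready G x X \<pi>"
  unfolding ready_def covers_def mostly_def spread_def
  using blk_eq patterns_cong valid_cong by simp

lemma ready_insert: "y \<in> blk x \<Longrightarrow> ready G x (insert y X) \<pi> = ready G x X \<pi>"
  unfolding ready_def covers_def by (simp add: patterns_insert)

text \<open>\<open>G\<close> guarantees infinitely many points of \<open>C\<close>, so the finitely
  many candidates that would spoil \<open>covers\<close> or \<open>ready\<close> can be avoided. A
  new point enters an existing class or a new class of a ready block. The whole copy realises the
  fixed pattern \<pi>.\<close>

lemma free_build:
  assumes fin: "finite (dom \<pi>)" and \<pi>: "ran \<pi> \<subseteq> T"
    and G1: "\<And>x \<sigma>. \<lbrakk>G x \<sigma>; valid x \<sigma>\<rbrakk> \<Longrightarrow> infinite (cls x \<inter> orb \<sigma> \<inter> C)"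
    and G2: "\<And>x \<sigma> \<sigma>'. \<lbrakk>G x \<sigma>; \<sigma> \<subseteq>\<^sub>m \<sigma>'; valid x \<sigma>'\<rbrakk> \<Longrightarrow> G x \<sigma>'"
    and G3: "\<And>x y \<sigma>. \<lbrakk>G x \<sigma>; y \<in> cls x\<rbrakk> \<Longrightarrow> G y \<sigma>"
    and fresh_blk: "\<And>Z. finite Z \<Longrightarrow> \<exists>x. blk x \<inter> (dom \<pi> \<union> Z) = {} \<and> ready G x (dom \<pi> \<union> Z) \<pi>"
  shows "\<exists>Y. sat Y \<and> Y \<subseteq> C"
proof -
  let ?X = "\<lambda>Z. dom \<pi> \<union> Z"
  define I where "I Z Y \<longleftrightarrow> Y = UNIV \<and> finite Z \<and> Z \<subseteq> C \<and> Z \<subseteq> orb \<pi> \<and>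
    (\<forall>x\<in>Z. covers x (?X Z) \<pi> (G x) \<and> ready G x (?X Z) \<pi>)" for Z and Y :: "nat set"
  have disj: "blk x \<inter> dom \<pi> = {}" if "x \<in> orb \<pi>" for x
    using that \<pi> T_blk by (fastforce simp: orb_def ran_def)
  \<comment> \<open>\<open>z\<close> names the class to be entered, and \<open>wz\<close> says that
    \<open>w\<close> is placed relative to \<open>Z\<close> as a member of that class would
    be.\<close>
  have close: "\<exists>y. eqv Z y w \<and> I (insert y Z) UNIV"
    if I: "I Z UNIV" and w: "w \<notin> Z" and z: "covers z (?X Z) \<pi> (G z)" "ready G z (?X Z) \<pi>" "blk z \<inter> dom \<pi> = {}"
      and wz: "\<And>e. e \<in> Z \<Longrightarrow> (e \<in> cls z \<longrightarrow> d w e = a) \<and> (e \<in> blk z - cls z \<longrightarrow> d w e = b) \<and> (e \<notin> blk z \<longrightarrow> d w e \<in> T)"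
    for Z w z
  proof -
    have Z: "finite Z" "Z \<subseteq> C" "Z \<subseteq> orb \<pi>" and c: "\<And>x. x \<in> Z \<Longrightarrow> covers x (?X Z) \<pi> (G x)"
      and r: "\<And>x. x \<in> Z \<Longrightarrow> ready G x (?X Z) \<pi>" using I by (auto simp: I_def)
    have finX: "finite (?X Z)" using Z(1) fin by simp
    have "\<exists>D. finite D \<and> (\<forall>y. y \<notin> D \<longrightarrow> covers x (insert y (?X Z)) \<pi> (G x) \<and> ready G x (insert y (?X Z)) \<pi>)"
      if x: "x \<in> Z" for x
    proof -
      have dm: "dom \<pi> \<subseteq> ?X Z - blk x" using disj x Z(3) by blast
      obtain A where A: "spread x A" "covers x (?X Z) \<pi> (mostly G x A)" using r[OF x] by (auto simp: ready_def)
      obtain D1 where "finite D1" "\<forall>y. y \<notin> D1 \<longrightarrow> covers x (insert y (?X Z)) \<pi> (G x)"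
        using covers_extend[OF c[OF x] finX dm] G2 by blast
      moreover obtain D2 where "finite D2" "\<forall>y. y \<notin> D2 \<longrightarrow> covers x (insert y (?X Z)) \<pi> (mostly G x A)"
        using covers_extend[OF A(2) finX dm] mostly_her by blast
      ultimately show ?thesis using A(1) by (intro exI[of _ "D1 \<union> D2"]) (auto simp: ready_def)
    qed
    then obtain D where D: "\<And>x. x \<in> Z \<Longrightarrow> finite (D x)"
      "\<And>x y. \<lbrakk>x \<in> Z; y \<notin> D x\<rbrakk> \<Longrightarrow> covers x (insert y (?X Z)) \<pi> (G x) \<and> ready G x (insert y (?X Z)) \<pi>"
      by metis
    \<comment> \<open>The demand to be met: \<pi> together with the distances of \<open>w\<close> to
      the chosen points in other blocks.\<close>
    define \<tau> where "\<tau> e = (if e \<in> dom \<pi> then \<pi> e else if e \<in> Z - blk z then Some (d w e) else None)" for e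
    have "\<tau> \<in> patterns z (?X Z) \<pi>"
      unfolding patterns_def
    proof (intro CollectI conjI)
      show "dom \<tau> = ?X Z - blk z" using z(3) by (auto simp: \<tau>_def split: if_splits)
      show "ran \<tau> \<subseteq> T" using \<pi> wz by (auto simp: \<tau>_def ran_def split: if_splits)
      show "\<pi> \<subseteq>\<^sub>m \<tau>" by (auto simp: \<tau>_def map_le_def)
    qed
    then obtain \<sigma> where \<sigma>: "\<tau> \<subseteq>\<^sub>m \<sigma>" "valid z \<sigma>" "G z \<sigma>" using z(1) unfolding covers_def by blast
    have "infinite (cls z \<inter> orb \<sigma> \<inter> C - (Z \<union> (\<Union>x\<in>Z. D x)))"
      using G1[OF \<sigma>(3,2)] D(1) Z(1) by (intro Diff_infinite_finite) auto
    then obtain y where "y \<in> cls z \<inter> orb \<sigma> \<inter> C - (Z \<union> (\<Union>x\<in>Z. D x))"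
      using infinite_imp_nonempty by blast
    then have y: "y \<in> cls z" "y \<in> orb \<sigma>" "y \<in> C" "y \<notin> Z" "\<And>x. x \<in> Z \<Longrightarrow> y \<notin> D x" by auto
    have y\<tau>: "d y e = t" if "\<tau> e = Some t" for e t
      using that \<sigma>(1) y(2) by (auto simp: orb_def map_le_def dom_def) 
    have yb: "y \<in> blk z" using cls_blk y(1) by blast
    have Z\<pi>: "e \<notin> dom \<pi>" if "e \<in> Z" for e using disj that Z(3) blk_refl by blast
    have "eqv Z y w"
      unfolding eqv_def
    proof
      fix e assume e: "e \<in> Z"
      consider "e \<in> cls z" | "e \<in> blk z - cls z" | "e \<notin> blk z" by blast
      then show "d y e = d w e"
      proof cases
        case 1
        then show ?thesis using wz[OF e] d_cls[of e y] cls_eq[OF y(1)] y(4) e by auto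
      next
        case 2
        then show ?thesis using wz[OF e] d_blk[of e y] cls_eq[OF y(1)] blk_eq[OF yb] by auto
      next
        case 3
        then show ?thesis using y\<tau>[of e "d w e"] e Z\<pi> by (simp add: \<tau>_def)
      qed
    qed
    moreover have "I (insert y Z) UNIV"
      unfolding I_def
    proof (intro conjI ballI)
      show "insert y Z \<subseteq> orb \<pi>"
      proof -
        have "d y e = t" if "\<pi> e = Some t" for e t using that y\<tau>[of e t] by (simp add: \<tau>_def domI)
        then have "y \<in> orb \<pi>" by (simp add: orb_def)
        then show ?thesis using Z(3) by blast
      qed
      fix x assume x: "x \<in> insert y Z"
      have "covers y (insert y (?X Z)) \<pi> (G y)"
        using z(1) G3[OF _ y(1)] valid_cong[OF yb] patterns_insert[of y y] patterns_cong[OF yb]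
        unfolding covers_def by (metis blk_refl)
      then show "covers x (?X (insert y Z)) \<pi> (G x)" using x D(2) y(5) by auto
      have "ready G y (insert y (?X Z)) \<pi>" using z(2) ready_cong[OF yb] ready_insert[of y y] by simp
      then show "ready G x (?X (insert y Z)) \<pi>" using x D(2) y(5) by auto
    qed (use Z y in auto)
    ultimately show ?thesis by blast
  qed
  have new_cls: "\<exists>z \<in> blk x. covers z (?X Z) \<pi> (G z) \<and> ready G z (?X Z) \<pi> \<and> (\<forall>e\<in>Z. e \<notin> cls z)"
    if finZ: "finite Z" and rx: "ready G x (?X Z) \<pi>" for x Z
  proof -
    have finX: "finite (?X Z)" using that fin by simp
    obtain A where A: "spread x A" "covers x (?X Z) \<pi> (mostly G x A)" using rx by (auto simp: ready_def)
    let ?P = "patterns x (?X Z) \<pi>"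
    obtain s where s: "\<And>\<tau>. \<tau> \<in> ?P \<Longrightarrow> \<tau> \<subseteq>\<^sub>m s \<tau> \<and> valid x (s \<tau>) \<and> mostly G x A (s \<tau>)"
      using A(2) unfolding covers_def by metis
    \<comment> \<open>Each pattern rules out finitely many sampled classes and each chosen point at
      most one; any other sampled class serves all patterns at once.\<close>
    define Bad where "Bad = (\<Union>\<tau>\<in>?P. {z \<in> A. \<not> able G z (s \<tau>)}) \<union> (\<Union>e\<in>Z. {z \<in> A. e \<in> cls z})"
    have "finite {z \<in> A. \<not> able G z (s \<tau>)}" if "\<tau> \<in> ?P" for \<tau>
      using s[OF that] map_le_refl unfolding mostly_def by blast
    moreover have "finite {z \<in> A. e \<in> cls z}" for e
    proof (cases "{z \<in> A. e \<in> cls z} = {}")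
      case True
      then show ?thesis by (simp only: finite.emptyI)
    next
      case False
      then obtain u where u: "u \<in> A" "e \<in> cls u" by blast
      have "z = u" if "z \<in> A" "e \<in> cls z" for z
        using that u A(1) cls_sym cls_trans unfolding spread_def by blast
      then have "{z \<in> A. e \<in> cls z} \<subseteq> {u}" by blast
      then show ?thesis using finite_subset by blast
    qed
    ultimately have "finite Bad" using finite_patterns_at[OF finX] finZ by (simp add: Bad_def)
    then have "infinite (A - Bad)" using A(1) by (simp add: spread_def)
    then obtain z where z: "z \<in> A" "z \<notin> Bad" using infinite_imp_nonempty by blast
    have zb: "z \<in> blk x" using z(1) A(1) by (auto simp: spread_def)
    have "covers z (?X Z) \<pi> (G z)"
      unfolding covers_def patterns_cong[OF zb]
    proof
      fix \<tau> assume \<tau>: "\<tau> \<in> ?P"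
      then have "able G z (s \<tau>)" using z by (auto simp: Bad_def)
      then show "\<exists>\<sigma>. \<tau> \<subseteq>\<^sub>m \<sigma> \<and> valid z \<sigma> \<and> G z \<sigma>" using s[OF \<tau>] map_le_trans unfolding able_def by blast
    qed
    then show ?thesis using z zb rx ready_cong[OF zb] by (auto simp: Bad_def)
  qed
  obtain Y where Y: "sat Y" "\<And>H. \<lbrakk>finite H; H \<subseteq> Y\<rbrakk> \<Longrightarrow> \<exists>Z X. I Z X \<and> H \<subseteq> Z \<and> Z \<subseteq> Y"
  proof (rule build[where I = I])
    show "I {} UNIV" by (simp add: I_def)
    show "finite Z \<and> Z \<subseteq> X \<and> sat X" if "I Z X" for Z X using that sat_UNIV by (auto simp: I_def)
    fix Z X w assume IX: "I Z X" and w: "w \<in> X" "w \<notin> Z"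
    have X: "X = UNIV" using IX by (simp add: I_def)
    then have I: "I Z UNIV" using IX by simp
    have Z: "finite Z" "Z \<subseteq> orb \<pi>" using I by (auto simp: I_def)
    have "\<exists>y. eqv Z y w \<and> I (insert y Z) UNIV"
    proof (cases "\<exists>x\<in>Z. w \<in> cls x")
      case True
      then obtain x where x: "x \<in> Z" "w \<in> cls x" by blast
      have "cls w = cls x" "blk w = blk x" using x cls_eq cls_blk blk_eq by blast+
      then have "(e \<in> cls x \<longrightarrow> d w e = a) \<and> (e \<in> blk x - cls x \<longrightarrow> d w e = b) \<and> (e \<notin> blk x \<longrightarrow> d w e \<in> T)"
        if "e \<in> Z" for e using that w d_cls[of e w] d_blk[of e w] d_T[of e w] by auto
      then show ?thesis using close[OF I w(2), of x] I x(1) disj Z(2) by (auto simp: I_def)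
    next
      case False
      obtain x where x: "ready G x (?X Z) \<pi>" "blk x \<inter> dom \<pi> = {}"
        "\<And>e. e \<in> Z \<Longrightarrow> (e \<in> blk x \<longrightarrow> d w e = b) \<and> (e \<notin> blk x \<longrightarrow> d w e \<in> T)"
      proof (cases "\<exists>x\<in>Z. w \<in> blk x")
        case True
        then obtain x where x: "x \<in> Z" "w \<in> blk x" by blast
        have "(e \<in> blk x \<longrightarrow> d w e = b) \<and> (e \<notin> blk x \<longrightarrow> d w e \<in> T)" if "e \<in> Z" for e
          using that False cls_sym d_blk[of e w] d_T[of e w] blk_eq[OF x(2)] by blast
        then show thesis using that[of x] I x(1) disj Z(2) by (auto simp: I_def)
      next
        case False
        obtain x where "blk x \<inter> ?X Z = {}" "ready G x (?X Z) \<pi>" using fresh_blk[OF Z(1)] by blast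
        moreover have "d w e \<in> T" if "e \<in> Z" for e using False that d_T blk_sym by blast
        ultimately show thesis using that[of x] by blast
      qed
      obtain z where z: "z \<in> blk x" "covers z (?X Z) \<pi> (G z)" "ready G z (?X Z) \<pi>" "\<forall>e\<in>Z. e \<notin> cls z"
        using new_cls[OF Z(1) x(1)] by blast
      show ?thesis
        using close[OF I w(2) z(2,3)] x(2,3) z(4) blk_eq[OF z(1)] by simp
    qed
    then show "\<exists>y Y'. Y' \<subseteq> X \<and> eqv Z y w \<and> I (insert y Z) Y'" using X by blast
  qed blast
  have "y \<in> C" if "y \<in> Y" for y using Y(2)[of "{y}"] that by (auto simp: I_def)
  then show ?thesis using Y(1) by blast
qed

section \<open>Red and blue classes\<close>

lemma orb_anti: "\<sigma> \<subseteq>\<^sub>m \<sigma>' \<Longrightarrow> orb \<sigma>' \<subseteq> orb \<sigma>"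
  unfolding orb_def map_le_def by (auto simp: dom_def)

definition Gr where "Gr R x \<sigma> \<longleftrightarrow> finite (cls x \<inter> orb \<sigma> - R)"

text \<open>Equivalent to no valid extension satisfying \<open>Gr\<close>; through this duality,
  failure of the red construction drives the blue one.\<close>

definition Gb where
  "Gb R x \<sigma> \<longleftrightarrow> (\<forall>\<sigma>'. \<sigma> \<subseteq>\<^sub>m \<sigma>' \<and> valid x \<sigma>' \<longrightarrow> infinite (cls x \<inter> orb \<sigma>' - R))"

lemma red_copy:
  assumes "\<And>Z. finite Z \<Longrightarrow> \<exists>x. blk x \<inter> Z = {} \<and> ready (Gr R) x Z Map.empty"
  shows "\<exists>Y. sat Y \<and> Y \<subseteq> R"
proof (rule free_build[where \<pi> = Map.empty and G = "Gr R"])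
  show "infinite (cls x \<inter> orb \<sigma> \<inter> R)" if "Gr R x \<sigma>" "valid x \<sigma>" for x \<sigma>
  proof -
    have "cls x \<inter> orb \<sigma> = (cls x \<inter> orb \<sigma> \<inter> R) \<union> (cls x \<inter> orb \<sigma> - R)" by blast
    then show ?thesis using orb_infinite[OF that(2)] that(1) unfolding Gr_def by (metis finite_UnI)
  qed
  show "Gr R x \<sigma>'" if "Gr R x \<sigma>" "\<sigma> \<subseteq>\<^sub>m \<sigma>'" for x \<sigma> \<sigma>'
    using that(1) orb_anti[OF that(2)] unfolding Gr_def by (auto elim: rev_finite_subset)
  show "Gr R y \<sigma>" if "Gr R x \<sigma>" "y \<in> cls x" for x y \<sigma> using that cls_eq by (simp add: Gr_def)
qed (use assms in auto)

text \<open>Each block away from \<open>Z0\<close> has a pattern on \<open>Z0\<close> and a sample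
  of classes no infinite part of which is mostly red over any extension. By pigeonhole one pattern
  \<pi> works for blocks avoiding any finite set, and the blue copy is built inside its
  orbit.\<close>

lemma blue_copy:
  assumes Z0: "finite Z0" "\<And>x. blk x \<inter> Z0 = {} \<Longrightarrow> \<not> ready (Gr R) x Z0 Map.empty"
  shows "\<exists>Y. sat Y \<and> Y \<subseteq> - R"
proof -
  define bad where "bad x \<tau> A \<longleftrightarrow> spread x A \<and>
    (\<forall>A' \<sigma>. A' \<subseteq> A \<and> infinite A' \<and> \<tau> \<subseteq>\<^sub>m \<sigma> \<and> valid x \<sigma> \<longrightarrow> \<not> mostly (Gr R) x A' \<sigma>)" for x \<tau> A
  let ?P = "{\<tau>. dom \<tau> = Z0 \<and> ran \<tau> \<subseteq> T}"
  have bad_ex: "\<exists>\<tau>\<in>?P. \<exists>A. bad x \<tau> A" if x: "blk x \<inter> Z0 = {}" for x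
  proof (rule ccontr)
    assume neg: "\<not> ?thesis"
    have P: "patterns x Z0 Map.empty = ?P" using x by (auto simp: patterns_def)
    obtain A0 where A0: "spread x A0" using spread_ex by blast
    have "\<exists>A \<subseteq> A0. infinite A \<and> (\<forall>\<tau>\<in>?P. \<exists>\<sigma>. \<tau> \<subseteq>\<^sub>m \<sigma> \<and> valid x \<sigma> \<and> mostly (Gr R) x A \<sigma>)"
    proof (rule infinite_subset_all)
      show "finite ?P" using finite_patterns Z0(1) finite_T by blast
      show "infinite A0" using A0 by (simp add: spread_def)
      show "\<exists>A' \<subseteq> A. infinite A' \<and> (\<exists>\<sigma>. \<tau> \<subseteq>\<^sub>m \<sigma> \<and> valid x \<sigma> \<and> mostly (Gr R) x A' \<sigma>)"
        if "\<tau> \<in> ?P" "A \<subseteq> A0" "infinite A" for \<tau> A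
        using neg that spread_subset[OF A0] unfolding bad_def by blast
    qed (use mostly_subset in blast)
    then obtain A where A: "A \<subseteq> A0" "infinite A"
      "\<forall>\<tau>\<in>?P. \<exists>\<sigma>. \<tau> \<subseteq>\<^sub>m \<sigma> \<and> valid x \<sigma> \<and> mostly (Gr R) x A \<sigma>" by blast
    have "covers x Z0 Map.empty (mostly (Gr R) x A)" unfolding covers_def P by (rule A(3))
    then have "ready (Gr R) x Z0 Map.empty"
      using spread_subset[OF A0 A(1,2)] unfolding ready_def by blast
    then show False using Z0(2) x by blast
  qed
  define ok where "ok \<tau> \<longleftrightarrow> (\<forall>Z. finite Z \<longrightarrow> (\<exists>x A. blk x \<inter> Z = {} \<and> bad x \<tau> A))" for \<tau>
  have "\<exists>\<tau>\<in>?P. ok \<tau>"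
  proof (rule ccontr)
    assume "\<not> (\<exists>\<tau>\<in>?P. ok \<tau>)"
    then have "\<forall>\<tau>\<in>?P. \<not> ok \<tau>" by blast
    then have "\<forall>\<tau>\<in>?P. \<exists>Z. finite Z \<and> (\<forall>x A. blk x \<inter> Z = {} \<longrightarrow> \<not> bad x \<tau> A)"
      by (simp add: ok_def)
    from bchoice[OF this] obtain Zf where
      Zf: "\<forall>\<tau>\<in>?P. finite (Zf \<tau>) \<and> (\<forall>x A. blk x \<inter> Zf \<tau> = {} \<longrightarrow> \<not> bad x \<tau> A)" by (elim exE)
    let ?Z = "Z0 \<union> (\<Union>\<tau>\<in>?P. Zf \<tau>)"
    have "finite ?Z" using Z0(1) Zf finite_patterns[OF Z0(1) finite_T] by simp
    then obtain x where xM: "x \<notin> ?Z" "\<And>u. u \<in> ?Z \<Longrightarrow> d x u = M"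
      using realize[of ?Z "\<lambda>_. M"] M_in tri_TT[of M M] d_in_S b_less_M by (auto simp: T_def)
    have "u \<notin> blk x" if "u \<in> ?Z" for u using xM(2)[OF that] b_less_M by (simp add: blk_def)
    then have x: "blk x \<inter> Z0 = {}" "\<And>\<tau>. \<tau> \<in> ?P \<Longrightarrow> blk x \<inter> Zf \<tau> = {}" by blast+
    from bad_ex[OF x(1)] obtain \<tau> A where "\<tau> \<in> ?P" "bad x \<tau> A" by (elim bexE exE)
    then show False using bspec[OF Zf] x(2) by simp
  qed
  then obtain \<pi> where \<pi>: "dom \<pi> = Z0" "ran \<pi> \<subseteq> T"
    "\<And>Z. finite Z \<Longrightarrow> \<exists>x A. blk x \<inter> Z = {} \<and> bad x \<pi> A" unfolding ok_def by blast
  show ?thesis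
  proof (rule free_build[where \<pi> = \<pi> and G = "Gb R"])
    show "infinite (cls x \<inter> orb \<sigma> \<inter> - R)" if "Gb R x \<sigma>" "valid x \<sigma>" for x \<sigma>
      using that by (auto simp: Gb_def Diff_eq)
    show "Gb R x \<sigma>'" if "Gb R x \<sigma>" "\<sigma> \<subseteq>\<^sub>m \<sigma>'" for x \<sigma> \<sigma>'
      using that map_le_trans unfolding Gb_def by blast
    show "Gb R y \<sigma>" if "Gb R x \<sigma>" "y \<in> cls x" for x y \<sigma>
      using that(1) cls_eq[OF that(2)] valid_cong[OF cls_blk[OF that(2)]] by (simp add: Gb_def)
    fix Z :: "nat set" assume "finite Z"
    then have finX: "finite (dom \<pi> \<union> Z)" using \<pi>(1) Z0(1) by simp
    obtain x A0 where x: "blk x \<inter> (dom \<pi> \<union> Z) = {}" "bad x \<pi> A0" using \<pi>(3)[OF finX] by blast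
    have sp: "spread x A0" using x(2) by (simp add: bad_def)
    have "\<exists>A \<subseteq> A0. infinite A \<and> (\<forall>\<tau>\<in>patterns x (dom \<pi> \<union> Z) \<pi>. \<exists>\<sigma>. \<tau> \<subseteq>\<^sub>m \<sigma> \<and> valid x \<sigma> \<and> mostly (Gb R) x A \<sigma>)"
    proof (rule infinite_subset_all)
      show "finite (patterns x (dom \<pi> \<union> Z) \<pi>)" using finite_patterns_at[OF finX] .
      show "infinite A0" using sp by (simp add: spread_def)
      show "\<exists>A' \<subseteq> A. infinite A' \<and> (\<exists>\<sigma>. \<tau> \<subseteq>\<^sub>m \<sigma> \<and> valid x \<sigma> \<and> mostly (Gb R) x A' \<sigma>)"
        if \<tau>: "\<tau> \<in> patterns x (dom \<pi> \<union> Z) \<pi>" and A: "A \<subseteq> A0" "infinite A" for \<tau> A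
      proof -
        \<comment> \<open>Badness leaves, for some extension \<sigma>, infinitely many sampled
          classes that no further extension makes almost entirely red; these are good for
          blue.\<close>
        have "\<not> mostly (Gr R) x A \<tau>"
          using x(2) A \<tau> patterns_valid[OF finX \<tau>] unfolding bad_def patterns_def by blast
        then obtain \<sigma> where \<sigma>: "\<tau> \<subseteq>\<^sub>m \<sigma>" "valid x \<sigma>" "infinite {z \<in> A. \<not> able (Gr R) z \<sigma>}"
          unfolding mostly_def by blast
        have "able (Gb R) z \<sigma>'" if z: "z \<in> A" "\<not> able (Gr R) z \<sigma>" and \<sigma>': "\<sigma> \<subseteq>\<^sub>m \<sigma>'" "valid x \<sigma>'" for z \<sigma>'
        proof -
          have zb: "z \<in> blk x" using z(1) A(1) sp by (auto simp: spread_def)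
          have "Gb R z \<sigma>'"
            using z(2) map_le_trans[OF \<sigma>'(1)] unfolding Gb_def able_def Gr_def by blast
          then show ?thesis using \<sigma>'(2) valid_cong[OF zb] unfolding able_def by (meson map_le_refl)
        qed
        then have empty: "{z \<in> {z \<in> A. \<not> able (Gr R) z \<sigma>}. \<not> able (Gb R) z \<sigma>'} = {}"
          if "\<sigma> \<subseteq>\<^sub>m \<sigma>'" "valid x \<sigma>'" for \<sigma>'
          using that by blast
        have "mostly (Gb R) x {z \<in> A. \<not> able (Gr R) z \<sigma>} \<sigma>"
          unfolding mostly_def
        proof (intro allI impI)
          fix \<sigma>' assume "\<sigma> \<subseteq>\<^sub>m \<sigma>' \<and> valid x \<sigma>'"
          then show "finite {z \<in> {z \<in> A. \<not> able (Gr R) z \<sigma>}. \<not> able (Gb R) z \<sigma>'}"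
            by (subst empty) simp_all
        qed
        then show ?thesis using \<sigma> by (intro exI[of _ "{z \<in> A. \<not> able (Gr R) z \<sigma>}"]) blast
      qed
    qed (use mostly_subset in blast)
    then obtain A where A: "A \<subseteq> A0" "infinite A"
      "\<forall>\<tau>\<in>patterns x (dom \<pi> \<union> Z) \<pi>. \<exists>\<sigma>. \<tau> \<subseteq>\<^sub>m \<sigma> \<and> valid x \<sigma> \<and> mostly (Gb R) x A \<sigma>" by blast
    have "covers x (dom \<pi> \<union> Z) \<pi> (mostly (Gb R) x A)" unfolding covers_def by (rule A(3))
    then have "ready (Gb R) x (dom \<pi> \<union> Z) \<pi>"
      using spread_subset[OF sp A(1,2)] unfolding ready_def by blast
    then show "\<exists>x. blk x \<inter> (dom \<pi> \<union> Z) = {} \<and> ready (Gb R) x (dom \<pi> \<union> Z) \<pi>" using x(1) by blast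
  next
    show "finite (dom \<pi>)" "ran \<pi> \<subseteq> T" using \<pi> Z0 by simp_all
  qed
qed

lemma mono_copy: "\<exists>Y. sat Y \<and> (Y \<subseteq> R \<or> Y \<inter> R = {})"
proof (cases "\<forall>Z. finite Z \<longrightarrow> (\<exists>x. blk x \<inter> Z = {} \<and> ready (Gr R) x Z Map.empty)")
  case True
  then show ?thesis using red_copy by blast
next
  case False
  then obtain Z where "finite Z" "\<And>x. blk x \<inter> Z = {} \<Longrightarrow> \<not> ready (Gr R) x Z Map.empty" by blast
  then obtain Y where "sat Y" "Y \<subseteq> - R" using blue_copy by blast
  then show ?thesis by blast
qed

end

section \<open>Compositions\<close>

lemma saturated_image:
  assumes inj: "inj_on f A"
  shows "saturated S d (f ` A) \<longleftrightarrow> saturated S (\<lambda>x y. d (f x) (f y)) A"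
proof
  assume sat: "saturated S d (f ` A)"
  show "saturated S (\<lambda>x y. d (f x) (f y)) A"
    unfolding saturated_def
  proof (intro allI impI)
    fix E g assume E: "finite E \<and> E \<subseteq> A \<and> (\<forall>x\<in>E. g x \<in> S) \<and> (\<forall>x\<in>E. \<forall>y\<in>E. tri (g x) (g y) (d (f x) (f y)))"
    define h where "h = g \<circ> inv_into A f"
    have h: "h (f x) = g x" if "x \<in> E" for x
      using that E inj by (auto simp: h_def)
    have "\<exists>z\<in>f ` A. \<forall>x\<in>f ` E. d z x = h x"
      using sat[unfolded saturated_def, rule_format, of "f ` E" h] E h by (auto simp: image_subset_iff)
    then show "\<exists>z\<in>A. \<forall>x\<in>E. d (f z) (f x) = g x" using h by auto
  qed
next
  assume sat: "saturated S (\<lambda>x y. d (f x) (f y)) A"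
  show "saturated S d (f ` A)"
    unfolding saturated_def
  proof (intro allI impI)
    fix E g assume E: "finite E \<and> E \<subseteq> f ` A \<and> (\<forall>x\<in>E. g x \<in> S) \<and> (\<forall>x\<in>E. \<forall>y\<in>E. tri (g x) (g y) (d x y))"
    then obtain E' where E': "E' \<subseteq> A" "finite E'" "E = f ` E'" using finite_subset_image by metis
    have "\<exists>z\<in>A. \<forall>x\<in>E'. d (f z) (f x) = g (f x)"
      using sat[unfolded saturated_def, rule_format, of E' "g \<circ> f"] E E' by auto
    then show "\<exists>z\<in>f ` A. \<forall>x\<in>E. d z x = g x" using E'(3) by auto
  qed
qed

text \<open>A point at distance \<open>M > 0\<close> from all of a finite \<open>V\<close> would
  have that distance to itself.\<close>

lemma saturated_infinite:
  assumes "distance_set S" "\<And>x. x \<in> V \<Longrightarrow> d x x = 0" "\<And>x y. \<lbrakk>x \<in> V; y \<in> V; x \<noteq> y\<rbrakk> \<Longrightarrow> d x y \<in> S"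
    and "saturated S d V"
  shows "infinite V"
proof
  interpret distance_set S by fact
  assume "finite V"
  have Mpos: "0 < M" using M_in S_pos by auto
  have "tri M M (d x y)" if "x \<in> V" "y \<in> V" for x y
  proof -
    have "d x y \<in> S0" using assms(2,3) that S_S0 by (cases "x = y") auto
    from le_M[OF this] S0_nonneg[OF this] show ?thesis using Mpos by (simp add: tri_def)
  qed
  then obtain z where "z \<in> V" "\<forall>x\<in>V. d z x = M"
    using assms(4)[unfolded saturated_def, rule_format, of V "\<lambda>_. M"] \<open>finite V\<close> M_in by blast
  then show False using assms(2) Mpos by force
qed

lemma urysohn_natI:
  assumes "distance_set S" and zero: "\<And>x y. \<lbrakk>x \<in> V; y \<in> V\<rbrakk> \<Longrightarrow> d x y = 0 \<longleftrightarrow> x = y"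
    and sym: "\<And>x y. \<lbrakk>x \<in> V; y \<in> V\<rbrakk> \<Longrightarrow> d x y = d y x"
    and triangle: "\<And>x y z. \<lbrakk>x \<in> V; y \<in> V; z \<in> V\<rbrakk> \<Longrightarrow> d x z \<le> d x y + d y z"
    and dS: "\<And>x y. \<lbrakk>x \<in> V; y \<in> V; x \<noteq> y\<rbrakk> \<Longrightarrow> d x y \<in> S"
    and sat: "saturated S d V" and count: "countable V"
  obtains f where "bij_betw f UNIV V" "urysohn_nat S (\<lambda>m n. d (f m) (f n))"
proof -
  have "infinite V"
    by (rule saturated_infinite[OF assms(1) _ dS sat]) (simp_all add: zero)
  then obtain f :: "nat \<Rightarrow> 'a" where f: "bij_betw f UNIV V"
    using bij_betw_from_nat_into count by blast
  then have inj: "inj f" and range: "range f = V" by (auto simp: bij_betw_def)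
  have fV: "f n \<in> V" for n using range by blast
  have "urysohn_nat S (\<lambda>m n. d (f m) (f n))"
  proof (intro urysohn_nat.intro urysohn_nat_axioms.intro assms(1))
    show "saturated S (\<lambda>m n. d (f m) (f n)) UNIV"
      using saturated_image[OF inj, of S d] sat range by simp
    show "d (f x) (f y) = 0 \<longleftrightarrow> x = y" for x y
      using zero[OF fV fV, of x y] injD[OF inj, of x y] by blast
    show "d (f x) (f y) \<in> S" if "x \<noteq> y" for x y
      using dS[OF fV fV, of x y] injD[OF inj, of x y] that by blast
    show "d (f x) (f y) = d (f y) (f x)" for x y by (rule sym[OF fV fV])
    show "d (f x) (f z) \<le> d (f x) (f y) + d (f y) (f z)" for x y z by (rule triangle[OF fV fV fV])
  qed
  then show thesis using that f by blast
qed

text \<open>A property of \<open>S\<close> alone, suited to induction. Other carriers come back by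
  \<open>vertex_indivisible_on\<close>, more colours by \<open>indivisible_colours\<close>.\<close>

definition vertex_indivisible :: "real set \<Rightarrow> bool" where
  "vertex_indivisible S \<longleftrightarrow> (\<forall>d R. urysohn_nat S d \<longrightarrow> (\<exists>Y. saturated S d Y \<and> (Y \<subseteq> R \<or> Y \<inter> R = {})))"

lemma vertex_indivisible_on:
  assumes ind: "vertex_indivisible S" and S: "distance_set S"
    and zero: "\<And>x y. \<lbrakk>x \<in> V; y \<in> V\<rbrakk> \<Longrightarrow> d x y = 0 \<longleftrightarrow> x = y"
    and sym: "\<And>x y. \<lbrakk>x \<in> V; y \<in> V\<rbrakk> \<Longrightarrow> d x y = d y x"
    and triangle: "\<And>x y z. \<lbrakk>x \<in> V; y \<in> V; z \<in> V\<rbrakk> \<Longrightarrow> d x z \<le> d x y + d y z"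
    and dS: "\<And>x y. \<lbrakk>x \<in> V; y \<in> V; x \<noteq> y\<rbrakk> \<Longrightarrow> d x y \<in> S"
    and sat: "saturated S d V" and count: "countable V"
  shows "\<exists>Y\<subseteq>V. saturated S d Y \<and> (Y \<subseteq> R \<or> Y \<inter> R = {})"
proof -
  obtain f where f: "bij_betw f UNIV V" "urysohn_nat S (\<lambda>m n. d (f m) (f n))"
    using urysohn_natI[OF S zero sym triangle dS sat count] by blast
  obtain Y where Y: "saturated S (\<lambda>m n. d (f m) (f n)) Y" "Y \<subseteq> f -` R \<or> Y \<inter> f -` R = {}"
    using ind f(2) unfolding vertex_indivisible_def by blast
  have "inj_on f Y" using f(1) by (meson bij_betw_imp_inj_on inj_on_subset subset_UNIV)
  then have "saturated S d (f ` Y)" using Y(1) saturated_image by blast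
  moreover have "f ` Y \<subseteq> V" using f(1) by (auto simp: bij_betw_def)
  ultimately show ?thesis using Y(2) by (intro exI[of _ "f ` Y"]) auto
qed

context urysohn_nat
begin

text \<open>If \<open>e\<close> is absorbed by all larger distances, then the space is obtained by replacing each point
  of the space for the larger distances by a copy of the space for the distances up to \<open>e\<close>.\<close>

lemma composition:
  assumes e: "e \<oplus> e = e" "\<And>t. \<lbrakk>t \<in> S; e < t\<rbrakk> \<Longrightarrow> e \<oplus> t = t"
    and S1: "S1 = {s \<in> S. s \<le> e}" "distance_set S1" "vertex_indivisible S1"
    and S2: "S2 = {s \<in> S. e < s}" "distance_set S2" "vertex_indivisible S2"
  shows "\<exists>Y. sat Y \<and> (Y \<subseteq> R \<or> Y \<inter> R = {})"
proof -
  have e0: "0 \<le> e" using e(1) oplus_nonneg by metis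
  have trans: "d x z \<le> e" if "d x y \<le> e" "d y z \<le> e" for x y z
    using d_tri[of x z y] oplus_mono[OF that] e(1) by simp
  have absorb: "d x' y = d x y" if "e < d x y" "d x x' \<le> e" for x x' y
  proof -
    have le: "d u' y \<le> d u y" if "e < d u y" "d u u' \<le> e" for u u'
    proof -
      have "u \<noteq> y" using that(1) e0 by auto
      then have "e \<oplus> d u y = d u y" using e(2) d_in_S that(1) by blast
      then show ?thesis
        using d_tri[of u' y u] oplus_mono[OF _ order_refl, of "d u' u" e "d u y"] that(2) by (simp add: d_sym[of u'])
    qed
    have "e < d x' y" using trans[OF that(2), of y] that(1) by force
    then show ?thesis using le[OF that] le[of x' x] that(2) by (simp add: d_sym[of x'])
  qed
  define \<rho> where "\<rho> x = (LEAST y. d x y \<le> e)" for x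
  have \<rho>: "d x (\<rho> x) \<le> e" for x
    unfolding \<rho>_def by (rule LeastI[of _ x]) (use e0 in simp)
  have \<rho>_eq: "\<rho> x = \<rho> y" if "d x y \<le> e" for x y
  proof -
    have "d x z \<le> e \<longleftrightarrow> d y z \<le> e" for z
      using trans[of x y z] trans[of y x z] that by (auto simp: d_sym[of y x])
    then show ?thesis by (simp add: \<rho>_def)
  qed
  define V where "V = range \<rho>"
  have \<rho>V: "\<rho> v = v" if v: "v \<in> V" for v
  proof -
    obtain u where "v = \<rho> u" using v by (auto simp: V_def)
    then show ?thesis using \<rho>_eq[OF \<rho>[of u]] by simp
  qed
  define B where "B v = {y. d v y \<le> e}" for v
  have far: "e < d u v" if "u \<in> V" "v \<in> V" "u \<noteq> v" for u v
    using that \<rho>_eq[of u v] \<rho>V by force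
  have satV: "saturated S2 d V"
    unfolding saturated_def
  proof (intro allI impI)
    fix E f assume E: "finite E \<and> E \<subseteq> V \<and> (\<forall>x\<in>E. f x \<in> S2) \<and> (\<forall>x\<in>E. \<forall>y\<in>E. tri (f x) (f y) (d x y))"
    obtain z where z: "\<And>x. x \<in> E \<Longrightarrow> d z x = f x"
      using sat_UNIV[unfolded saturated_def, rule_format, of E f] E S2(1) by auto
    have "d (\<rho> z) x = f x" if x: "x \<in> E" for x
    proof -
      have "e < d z x" using z[OF x] E x S2(1) by auto
      then show ?thesis using absorb[OF _ \<rho>] z[OF x] by simp
    qed
    then show "\<exists>z\<in>V. \<forall>x\<in>E. d z x = f x" unfolding V_def by blast
  qed
  have satB: "saturated S1 d (B v)" for v
    unfolding saturated_def
  proof (intro allI impI)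
    fix E f assume E: "finite E \<and> E \<subseteq> B v \<and> (\<forall>x\<in>E. f x \<in> S1) \<and> (\<forall>x\<in>E. \<forall>y\<in>E. tri (f x) (f y) (d x y))"
    show "\<exists>z\<in>B v. \<forall>x\<in>E. d z x = f x"
    proof (cases "E = {}")
      case True
      then show ?thesis using e0 by (auto simp: B_def intro: exI[of _ v])
    next
      case False
      then obtain x where x: "x \<in> E" by blast
      obtain z where z: "\<And>x. x \<in> E \<Longrightarrow> d z x = f x" 
        using sat_UNIV[unfolded saturated_def, rule_format, of E f] E S1(1) by auto
      have "d v x \<le> e" "d x z \<le> e" using x E z[OF x] S1(1) d_sym[of x z] by (auto simp: B_def)
      then have "z \<in> B v" using trans by (auto simp: B_def)
      then show ?thesis using z by blast
    qed
  qed
  have "\<exists>K\<subseteq>B v. saturated S1 d K \<and> (K \<subseteq> R \<or> K \<inter> R = {})" for v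
  proof (rule vertex_indivisible_on[OF S1(3,2) _ _ _ _ satB])
    fix x y assume xy: "x \<in> B v" "y \<in> B v" "x \<noteq> y"
    then have "d x y \<le> e" using trans[of x v y] by (auto simp: B_def d_sym[of x])
    then show "d x y \<in> S1" using d_in_S xy(3) S1(1) by blast
  qed (auto intro: d_triangle d_sym)
  then obtain K where K: "\<And>v. K v \<subseteq> B v" "\<And>v. saturated S1 d (K v)" "\<And>v. K v \<subseteq> R \<or> K v \<inter> R = {}"
    by metis
  \<comment> \<open>Each block now contains a monochromatic copy \<open>K v\<close>; the space of
    blocks is coloured by the colour of that copy.\<close>
  have "\<exists>V'\<subseteq>V. saturated S2 d V' \<and> (V' \<subseteq> {v. K v \<subseteq> R} \<or> V' \<inter> {v. K v \<subseteq> R} = {})"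
  proof (rule vertex_indivisible_on[OF S2(3,2) _ _ _ _ satV])
    show "d x y \<in> S2" if "x \<in> V" "y \<in> V" "x \<noteq> y" for x y
      using far[OF that] d_in_S that(3) S2(1) by blast
  qed (auto intro: d_triangle d_sym)
  then obtain V' where V': "V' \<subseteq> V" "saturated S2 d V'"
    "V' \<subseteq> {v. K v \<subseteq> R} \<or> V' \<inter> {v. K v \<subseteq> R} = {}" by blast
  define Y where "Y = (\<Union>v\<in>V'. K v)"
  have "sat Y"
  proof (rule sat_ptI)
    fix E w assume E: "finite E" "E \<subseteq> Y" "w \<notin> E"
    show "\<exists>y\<in>Y. eqv E y w"
    \<comment> \<open>If \<open>w\<close> lies in the block of a point of \<open>E\<close>, the copy
      \<open>K v\<close> in that block is used and \<open>absorb\<close> settles the other blocks.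
      Otherwise a suitable block is found in \<open>V'\<close>, and any point of its copy will
      do.\<close>
    proof (cases "\<exists>x\<in>E. d w x \<le> e")
      case True
      then obtain x v where x: "x \<in> E" "d w x \<le> e" "v \<in> V'" "x \<in> K v" using E(2) unfolding Y_def by blast
      have vx: "d v x \<le> e" using x(4) K(1) by (auto simp: B_def)
      have vw: "d v w \<le> e" using trans[OF vx, of w] x(2) by (simp add: d_sym[of x])
      have EB: "u \<in> K v" if u: "u \<in> E" "u \<in> B v" for u
      proof -
        obtain v' where v': "v' \<in> V'" "u \<in> K v'" using u(1) E(2) unfolding Y_def by blast
        have "d v' u \<le> e" "d v u \<le> e" using v'(2) K(1) u(2) by (auto simp: B_def)
        then have "d v v' \<le> e" using trans[of v u v'] by (simp add: d_sym[of u])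
        then have "v = v'" using far V'(1) x(3) v'(1) by force
        then show ?thesis using v' by simp
      qed
      have dS1: "d w u \<in> S1" if "u \<in> E \<inter> B v" for u
      proof -
        have "d w u \<le> e" using trans[of w v u] vw that by (auto simp: B_def d_sym[of w v])
        then show ?thesis using d_in_S[of w u] that E(3) S1(1) by auto
      qed
      have "E \<inter> B v \<subseteq> K v" using EB by blast
      then obtain y where y: "y \<in> K v" "\<forall>u\<in>E \<inter> B v. d y u = d w u"
        using K(2)[of v, unfolded saturated_def, rule_format, of "E \<inter> B v" "d w"] E(1) dS1 tri_d by blast
      have "eqv E y w"
        unfolding eqv_def
      proof
        fix u assume u: "u \<in> E"
        show "d y u = d w u"
        proof (cases "u \<in> B v")
          case True
          then show ?thesis using y(2) u by blast
        next
          case False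
          have "d w y \<le> e" using trans[of w v y] vw y(1) K(1) by (auto simp: B_def d_sym[of w v])
          moreover have "e < d w u" using trans[OF vw, of u] False by (force simp: B_def)
          ultimately show ?thesis using absorb by blast
        qed
      qed
      then show ?thesis using y(1) x(3) unfolding Y_def by blast
    next
      case False
      then have farE: "e < d w x" if "x \<in> E" for x using that by force
      have \<rho>E: "\<rho> x \<in> V'" if x: "x \<in> E" for x
      proof -
        obtain v where v: "v \<in> V'" "x \<in> K v" using x E(2) unfolding Y_def by blast
        then have "d v x \<le> e" using K(1) by (auto simp: B_def)
        then have "\<rho> x = v" using \<rho>_eq \<rho>V V'(1) v(1) by (metis subsetD)
        then show ?thesis using v(1) by simp
      qed
      have w\<rho>: "d w (\<rho> x) = d w x" if "x \<in> E" for x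
        using absorb[of x w "\<rho> x"] farE[OF that] \<rho>[of x] by (simp add: d_sym[of w])
      have "d w (\<rho> x) \<in> S2" if "x \<in> E" for x
        using farE[OF that] w\<rho>[OF that] d_in_S[of w x] that E(3) S2(1) by auto
      then obtain v where v: "v \<in> V'" "\<forall>u\<in>\<rho> ` E. d v u = d w u"
        using V'(2)[unfolded saturated_def, rule_format, of "\<rho> ` E" "d w"] E(1) \<rho>E tri_d by blast
      obtain y where y: "y \<in> K v"
        using K(2)[of v, unfolded saturated_def, rule_format, of "{}"] by auto
      have "d y x = d w x" if "x \<in> E" for x
      proof -
        have "e < d v (\<rho> x)" using v(2) w\<rho>[OF that] farE[OF that] that by simp
        moreover have "d v y \<le> e" using y K(1) by (auto simp: B_def)
        ultimately have 1: "d y (\<rho> x) = d v (\<rho> x)" using absorb by blast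
        have "e < d (\<rho> x) y" using 1 \<open>e < d v (\<rho> x)\<close> by (simp add: d_sym[of _ y])
        then have "d x y = d (\<rho> x) y" using absorb[of "\<rho> x" y x] \<rho>[of x] by (simp add: d_sym[of _ x])
        then show ?thesis using 1 v(2) w\<rho>[OF that] that by (simp add: d_sym[of y])
      qed
      then show ?thesis using y v(1) unfolding Y_def eqv_def by blast
    qed
  qed
  moreover have "Y \<subseteq> R \<or> Y \<inter> R = {}" using V'(3) K(3) unfolding Y_def by blast
  ultimately show ?thesis by blast
qed

end

section \<open>At most four distances\<close>

lemma oplus_subset:
  assumes "distance_set S" "S' \<subseteq> S" "S' \<noteq> {}" "a \<in> S'" "b \<in> S'" "oplus S a b \<in> S'"
  shows "oplus S' a b = oplus S a b"
proof -
  interpret distance_set S by fact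
  have fin: "finite S'" using finite_S assms(2) finite_subset by blast
  have eq: "rnd S' x = rnd S x" if x: "rnd S x \<in> S'" "0 \<le> x" for x
  proof (rule antisym)
    show "rnd S' x \<le> rnd S x"
      unfolding rnd_def using finite_S assms(2) fin by (intro Max_mono) auto
    show "rnd S x \<le> rnd S' x"
      unfolding rnd_def[of S'] using fin x rnd_le[OF x(2)] by (intro Max_ge) auto
  qed
  have S: "a \<in> S" "b \<in> S" using assms by auto
  have ab: "rnd S' a = a" "rnd S' b = b"
    using eq[of a] eq[of b] assms(4,5) S S_pos S_S0 by auto
  have "0 \<le> a + b" using S0_nonneg[OF S_S0[OF S(1)]] S0_nonneg[OF S_S0[OF S(2)]] by simp
  moreover have "oplus S a b = rnd S (a + b)" using S S_S0 by (simp add: oplus_def)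
  ultimately show ?thesis using eq[of "a + b"] assms(6) ab by (simp add: oplus_def)
qed

text \<open>On a subset closed under \<oplus> the subset's own rounding gives the same sums, so
  associativity is inherited.\<close>

lemma distance_set_subset:
  assumes "distance_set S" "S' \<subseteq> S" "S' \<noteq> {}" "\<And>a b. \<lbrakk>a \<in> S'; b \<in> S'\<rbrakk> \<Longrightarrow> oplus S a b \<in> S'"
  shows "distance_set S'"
proof -
  interpret distance_set S by fact
  have eq: "oplus S' a b = oplus S a b" if "a \<in> S'" "b \<in> S'" for a b
    using oplus_subset[OF assms(1-3) that assms(4)[OF that]] .
  show ?thesis
  proof
    show "finite S'" using finite_S assms(2) finite_subset by blast
    show "oplus S' (oplus S' a b) c = oplus S' a (oplus S' b c)" if "a \<in> S'" "b \<in> S'" "c \<in> S'" for a b c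
      using that assms(4) by (simp add: eq oplus_assoc)
  qed (use assms(2,3) S_pos in auto)
qed

context urysohn_nat
begin

lemma no_chain:
  assumes "card S \<le> 4" "x1 \<in> S" "x2 \<in> S" "x3 \<in> S" "x4 \<in> S" "x5 \<in> S"
    and "x1 < x2" "x2 < x3" "x3 < x4" "x4 < x5"
  shows False
proof -
  have "card {x1, x2, x3, x4, x5} = 5" using assms(7-10) by simp
  moreover have "card {x1, x2, x3, x4, x5} \<le> card S" using assms(2-6) finite_S by (intro card_mono) auto
  ultimately show False using assms(1) by simp
qed

lemma four_elements:
  assumes "card S \<le> 4" "x1 \<in> S" "x2 \<in> S" "x3 \<in> S" "x4 \<in> S" "distinct [x1, x2, x3, x4]"
  shows "S = {x1, x2, x3, x4}"
proof -
  have "card {x1, x2, x3, x4} = 4" using assms(6) by simp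
  then show ?thesis using card_subset_eq[OF finite_S, of "{x1, x2, x3, x4}"]
      card_mono[OF finite_S, of "{x1, x2, x3, x4}"] assms by auto
qed

text \<open>\<open>IH\<close> enters only through \<open>absorbed\<close>. When
  \<open>i < M\<close>, that step leaves some \<open>t\<close> with
  \<open>i < t < i \<oplus> t\<close>, so that \<open>S\<close> has room for at most one further
  element; this is what makes the case analysis short.\<close>

lemma mono_copy_le4:
  assumes card: "card S \<le> 4"
    and IH: "\<And>S'. \<lbrakk>distance_set S'; card S' < card S\<rbrakk> \<Longrightarrow> vertex_indivisible S'"
  shows "\<exists>Y. sat Y \<and> (Y \<subseteq> R \<or> Y \<inter> R = {})"
proof (rule ccontr)
  assume neg: "\<not> ?thesis"
  interpret no_mono_copy S d R
    by unfold_locales (use neg in auto)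
  have dset: "distance_set S" by unfold_locales
  note S0 = S_S0
  define a where "a = Min S"
  have a: "a \<in> S" "\<And>s. s \<in> S \<Longrightarrow> a \<le> s" unfolding a_def using finite_S S_nonempty by auto
  define i where "i = a \<oplus> a \<oplus> a \<oplus> a"
  have i: "i \<in> S" unfolding i_def using a(1) oplus_in_S by blast
  have i_a: "i \<oplus> a = i"
  proof (rule ccontr)
    assume ne: "i \<oplus> a \<noteq> i"
    define m where "m = (\<lambda>x. x \<oplus> a)"
    have m_le: "x \<le> m x" if "x \<in> S" for x using le_oplus1 S0 that by (simp add: m_def)
    have m_in: "m x \<in> S" if "x \<in> S" for x using oplus_in_S that by (simp add: m_def)
    have im: "i = m (m (m a))" by (simp add: i_def m_def)
    have "m x \<noteq> x" if "x \<in> {a, m a, m (m a), i}" for x using that ne im by (auto simp: m_def)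
    then have "a < m a" "m a < m (m a)" "m (m a) < m (m (m a))" "m (m (m a)) < m i"
      using m_le m_in a(1) im by (metis insertI1 insertI2 order_le_less)+
    then show False using no_chain[OF card] m_in a(1) im by metis
  qed
  have i_i: "i \<oplus> i = i"
  proof -
    have "i \<oplus> i = i \<oplus> a \<oplus> a \<oplus> a \<oplus> a" by (simp add: i_def oplus_ac)
    then show ?thesis using i_a by simp
  qed
  have absorbed: False if e: "e \<in> S" "e < M" "e \<oplus> e = e" "\<And>t. \<lbrakk>t \<in> S; e < t\<rbrakk> \<Longrightarrow> e \<oplus> t = t" for e
  proof -
    define S1 S2 where "S1 = {s \<in> S. s \<le> e}" and "S2 = {s \<in> S. e < s}"
    have S1: "distance_set S1"
    proof (rule distance_set_subset[OF dset])
      show "x \<oplus> y \<in> S1" if "x \<in> S1" "y \<in> S1" for x y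
        using oplus_mono[of x e y e] e(3) oplus_in_S that by (auto simp: S1_def)
    qed (use e(1) in \<open>auto simp: S1_def\<close>)
    have S2: "distance_set S2"
    proof (rule distance_set_subset[OF dset])
      show "x \<oplus> y \<in> S2" if "x \<in> S2" "y \<in> S2" for x y
        using le_oplus1[OF S0, of x y] oplus_in_S that by (fastforce simp: S2_def)
    qed (use e(2) M_in in \<open>auto simp: S2_def\<close>)
    have "M \<notin> S1" "S1 \<subseteq> S" using e(2) by (auto simp: S1_def)
    then have "S1 \<subset> S" using M_in by blast
    moreover have "S2 \<subset> S" using e(1) by (auto simp: S2_def)
    ultimately have "vertex_indivisible S1" "vertex_indivisible S2"
      using IH S1 S2 psubset_card_mono[OF finite_S] by blast+
    then show False using composition[OF e(3,4) S1_def S1 _ S2_def S2] neg by blast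
  qed
  have two_level: False
    if "j \<in> S" "\<not> large j" "\<And>s t. \<lbrakk>s \<in> S; t \<in> S; \<not> large s; \<not> large t\<rbrakk> \<Longrightarrow> s \<oplus> t = j"
      "\<And>s t. \<lbrakk>s \<in> S; t \<in> S; \<not> large s; large t\<rbrakk> \<Longrightarrow> s \<oplus> t = j \<oplus> t" for j
  proof -
    interpret two_level_copy S d R j by unfold_locales (fact that)+
    show False by (rule inconsistent)
  qed
  show False
  proof (cases "i = M")
    case True
    \<comment> \<open>Doubling the least sum \<open>a \<oplus> a\<close> gives \<open>i = M\<close>,
      so every sum is large.\<close>
    have aa: "large (a \<oplus> a)" using True by (simp add: large_def i_def oplus_assoc)
    have "archimedean_copy S d R"
    proof
      show L: "large (s \<oplus> t)" if "s \<in> S" "t \<in> S" for s t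
        using large_mono[OF aa] oplus_mono a(2) that by blast
      \<comment> \<open>Otherwise \<open>s < t < s \<oplus> s < t \<oplus> t < M\<close> would be
        five elements.\<close>
      have less: False if st: "s \<in> S" "t \<in> S" "\<not> large s" "\<not> large t" "s \<oplus> s \<noteq> t \<oplus> t" "s < t" for s t
      proof -
        have "s \<oplus> s < t \<oplus> t" using oplus_mono[of s t s t] st(5,6) by simp
        moreover have "t < s \<oplus> s" using large_mono[OF L[OF st(1,1)], of t] st(4) by force
        moreover have "t \<oplus> t < M" using st(4) oplus_le_M[of t t] by (simp add: large_def)
        ultimately show False using no_chain[OF card] st(1,2,6) oplus_in_S M_in by metis
      qed
      show "s \<oplus> s = t \<oplus> t" if "s \<in> S" "t \<in> S" "\<not> large s" "\<not> large t" for s t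
        using less[of s t] less[of t s] that by (metis linorder_neqE_linordered_idom)
    qed
    then show False by (rule archimedean_copy.inconsistent)
  next
    case False
    then have iM: "i < M" using le_M[OF S0[OF i]] by simp
    obtain t where t: "t \<in> S" "i < t" "i \<oplus> t \<noteq> t" using absorbed[OF i iM i_i] by blast
    define u where "u = i \<oplus> t"
    have u: "u \<in> S" "t < u" using oplus_in_S t le_oplus2[OF S0, of t i] by (auto simp: u_def)
    have i_u: "i \<oplus> u = u" using i_i by (simp add: u_def oplus_assoc[symmetric])
    have i_small: "\<not> large i" using i_i False by (simp add: large_def)
    have tt: "u \<le> t \<oplus> t" using oplus_mono[of i t t t] t(2) by (simp add: u_def)
    show False
    \<comment> \<open>When \<open>a \<noteq> i\<close>, the elements are
      \<open>a < i < t < u = M\<close>; here \<open>a\<close> and \<open>i\<close> are the small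
      distances, and both add to \<open>t\<close> alike.\<close>
    proof (cases "a = i")
      case False
      then have ai: "a < i" using a(2)[OF i] by simp
      have S: "S = {a, i, t, u}" by (rule four_elements[OF card]) (use a(1) i t u ai in auto)
      have uM: "u = M" using M_in S ai t(2) u(2) le_M[OF S0[OF u(1)]] by auto
      have large: "large t" "large u"
        using tt uM oplus_le_M[of t t] oplus_le_M[of u u] le_oplus1[OF S0[OF u(1)], of u] by (auto simp: large_def)
      have a_small: "\<not> large a" using i_small large_mono[of a i] ai by auto
      have aa: "a \<oplus> a = i"
      proof -
        have "a \<oplus> a \<in> S" using oplus_in_S a(1) by blast
        moreover have "a \<oplus> a \<le> i" using oplus_mono[of a i a i] ai i_i by simp
        moreover have "a \<oplus> a \<noteq> a" using ai by (auto simp: i_def)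
        ultimately show ?thesis using S t(2) u(2) by auto
      qed
      have at: "a \<oplus> t = u"
      proof -
        have "a \<oplus> t \<noteq> t"
        proof
          assume *: "a \<oplus> t = t"
          have "i \<oplus> t = t" by (simp add: i_def oplus_assoc *)
          then show False using t(3) by simp
        qed
        moreover have "a \<oplus> t \<in> S" "t \<le> a \<oplus> t" using oplus_in_S a(1) le_oplus2[OF S0[OF t(1)]] by blast+
        ultimately show ?thesis using S ai t(2) by auto
      qed
      show False
      proof (rule two_level[OF i i_small])
        have el: "s = a \<or> s = i \<or> s = t \<or> s = u" if "s \<in> S" for s
          using that unfolding S by simp
        have "a \<oplus> i = i" using i_a by (simp add: oplus_comm)
        then show "s \<oplus> s' = i" if "s \<in> S" "s' \<in> S" "\<not> large s" "\<not> large s'" for s s'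
          using that(3,4) el[OF that(1)] el[OF that(2)] large aa i_a i_i by auto
        show "s \<oplus> s' = i \<oplus> s'" if "s \<in> S" "s' \<in> S" "\<not> large s" "large s'" for s s'
        proof -
          have "s = a \<or> s = i" "s' = t \<or> s' = u"
            using that(3,4) el[OF that(1)] el[OF that(2)] large i_small a_small by auto
          then show ?thesis using at uM by (auto simp: u_def)
        qed
      qed
    next
      case True
      show False
      \<comment> \<open>If \<open>i\<close> is the only small distance, the conditions of
        \<open>two_level\<close> reduce to \<open>i \<oplus> i = i\<close>.\<close>
      proof (cases "\<exists>v\<in>S. v \<noteq> i \<and> \<not> large v")
        case False
        show False
        proof (rule two_level[OF i i_small])
          show "s \<oplus> s' = i" if "s \<in> S" "s' \<in> S" "\<not> large s" "\<not> large s'" for s s'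
            using that False i_i by metis
          show "s \<oplus> s' = i \<oplus> s'" if "s \<in> S" "s' \<in> S" "\<not> large s" "large s'" for s s'
            using that False by metis
        qed
      next
        case True': True
        then obtain v where v: "v \<in> S" "v \<noteq> i" "\<not> large v" by blast
        have iv: "i < v" using a(2)[OF v(1)] True v(2) by simp
        show False
        proof (cases "u = M")
          case True
          have large_t: "large t" using tt oplus_le_M[of t t] True by (simp add: large_def)
          then have vt: "v < t" using large_mono[of t v] v(3) by force
          have S: "S = {i, v, t, u}" by (rule four_elements[OF card]) (use i v t u iv vt in auto)
          have "v \<oplus> v \<in> S" "v \<le> v \<oplus> v" "v \<oplus> v \<noteq> u"
            using oplus_in_S v le_oplus1[OF S0, of v v] True by (auto simp: large_def)
          then have "v \<oplus> v = v \<or> v \<oplus> v = t" using S iv by auto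
          \<comment> \<open>The value \<open>t\<close> would yield \<open>i \<oplus> t = t\<close>,
            against the choice of \<open>t\<close>.\<close>
          moreover have "v \<oplus> v \<noteq> t"
          proof
            assume vv: "v \<oplus> v = t"
            have "i \<oplus> v \<in> S" "v \<le> i \<oplus> v" "i \<oplus> v \<le> t"
              using oplus_in_S i le_oplus2[OF S0[OF v(1)]] oplus_mono[of i v v v] iv vv by auto
            then have "i \<oplus> v = v \<or> i \<oplus> v = t" using S iv u(2) by auto
            then show False
            proof
              assume "i \<oplus> v = v"
              then have "i \<oplus> t = t" using vv by (metis oplus_assoc)
              then show False using t(3) by simp
            next
              assume "i \<oplus> v = t"
              then have "i \<oplus> t = t" using i_i by (metis oplus_assoc)
              then show False using t(3) by simp
            qed
          qed
          ultimately have vv: "v \<oplus> v = v" by blast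
          have "free_cross S d i v"
          proof
            show "s = i \<or> s = v \<or> v < s" if "s \<in> S" for s using that S vt u(2) by auto
            show "s \<oplus> t' = M" if "s \<in> S" "t' \<in> S" "v < t'" for s t'
            proof -
              have "t \<le> t'" using that S iv vt u(2) by auto
              moreover have "i \<le> s" using a(2)[OF that(1)] \<open>a = i\<close> by simp
              ultimately have "u \<le> s \<oplus> t'" using oplus_mono[of i s t t'] by (simp add: u_def)
              then show ?thesis using True oplus_le_M[of s t'] by simp
            qed
          qed (use i v iv i_i vv vt u(2) True in auto)
          then show False using free_cross.mono_copy neg by blast
        next
          case False
          then have uM: "u < M" using le_M[OF S0[OF u(1)]] by simp
          \<comment> \<open>Here \<open>u\<close> will be idempotent with only \<open>M\<close>
            above it, which leads back to a composition.\<close>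
          have S: "S = {i, t, u, M}" by (rule four_elements[OF card]) (use i t u uM M_in in auto)
          have "\<not> large t"
          proof
            assume "large t"
            then have "large s" if "t \<le> s" for s using large_mono that by blast
            then show False using v S u(2) uM by auto
          qed
          then have "t \<oplus> t \<noteq> M" by (simp add: large_def)
          moreover have "t \<oplus> t \<in> {i, t, u, M}" using oplus_in_S t(1) S by blast
          ultimately have "t \<oplus> t = u" using tt t(2) u(2) by auto
          then have ut: "u \<oplus> t = u" using i_u by (simp add: u_def oplus_assoc)
          then have "u \<oplus> u = u" using i_u by (metis oplus_assoc oplus_comm u_def)
          moreover have "u \<oplus> t' = t'" if "t' \<in> S" "u < t'" for t'
          proof -
            have "t' \<in> {i, t, u, M}" using that(1) S by blast
            then show ?thesis using that(2) t(2) u(2) by auto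
          qed
          ultimately show False using absorbed[OF u(1) uM] by blast
        qed
      qed
    qed
  qed
qed

end

lemma vertex_indivisible_le4:
  assumes "distance_set S" "card S \<le> 4"
  shows "vertex_indivisible S"
  using assms
proof (induction "card S" arbitrary: S rule: less_induct)
  case less
  show ?case
    unfolding vertex_indivisible_def
  proof (intro allI impI)
    fix d R assume "urysohn_nat S d"
    then show "\<exists>Y. saturated S d Y \<and> (Y \<subseteq> R \<or> Y \<inter> R = {})"
      using urysohn_nat.mono_copy_le4[of S d R] less by (meson le_trans less_imp_le)
  qed
qed

section \<open>Back to isometric copies, several colours and the original space\<close>

lemma (in urysohn_nat) embed_saturated:
  assumes "sat Y"
  shows "\<exists>f. range f \<subseteq> Y \<and> (\<forall>m n. d (f m) (f n) = d m n)"
proof -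
  define P where "P f n y \<longleftrightarrow> y \<in> Y \<and> (\<forall>m<n. d y (f m) = d n m)" for f :: "nat \<Rightarrow> nat" and n y
  have "\<exists>f. \<forall>n. P f n (f n)"
  proof (rule dependent_wellorder_choice)
    show "P f n y = P g n y" if "\<And>m. m < n \<Longrightarrow> f m = g m" for f g n y
      using that by (simp add: P_def)
    fix n f assume IH: "\<And>m. m < n \<Longrightarrow> P f m (f m)"
    have iso: "isom_on {..<n} f"
      unfolding isom_on_def
    proof (intro ballI)
      fix u v assume uv: "u \<in> {..<n}" "v \<in> {..<n}"
      consider "u < v" | "u = v" | "v < u" by linarith
      then show "d (f u) (f v) = d u v"
        using IH[of u] IH[of v] uv by cases (auto simp: P_def d_sym[of "f u"] d_sym[of u])
    qed
    \<comment> \<open>\<open>g n\<close> is where \<open>n\<close> would go in the ambient space;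
      its type over the image so far is then realised in \<open>Y\<close>.\<close>
    obtain g where g: "isom_on ({..<n} \<union> {n}) g" "\<And>u. u \<in> {..<n} \<Longrightarrow> g u = f u"
      using isom_extend[OF _ _ iso, of "{n}"] by blast
    have gn: "d (g n) (f m) = d n m" if "m < n" for m
      using isom_onD[OF g(1), of n m] g(2)[of m] that by simp
    have "f ` {..<n} \<subseteq> Y" using IH by (auto simp: P_def)
    moreover have "g n \<notin> f ` {..<n}" using gn d_eq_0 by (metis d_self imageE lessThan_iff less_irrefl)
    ultimately obtain y where "y \<in> Y" "eqv (f ` {..<n}) y (g n)"
      using sat_pt[OF assms, of "f ` {..<n}" "g n"] by blast
    then have "P f n y" using gn by (auto simp: P_def eqv_def)
    then show "\<exists>y. P f n y" by blast
  qed
  then obtain f where f: "\<And>n. f n \<in> Y" "\<And>m n. m < n \<Longrightarrow> d (f n) (f m) = d n m"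
    by (auto simp: P_def)
  have "d (f m) (f n) = d m n" for m n
    using f(2)[of m n] f(2)[of n m] by (cases m n rule: linorder_cases) (auto simp: d_sym[of "f m"] d_sym[of m])
  then show ?thesis using f(1) by (intro exI[of _ f]) auto
qed

text \<open>The last colour is played against the union of the others; a copy avoiding it is
  enumerated anew and has one colour less.\<close>

lemma indivisible_colours:
  assumes ind: "vertex_indivisible S" and S: "distance_set S"
  shows "\<lbrakk>urysohn_nat S d; \<And>n. col n < (k::nat)\<rbrakk> \<Longrightarrow> \<exists>Y c. saturated S d Y \<and> (\<forall>y\<in>Y. col y = c)"
proof (induction k arbitrary: d col)
  case 0
  then show ?case by simp
next
  case (Suc k)
  interpret urysohn_nat S d by fact
  obtain Y where Y: "sat Y" "Y \<subseteq> {n. col n = k} \<or> Y \<inter> {n. col n = k} = {}"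
    using ind Suc.prems(1) unfolding vertex_indivisible_def by blast
  show ?case
  proof (cases "Y \<subseteq> {n. col n = k}")
    case True
    then show ?thesis using Y(1) by blast
  next
    case False
    then have less: "col y < k" if "y \<in> Y" for y
      using Y(2) Suc.prems(2)[of y] that by (auto simp: less_Suc_eq)
    obtain f where f: "bij_betw f UNIV Y" "urysohn_nat S (\<lambda>m n. d (f m) (f n))"
    proof (rule urysohn_natI[OF S _ _ _ _ Y(1)])
      show "d x y = d y x" for x y by (rule d_sym)
      show "d x z \<le> d x y + d y z" for x y z by (rule d_triangle)
    qed (use d_in_S in auto)
    have fY: "f n \<in> Y" for n using f(1) by (auto simp: bij_betw_def)
    obtain Y' c where Y': "saturated S (\<lambda>m n. d (f m) (f n)) Y'" "\<forall>y\<in>Y'. col (f y) = c"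
      using Suc.IH[OF f(2), of "col \<circ> f"] less fY by auto
    have "inj_on f Y'" using f(1) by (meson bij_betw_imp_inj_on inj_on_subset subset_UNIV)
    then have "saturated S d (f ` Y')" using Y'(1) saturated_image by blast
    then show ?thesis using Y'(2) by (intro exI[of _ "f ` Y'"] exI[of _ c]) auto
  qed
qed

lemma distance_setI:
  assumes S: "finite S" "S \<noteq> {}" "S \<subseteq> {0<..}" and four: "four_values_condition S"
  shows "distance_set S"
proof
  have S0: "0 < s" if "s \<in> S" for s using S(3) that by auto
  have rnd_id: "rnd S a = a" if "a \<in> S" for a
    unfolding rnd_def using S(1) that S0[OF that] by (intro Max_eqI) auto
  have rnd: "rnd S x \<in> S" "rnd S x \<le> x" "\<And>s. \<lbrakk>s \<in> S; s \<le> x\<rbrakk> \<Longrightarrow> s \<le> rnd S x" if "a \<in> S" "a \<le> x" for a x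
  proof -
    have fin: "finite (insert 0 {s \<in> S. s \<le> x})" using S(1) by simp
    have "rnd S x \<in> insert 0 {s \<in> S. s \<le> x}" unfolding rnd_def by (rule Max_in[OF fin]) simp
    moreover show le: "s \<le> rnd S x" if "s \<in> S" "s \<le> x" for s
      unfolding rnd_def using fin that by (intro Max_ge) auto
    moreover have "0 < rnd S x" using le[OF \<open>a \<in> S\<close> \<open>a \<le> x\<close>] S0[OF \<open>a \<in> S\<close>] by simp
    ultimately show "rnd S x \<in> S" "rnd S x \<le> x" by auto
  qed
  define p where "p = oplus S"
  have p_eq: "p a b = rnd S (a + b)" if "a \<in> S" "b \<in> S" for a b
    using that rnd_id by (simp add: p_def oplus_def)
  have p: "p a b \<in> S" "a \<le> p a b" "b \<le> p a b" "p a b \<le> a + b" "\<And>s. \<lbrakk>s \<in> S; s \<le> a + b\<rbrakk> \<Longrightarrow> s \<le> p a b"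
    if ab: "a \<in> S" "b \<in> S" for a b
    using rnd[OF ab(1), of "a + b"] S0[OF ab(1)] S0[OF ab(2)] ab p_eq[OF ab] by auto
  have p_comm: "p a b = p b a" for a b by (simp add: p_def oplus_def add.commute)
  have le: "p (p a b) c \<le> p a (p b c)" if abc: "a \<in> S" "b \<in> S" "c \<in> S" for a b c
  proof -
    let ?t = "p a b" and ?u = "p (p a b) c"
    note t = p[OF abc(1,2)] and u = p[OF p(1)[OF abc(1,2)] abc(3)]
    \<comment> \<open>The triangles with sides \<open>a\<close>, \<open>b\<close> and
      \<open>?u\<close>, \<open>c\<close> share the side \<open>?t\<close>. The condition yields the
      other diagonal \<open>w\<close> with \<open>w \<le> b + c\<close>, hence
      \<open>w \<le> p b c\<close>, and with \<open>?u \<le> a + w\<close>.\<close>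
    have "\<exists>t\<in>S. \<bar>a - b\<bar> \<le> t \<and> t \<le> a + b \<and> \<bar>?u - c\<bar> \<le> t \<and> t \<le> ?u + c"
    proof (intro bexI[of _ ?t] conjI)
      show "\<bar>a - b\<bar> \<le> ?t" using t(2,3) S0[OF abc(1)] S0[OF abc(2)] by linarith
      show "\<bar>?u - c\<bar> \<le> ?t" "?t \<le> ?u + c" using u(2-4) S0[OF abc(3)] by linarith+
    qed (use t in auto)
    then obtain w where w: "w \<in> S" "\<bar>a - ?u\<bar> \<le> w" "w \<le> a + ?u" "\<bar>b - c\<bar> \<le> w" "w \<le> b + c"
      using four[unfolded four_values_condition_def, rule_format, OF abc(1,2) u(1) abc(3)] by blast
    have "w \<le> p b c" using p(5)[OF abc(2,3) w(1,5)] .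
    then have "?u \<le> a + p b c" using w(2) by linarith
    then show ?thesis using p(5)[OF abc(1) p(1)[OF abc(2,3)] u(1)] by blast
  qed
  show "oplus S (oplus S a b) c = oplus S a (oplus S b c)" if abc: "a \<in> S" "b \<in> S" "c \<in> S" for a b c
  proof -
    \<comment> \<open>By commutativity the reverse inequality is \<open>le\<close> for the triple
      read backwards.\<close>
    have "p (p a b) c = p a (p b c)"
      using le[OF abc] le[OF abc(3,2,1)] p_comm by (metis antisym)
    then show ?thesis by (simp add: p_def)
  qed
qed (use S in auto)

text \<open>The desired extension is modelled on \<open>{..n}\<close> with \<open>n\<close> as the
  new point, embedded into \<open>U\<close>, and moved by an isometry of \<open>U\<close> that takes
  its old part to \<open>E\<close>.\<close>

lemma saturated_Urysohn:
  fixes U :: "'a set"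
  assumes U: "is_Urysohn S U d" and pos: "S \<subseteq> {0<..}"
  shows "saturated S d U"
  unfolding saturated_def
proof (intro allI impI)
  interpret Metric_space U d using U by (simp add: is_Urysohn_def)
  fix E g assume E: "finite E \<and> E \<subseteq> U \<and> (\<forall>x\<in>E. g x \<in> S) \<and> (\<forall>x\<in>E. \<forall>y\<in>E. tri (g x) (g y) (d x y))"
  define n where "n = card E"
  obtain h where h: "bij_betw h {0..<n} E" using ex_bij_betw_nat_finite[of E] E by (auto simp: n_def)
  have hE: "h i \<in> E" "h i \<in> U" if "i < n" for i using h that E by (auto simp: bij_betw_def)
  have inj: "h i = h j \<longleftrightarrow> i = j" if "i < n" "j < n" for i j
    using h that by (auto simp: bij_betw_def inj_on_def)
  have g: "0 < g (h i)" "g (h i) \<in> S" if "i < n" for i using hE[OF that] E pos by auto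
  have t: "tri (g (h i)) (g (h j)) (d (h i) (h j))" if "i < n" "j < n" for i j using E hE that by blast
  define e where "e i j = (if i < n \<and> j < n then d (h i) (h j)
    else if i < n \<and> j = n then g (h i) else if i = n \<and> j < n then g (h j) else 0)" for i j
  have eM: "Metric_space {..n} e"
  proof
    show "0 \<le> e i j" for i j using g by (auto simp: e_def less_imp_le)
    show "e i j = e j i" for i j
      using commute[of "h i" "h j"] unfolding e_def by (simp only: conj_commute split: if_splits) auto
    show "e i j = 0 \<longleftrightarrow> i = j" if "i \<in> {..n}" "j \<in> {..n}" for i j
    proof -
      consider "i < n" "j < n" | "i < n" "j = n" | "i = n" "j < n" | "i = n" "j = n" using \<open>i \<in> {..n}\<close> \<open>j \<in> {..n}\<close> by force
      then show ?thesis
      proof cases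
        case 1
        then show ?thesis using zero[OF hE(2)[OF 1(1)] hE(2)[OF 1(2)]] inj[OF 1] by (simp add: e_def)
      qed (use g[of i] g[of j] in \<open>auto simp: e_def\<close>)
    qed
    show "e i k \<le> e i j + e j k" if "i \<in> {..n}" "j \<in> {..n}" "k \<in> {..n}" for i j k
    proof -
      have le: "i < n \<or> i = n" "j < n \<or> j = n" "k < n \<or> k = n" using that by auto
      have tr: "d (h i) (h k) \<le> d (h i) (h j) + d (h j) (h k)" if "i < n" "j < n" "k < n"
        using triangle hE(2) that by blast
      have c: "d (h j) (h i) = d (h i) (h j)" "d (h k) (h j) = d (h j) (h k)" "d (h k) (h i) = d (h i) (h k)"
        by (rule commute)+
      show ?thesis
        using le t[of i j] t[of j k] t[of i k] g(1)[of i] g(1)[of j] g(1)[of k] tr c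
        unfolding e_def tri_def by (elim disjE) simp_all
    qed
  qed
  have dU: "d x y \<in> S" if "x \<in> U" "y \<in> U" "x \<noteq> y" for x y
  proof -
    have "distances_in S {x, y} d" using U that by (simp add: is_Urysohn_def)
    then show ?thesis using that by (simp add: distances_in_def)
  qed
  have "distances_in S {..n} e"
    unfolding distances_in_def
    using g inj hE dU by (auto simp: e_def le_less)
  moreover have "finite {..n}" by simp
  ultimately obtain F \<phi> where F: "F \<subseteq> U" "isometry_onto {..n} e F d \<phi>"
    using U eM unfolding is_Urysohn_def isometric_def by meson
  have \<phi>: "bij_betw \<phi> {..n} F" "\<And>i j. \<lbrakk>i \<le> n; j \<le> n\<rbrakk> \<Longrightarrow> d (\<phi> i) (\<phi> j) = e i j"
    using F(2) by (auto simp: isometry_onto_def)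
  have \<phi>inj: "inj_on \<phi> {0..<n}" using \<phi>(1) by (auto simp: bij_betw_def inj_on_def)
  have \<phi>U: "\<phi> i \<in> U" if "i \<le> n" for i using \<phi>(1) F(1) that by (auto simp: bij_betw_def)
  define \<psi> where "\<psi> = h \<circ> inv_into {0..<n} \<phi>"
  have \<psi>: "\<psi> (\<phi> i) = h i" if "i < n" for i using \<phi>inj that by (simp add: \<psi>_def)
  have "bij_betw \<psi> (\<phi> ` {0..<n}) E"
    unfolding \<psi>_def using \<phi>inj h by (intro bij_betw_trans[OF bij_betw_inv_into]) (auto simp: bij_betw_def)
  then have "isometry_onto (\<phi> ` {0..<n}) d E d \<psi>"
    using \<psi> \<phi>(2) by (auto simp: isometry_onto_def e_def)
  moreover have "\<phi> ` {0..<n} \<subseteq> U" using \<phi>U by auto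
  ultimately obtain \<gamma> where \<gamma>: "isometry_onto U d U d \<gamma>" "\<forall>x\<in>\<phi> ` {0..<n}. \<gamma> x = \<psi> x"
    using U E unfolding is_Urysohn_def ultrahomogeneous_def by (metis finite_atLeastLessThan finite_imageI)
  have "d (\<gamma> (\<phi> n)) x = g x" if x: "x \<in> E" for x
  proof -
    obtain j where j: "j < n" "x = h j" using x h by (auto simp: bij_betw_def)
    have "x = \<gamma> (\<phi> j)" using \<gamma>(2) \<psi>[OF j(1)] j by simp
    then have "d (\<gamma> (\<phi> n)) x = d (\<phi> n) (\<phi> j)"
      using \<gamma>(1) \<phi>U j(1) by (auto simp: isometry_onto_def)
    then show ?thesis using \<phi>(2)[of n j] j by (simp add: e_def)
  qed
  moreover have "\<gamma> (\<phi> n) \<in> U" using \<gamma>(1) \<phi>U[of n] by (auto simp: isometry_onto_def bij_betw_def)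
  ultimately show "\<exists>z\<in>U. \<forall>x\<in>E. d z x = g x" by blast
qed

theorem theorem63:
  fixes S :: "real set" and U :: "'a set" and d :: "'a \<Rightarrow> 'a \<Rightarrow> real"
  assumes "finite S" and "S \<subseteq> {0<..}" and "card S \<le> 4"
    and "four_values_condition S"
    and "is_Urysohn S U d"
  shows "indivisible U d"
proof -
  interpret Metric_space U d using assms(5) by (simp add: is_Urysohn_def)
  have dU: "d x y \<in> S" if "x \<in> U" "y \<in> U" "x \<noteq> y" for x y
  proof -
    have "distances_in S {x, y} d" using assms(5) that by (simp add: is_Urysohn_def)
    then show ?thesis using that by (simp add: distances_in_def)
  qed
  show ?thesis
  proof (cases "S = {}")
    case True
    then have "x = y" if "x \<in> U" "y \<in> U" for x y using dU that by blast
    then have "\<exists>c. \<forall>x\<in>U. col x = c" for col :: "'a \<Rightarrow> nat" by metis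
    moreover have "isometric U d U d"
      unfolding isometric_def isometry_onto_def by (intro exI[of _ id]) auto
    ultimately show ?thesis unfolding indivisible_def by blast
  next
    case False
    have S: "distance_set S" using distance_setI assms(1,2,4) False by blast
    have sat: "saturated S d U" using saturated_Urysohn assms(2,5) by blast
    have countable: "countable U" using assms(5) by (simp add: is_Urysohn_def)
    obtain f where f: "bij_betw f UNIV U" "urysohn_nat S (\<lambda>m n. d (f m) (f n))"
      by (rule urysohn_natI[OF S zero commute triangle dU sat countable])
    interpret N: urysohn_nat S "\<lambda>m n. d (f m) (f n)" by fact
    have fU: "f n \<in> U" for n using f(1) by (auto simp: bij_betw_def)
    show ?thesis
      unfolding indivisible_def
    proof (intro allI impI ballI)
      fix k :: nat and col assume col: "col \<in> U \<rightarrow> {..<k}"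
      have less: "(col \<circ> f) n < k" for n using col fU[of n] by auto
      have "\<exists>Y c. N.sat Y \<and> (\<forall>y\<in>Y. (col \<circ> f) y = c)"
        by (rule indivisible_colours[OF vertex_indivisible_le4[OF S assms(3)] S f(2)]) (rule less)
      then obtain Y c where Y: "N.sat Y" "\<forall>y\<in>Y. (col \<circ> f) y = c" by (elim exE conjE)
      \<comment> \<open>An embedding of the whole space into the monochromatic set; conjugated by
        the enumeration \<open>f\<close> it gives the copy inside \<open>U\<close>.\<close>
      obtain h where h: "range h \<subseteq> Y" "\<forall>m n. d (f (h m)) (f (h n)) = d (f m) (f n)"
        using N.embed_saturated[OF Y(1)] by (elim exE conjE)
      let ?g = "f \<circ> h \<circ> inv f"
      have inv: "f (inv f x) = x" if "x \<in> U" for x using f(1) that by (simp add: bij_betw_def f_inv_into_f)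
      have dg: "d (?g x) (?g y) = d x y" if "x \<in> U" "y \<in> U" for x y
        using h(2) inv that by simp
      have gU: "?g x \<in> U" for x using fU by simp
      have "inj_on ?g U"
        using dg zero gU unfolding inj_on_def by metis
      then have bij: "bij_betw ?g U (?g ` U)" by (simp add: bij_betw_def)
      have "isometry_onto (?g ` U) d U d (inv_into U ?g)"
        unfolding isometry_onto_def
      proof (intro conjI ballI)
        show "bij_betw (inv_into U ?g) (?g ` U) U" using bij by (rule bij_betw_inv_into)
        fix x y assume "x \<in> ?g ` U" "y \<in> ?g ` U"
        then obtain u v where uv: "u \<in> U" "v \<in> U" "x = ?g u" "y = ?g v" by blast
        have "inv_into U ?g x = u" "inv_into U ?g y = v"
          using uv inv_into_f_f[OF \<open>inj_on ?g U\<close>] by blast+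
        then show "d (inv_into U ?g x) (inv_into U ?g y) = d x y" using dg uv by simp
      qed
      moreover have "?g ` U \<subseteq> U" using gU by blast
      moreover have "\<forall>x\<in>?g ` U. col x = c" using Y(2) h(1) by auto
      ultimately show "\<exists>M'\<subseteq>U. isometric M' d U d \<and> (\<exists>c. \<forall>x\<in>M'. col x = c)"
        unfolding isometric_def by blast
    qed
  qed
qed

end
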